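(* Let $\Omega\subset\mathbb H^n$ be an open set, $u\in C^\infty(\Omega)$, and for $s\in\mathbb R$ let $\Sigma^s=\{p\in\Omega:u(p)=s\}$. Let $R\subset\Omega$ be an $\mathcal S^{2n+1}$-rectifiable set with unit horizontal normal $\nu_R$. Then, for a.e. $s\in\mathbb R$ there exists a Radon measure $\mu_R^s$ on $R\cap\Sigma^s$ such that for any Borel function $h:\Omega\to[0,\infty)$ the function \[ s\mapsto \int_{\Omega}h\,\frac{|\nabla_H u|_g}{|\nabla u|_g}\,d\mu_R^{s} \] is $\mathcal L^1$-measurable, and the coarea formula \[ \int_{\mathbb R} \int_{\Omega}h\,\frac{|\nabla_H u|_g}{|\nabla u|_g}\,d\mu_R^{s}\, ds= \int_{R}h\,\sqrt{|\nabla_H u|_g^2-\langle \nu_R,\nabla_H u\rangle_g^2}\,d\mathcal S^{2n+1} \] holds.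
   Context: Heisenberg group: $\mathbb H^n=\mathbb C^n\times\mathbb R$ with $(z,t)\ast(\zeta,\tau)=(z+\zeta,\,t+\tau+2\,\mathrm{Im}\langle z,\bar\zeta\rangle)$, $\langle z,\bar\zeta\rangle=\sum_j z_j\bar\zeta_j$, $z_j=x_j+iy_j$. Vector fields $X_j=\partial_{x_j}+2y_j\partial_t$, $Y_j=\partial_{y_j}-2x_j\partial_t$, $T=\partial_t$. $H=\mathrm{span}\{X_1,\dots,X_n,Y_1,\dots,Y_n\}$; $g=\langle\cdot,\cdot\rangle_g$ is the left-invariant Riemannian metric making $X_1,\dots,Y_n,T$ orthonormal, $|\cdot|_g$ its norm. $\nabla_Hf=\sum_j (X_jf)X_j+(Y_jf)Y_j$ and $\nabla f=\nabla_Hf+(Tf)T$. Measures on $R\cap\Sigma^s$ are regarded as measures on $\Omega$. Balls and spherical measure: $\|(z,t)\|_\infty=\max\{|z|,|t|^{1/2}\}$, $U_r=\{\|q\|_\infty<r\}$, $U_r(p)=p\ast U_r$; $\mathcal S^{2n+1}(E)=\sup_{\delta>0}\inf\{c\sum_i r_i^{2n+1}:E\subset\bigcup_iU_{r_i}(p_i),\ r_i<\delta\}$, where $c=c(n)>0$ is the normalization constant for which the $H$-perimeter measure of any set of locally finite $H$-perimeter equals $\mathcal S^{2n+1}$ restricted to its $H$-reduced boundary. $H$-regular hypersurfaces: $f\in C(\Omega)$ is of class $C^1_H(\Omega)$ if its distributional derivatives $X_jf,Y_jf$ are continuous functions. $S\subset\mathbb H^n$ is an $H$-regular hypersurface if for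 each $p\in S$ there are $r>0$ and $f\in C^1_H(B_r(p))$ with $S\cap B_r(p)=\{f=0\}$ and $\nabla_Hf(p)\ne0$, where $B_r(p)=p\ast\{(z,t):(|z|^4+t^2)^{1/4}<r\}$. Its horizontal normal is $\nu_S=\nabla_Hf/|\nabla_Hf|_g$, defined up to sign. Rectifiability: $R$ is $\mathcal S^{2n+1}$-rectifiable if there are $H$-regular hypersurfaces $(S_j)_{j\in\mathbb N}$ with $\mathcal S^{2n+1}(R\setminus\bigcup_jS_j)=0$. Its normal is defined by $\nu_R(p)=\nu_{S_{\bar\jmath}}(p)$ where $\bar\jmath$ is the unique integer with $p\in S_{\bar\jmath}\setminus\bigcup_{j<\bar\jmath}S_j$; it is well defined $\mathcal S^{2n+1}$-a.e. on $R$ up to sign, and the formula does not depend on the sign.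
   Formalization: R is taken to be S^{2n+1}-measurable, and "Radon measure" means sigma-finite, inner regular by compact subsets of R∩Σ^s, and locally finite at those points of Ω near which R has finite S^{2n+1} measure; local finiteness elsewhere can fail (n=1, R the union of planes x=q, q rational, u=t). *)

theory Defs
  imports "HOL-Analysis.Analysis"
begin

section \<open>The Heisenberg group\<close>

type_synonym 'n heis = "(complex ^ 'n) \<times> real"

definition hdot :: "complex ^ 'n::finite \<Rightarrow> complex ^ 'n \<Rightarrow> complex" where
  "hdot z w = (\<Sum>j\<in>UNIV. z $ j * cnj (w $ j))"

definition hmul :: "'n::finite heis \<Rightarrow> 'n heis \<Rightarrow> 'n heis" (infixl "\<star>" 70) where
  "p \<star> q = (fst p + fst q, snd p + snd q + 2 * Im (hdot (fst p) (fst q)))"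

text \<open>Tangent vectors at any point are written in the Euclidean coordinates of the ambient space,
  so a vector field is a map from points to \<^typ>\<open>'n heis\<close>; \<open>z $ j = x\<^sub>j + i y\<^sub>j\<close>.\<close>

definition hX :: "'n::finite \<Rightarrow> 'n heis \<Rightarrow> 'n heis" where
  "hX j p = (axis j 1, 2 * Im (fst p $ j))"

definition hY :: "'n::finite \<Rightarrow> 'n heis \<Rightarrow> 'n heis" where
  "hY j p = (axis j \<i>, - 2 * Re (fst p $ j))"

definition hT :: "'n::finite heis \<Rightarrow> 'n heis" where
  "hT p = (0, 1)"

text \<open>The coefficient of \<open>hT p\<close> in the expansion of \<open>v\<close> with respect to the frame at \<open>p\<close>.  The
  coefficients of \<open>hX j p\<close> and \<open>hY j p\<close> are the real and imaginary parts of \<open>fst v $ j\<close>.\<close>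

definition T_coeff :: "'n::finite heis \<Rightarrow> 'n heis \<Rightarrow> real" where
  "T_coeff p v = snd v - 2 * Im (hdot (fst p) (fst v))"

definition g_inner :: "'n::finite heis \<Rightarrow> 'n heis \<Rightarrow> 'n heis \<Rightarrow> real" where
  "g_inner p v w = fst v \<bullet> fst w + T_coeff p v * T_coeff p w"

definition g_norm :: "'n::finite heis \<Rightarrow> 'n heis \<Rightarrow> real" where
  "g_norm p v = sqrt (g_inner p v v)"

lemma Im_hdot_axis:
  "Im (hdot z (axis j a)) = Im (z $ j * cnj a)"
proof -
  have "hdot z (axis j a) = (\<Sum>k\<in>UNIV. if k = j then z $ j * cnj a else 0)"
    unfolding hdot_def by (rule sum.cong) (auto simp: axis_def)
  then show ?thesis by simp
qed

lemma T_coeff_frame [simp]: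
  "T_coeff p (hX j p) = 0" "T_coeff p (hY j p) = 0" "T_coeff p (hT p) = 1"
  by (simp_all add: T_coeff_def hX_def hY_def hT_def Im_hdot_axis) (simp add: hdot_def)

lemma g_frame_orthonormal:
  "g_inner p (hX j p) (hX k p) = of_bool (j = k)"
  "g_inner p (hY j p) (hY k p) = of_bool (j = k)"
  "g_inner p (hX j p) (hY k p) = 0"
  "g_inner p (hX j p) (hT p) = 0"
  "g_inner p (hY j p) (hT p) = 0"
  "g_inner p (hT p) (hT p) = 1"
  unfolding g_inner_def T_coeff_frame
  by (auto simp: hX_def hY_def hT_def inner_axis_axis inner_complex_def)

lemma g_inner_bilinear: "bilinear (g_inner p)"
proof -
  have hdot_add: "hdot z (w + w') = hdot z w + hdot z w'" for z w w' :: "complex ^ 'a"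
    by (simp add: hdot_def algebra_simps sum.distrib)
  have hdot_scale: "hdot z (c *\<^sub>R w) = c *\<^sub>R hdot z w" for z w :: "complex ^ 'a" and c
    by (simp add: hdot_def scaleR_sum_right)
  have "T_coeff p (v + w) = T_coeff p v + T_coeff p w"
       "T_coeff p (c *\<^sub>R v) = c * T_coeff p v" for v w c
    by (simp_all add: T_coeff_def hdot_add hdot_scale algebra_simps)
  then show ?thesis
    by (auto simp: bilinear_def linear_iff g_inner_def inner_add_left inner_add_right algebra_simps)
qed

lemma frame_expansion:
  "v = (\<Sum>j\<in>UNIV. Re (fst v $ j) *\<^sub>R hX j p + Im (fst v $ j) *\<^sub>R hY j p) + T_coeff p v *\<^sub>R hT p"
proof (rule prod_eqI)
  have 1: "(\<Sum>j\<in>UNIV. Re (w $ j) *\<^sub>R axis j 1 + Im (w $ j) *\<^sub>R axis j \<i>) = w" for w :: "complex ^ 'a"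
  proof (rule vec_eq_iff[THEN iffD2], rule allI)
    fix k
    have "(\<Sum>j\<in>UNIV. Re (w $ j) *\<^sub>R axis j 1 + Im (w $ j) *\<^sub>R axis j \<i>) $ k
        = (\<Sum>j\<in>UNIV. if j = k then w $ k else 0)"
      unfolding sum_component by (rule sum.cong) (auto simp: axis_def complex_eq_iff)
    then show "(\<Sum>j\<in>UNIV. Re (w $ j) *\<^sub>R axis j 1 + Im (w $ j) *\<^sub>R axis j \<i>) $ k = w $ k" by simp
  qed
  show "fst v = fst ((\<Sum>j\<in>UNIV. Re (fst v $ j) *\<^sub>R hX j p + Im (fst v $ j) *\<^sub>R hY j p) + T_coeff p v *\<^sub>R hT p)"
    by (simp add: fst_sum hX_def hY_def hT_def 1)
  show "snd v = snd ((\<Sum>j\<in>UNIV. Re (fst v $ j) *\<^sub>R hX j p + Im (fst v $ j) *\<^sub>R hY j p) + T_coeff p v *\<^sub>R hT p)"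
    by (simp add: snd_sum hX_def hY_def hT_def T_coeff_def hdot_def sum_distrib_left
        sum.distrib[symmetric] sum_subtractf[symmetric] algebra_simps)
qed

text \<open>The open sets \<open>U_ball p r = p \<star> U\<^sub>r\<close> and \<open>B_ball p r = B\<^sub>r(p)\<close>.\<close>

definition box_norm :: "'n::finite heis \<Rightarrow> real" where
  "box_norm q = max (norm (fst q)) (sqrt \<bar>snd q\<bar>)"

definition U_ball :: "'n::finite heis \<Rightarrow> real \<Rightarrow> 'n heis set" where
  "U_ball p r = (\<lambda>q. p \<star> q) ` {q. box_norm q < r}"

definition B_ball :: "'n::finite heis \<Rightarrow> real \<Rightarrow> 'n heis set" where
  "B_ball p r = (\<lambda>q. p \<star> q) ` {q. root 4 (norm (fst q) ^ 4 + snd q ^ 2) < r}"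


section \<open>Smooth functions and gradients\<close>

text \<open>\<open>k\<close> times continuously differentiable on an open set.\<close>

primrec Ck_on :: "nat \<Rightarrow> 'a::euclidean_space set \<Rightarrow> ('a \<Rightarrow> 'b::euclidean_space) \<Rightarrow> bool" where
  "Ck_on 0 S f \<longleftrightarrow> continuous_on S f"
| "Ck_on (Suc k) S f \<longleftrightarrow>
     (\<forall>x\<in>S. f differentiable (at x)) \<and> (\<forall>v. Ck_on k S (\<lambda>x. frechet_derivative f (at x) v))"

definition smooth_on :: "'a::euclidean_space set \<Rightarrow> ('a \<Rightarrow> 'b::euclidean_space) \<Rightarrow> bool" where
  "smooth_on S f \<longleftrightarrow> (\<forall>k. Ck_on k S f)"

definition deriv_along ::
  "('n::finite heis \<Rightarrow> 'n heis) \<Rightarrow> ('n heis \<Rightarrow> real) \<Rightarrow> 'n heis \<Rightarrow> real" where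
  "deriv_along V f p = frechet_derivative f (at p) (V p)"

definition grad_H :: "('n::finite heis \<Rightarrow> real) \<Rightarrow> 'n heis \<Rightarrow> 'n heis" where
  "grad_H f p =
     (\<Sum>j\<in>UNIV. deriv_along (hX j) f p *\<^sub>R hX j p + deriv_along (hY j) f p *\<^sub>R hY j p)"

definition grad :: "('n::finite heis \<Rightarrow> real) \<Rightarrow> 'n heis \<Rightarrow> 'n heis" where
  "grad f p = grad_H f p + deriv_along hT f p *\<^sub>R hT p"

definition compact_support_in :: "'a::euclidean_space set \<Rightarrow> ('a \<Rightarrow> 'b::euclidean_space) \<Rightarrow> bool" where
  "compact_support_in A \<phi> \<longleftrightarrow>
     compact (closure {x. \<phi> x \<noteq> 0}) \<and> closure {x. \<phi> x \<noteq> 0} \<subseteq> A"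


section \<open>H-regular hypersurfaces\<close>

text \<open>\<open>g\<close> is the distributional derivative \<open>V f\<close> in \<open>U\<close>.  The formula is the right one for the
  fields \<open>hX j\<close>, \<open>hY j\<close>, which are divergence free, hence formally skew-adjoint.\<close>

definition is_distr_deriv ::
  "'n::finite heis set \<Rightarrow> ('n heis \<Rightarrow> 'n heis) \<Rightarrow> ('n heis \<Rightarrow> real) \<Rightarrow> ('n heis \<Rightarrow> real) \<Rightarrow> bool" where
  "is_distr_deriv U V f g \<longleftrightarrow>
     (\<forall>\<phi>. smooth_on UNIV \<phi> \<and> compact_support_in U \<phi> \<longrightarrow>
        (LINT p:U|lborel. f p * deriv_along V \<phi> p) = - (LINT p:U|lborel. g p * \<phi> p))"

definition C1_H :: "'n::finite heis set \<Rightarrow> ('n heis \<Rightarrow> real) \<Rightarrow> bool" where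
  "C1_H U f \<longleftrightarrow> continuous_on U f \<and>
     (\<forall>j. (\<exists>g. continuous_on U g \<and> is_distr_deriv U (hX j) f g) \<and>
          (\<exists>g. continuous_on U g \<and> is_distr_deriv U (hY j) f g))"

text \<open>On an open set \<open>U\<close> a continuous distributional derivative is unique, so the values of
  \<open>distr_deriv U V f\<close> inside \<open>U\<close> do not depend on the choice made here.\<close>

definition distr_deriv ::
  "'n::finite heis set \<Rightarrow> ('n heis \<Rightarrow> 'n heis) \<Rightarrow> ('n heis \<Rightarrow> real) \<Rightarrow> 'n heis \<Rightarrow> real" where
  "distr_deriv U V f = (SOME g. continuous_on U g \<and> is_distr_deriv U V f g)"

definition distr_grad_H :: "'n::finite heis set \<Rightarrow> ('n heis \<Rightarrow> real) \<Rightarrow> 'n heis \<Rightarrow> 'n heis" where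
  "distr_grad_H U f p =
     (\<Sum>j\<in>UNIV. distr_deriv U (hX j) f p *\<^sub>R hX j p + distr_deriv U (hY j) f p *\<^sub>R hY j p)"

definition defines_near ::
  "'n::finite heis set \<Rightarrow> 'n heis \<Rightarrow> real \<Rightarrow> ('n heis \<Rightarrow> real) \<Rightarrow> bool" where
  "defines_near S p r f \<longleftrightarrow> r > 0 \<and> C1_H (B_ball p r) f \<and>
     S \<inter> B_ball p r = {q \<in> B_ball p r. f q = 0} \<and> distr_grad_H (B_ball p r) f p \<noteq> 0"

definition H_regular :: "'n::finite heis set \<Rightarrow> bool" where
  "H_regular S \<longleftrightarrow> (\<forall>p\<in>S. \<exists>r f. defines_near S p r f)"

text \<open>A relation rather than a function, because the normal is only determined up to sign.\<close>

definition is_normal_at :: "'n::finite heis set \<Rightarrow> 'n heis \<Rightarrow> 'n heis \<Rightarrow> bool" where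
  "is_normal_at S p v \<longleftrightarrow> (\<exists>r f. defines_near S p r f \<and>
     v = (1 / g_norm p (distr_grad_H (B_ball p r) f p)) *\<^sub>R distr_grad_H (B_ball p r) f p)"


section \<open>Spherical measure\<close>

text \<open>Countable covers are indexed by \<^typ>\<open>nat\<close> and have positive radii; finite covers can be
  padded by balls of arbitrarily small total content, so they give the same infimum.\<close>

definition sph_pre :: "real \<Rightarrow> real \<Rightarrow> 'n::finite heis set \<Rightarrow> ennreal" where
  "sph_pre c \<delta> E =
     (INF (p, r) \<in> {(p :: nat \<Rightarrow> 'n heis, r :: nat \<Rightarrow> real).
          (\<forall>i. 0 < r i \<and> r i < \<delta>) \<and> E \<subseteq> (\<Union>i. U_ball (p i) (r i))}.
        \<Sum>i. ennreal (c * r i ^ (2 * CARD('n) + 1)))"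

definition sph_outer :: "real \<Rightarrow> 'n::finite heis set \<Rightarrow> ennreal" where
  "sph_outer c E = (SUP \<delta> \<in> {0<..}. sph_pre c \<delta> E)"

definition sph_measure :: "real \<Rightarrow> 'n::finite heis measure" where
  "sph_measure c = measure_of UNIV (lambda_system UNIV UNIV (sph_outer c)) (sph_outer c)"

lemma sph_pre_mono: "A \<subseteq> B \<Longrightarrow> sph_pre c \<delta> A \<le> sph_pre c \<delta> B"
  unfolding sph_pre_def by (rule INF_superset_mono) auto

lemma sph_outer_empty:
  fixes c :: real
  assumes "c > 0"
  shows "sph_outer c ({} :: 'n::finite heis set) = 0"
proof -
  have le: "sph_pre c \<delta> ({} :: 'n heis set) \<le> ennreal e" if "\<delta> > 0" "e > 0" for \<delta> e :: real
  proof -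
    define N where "N = 2 * CARD('n) + 1"
    define d where "d = min (min 1 (\<delta> / 2)) (e / c)"
    have d: "0 < d" "d \<le> 1" "d < \<delta>" "d \<le> e / c"
      using that assms by (auto simp: d_def min_less_iff_disj)
    then have "c * d \<le> e" using assms by (simp add: field_simps)
    note d = d this
    have "sph_pre c \<delta> ({} :: 'n heis set) \<le> (\<Sum>i. ennreal (c * (d * (1/2) ^ Suc i) ^ N))"
      unfolding sph_pre_def N_def
    proof (rule INF_lower2[of "(\<lambda>_. 0, \<lambda>i. d * (1/2) ^ Suc i)"])
      have "d * (1/2) ^ Suc i < \<delta>" for i
      proof -
        have "d * (1/2) ^ Suc i \<le> d * 1"
          using d by (intro mult_left_mono power_le_one) simp_all
        also have "\<dots> < \<delta>" using d by simp
        finally show ?thesis .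
      qed
      then show "(\<lambda>_. 0, \<lambda>i. d * (1/2) ^ Suc i) \<in> {(p, r).
          (\<forall>i. 0 < r i \<and> r i < \<delta>) \<and> {} \<subseteq> (\<Union>i. U_ball (p i) (r i))}"
        using d by simp
    qed simp
    also have "\<dots> \<le> (\<Sum>i. ennreal (e * (1/2) ^ Suc i))"
    proof (intro suminf_le ennreal_leI summableI)
      fix i
      let ?x = "d * (1/2::real) ^ Suc i"
      have "(1/2::real) ^ Suc i \<le> 1" by (rule power_le_one) simp_all
      then have x: "0 \<le> ?x" "?x \<le> 1"
        using d by (simp, intro mult_le_one) simp_all
      have "?x ^ N \<le> ?x ^ 1"
        using x by (intro power_decreasing) (auto simp: N_def)
      then have "c * ?x ^ N \<le> c * ?x" using assms by simp
      also have "\<dots> \<le> e * (1/2) ^ Suc i"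
        using d mult_right_mono[of "c * d" e "(1/2) ^ Suc i"] by (simp add: mult.assoc)
      finally show "c * ?x ^ N \<le> e * (1/2) ^ Suc i" .
    qed
    also have "\<dots> = ennreal e"
      using that power_half_series sums_mult[OF power_half_series, of e]
      by (intro suminf_ennreal_eq) auto
    finally show ?thesis .
  qed
  have "sph_pre c \<delta> ({} :: 'n heis set) = 0" if "\<delta> > 0" for \<delta> :: real
  proof -
    have "sph_pre c \<delta> ({} :: 'n heis set) \<le> 0"
    proof (rule ennreal_le_epsilon)
      fix e :: real assume "0 < e"
      then show "sph_pre c \<delta> ({} :: 'n heis set) \<le> 0 + ennreal e"
        using le[OF that, of e] by simp
    qed
    then show ?thesis by simp
  qed
  then have "sph_outer c ({} :: 'n heis set) = (SUP \<delta> \<in> {0::real<..}. 0)"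
    unfolding sph_outer_def by (intro SUP_cong) auto
  then show ?thesis by simp
qed

lemma sph_pre_subadditive:
  fixes A :: "nat \<Rightarrow> 'n::finite heis set"
  shows "sph_pre c \<delta> (\<Union>n. A n) \<le> (\<Sum>n. sph_pre c \<delta> (A n))"
proof (rule ennreal_le_epsilon)
  fix e :: real
  assume e: "0 < e" and fin: "(\<Sum>n. sph_pre c \<delta> (A n)) < top"
  define N where "N = 2 * CARD('n) + 1"
  define cover where "cover = (\<lambda>n. {(p :: nat \<Rightarrow> 'n heis, r :: nat \<Rightarrow> real).
      (\<forall>i. 0 < r i \<and> r i < \<delta>) \<and> A n \<subseteq> (\<Union>i. U_ball (p i) (r i))})"
  have "\<exists>x\<in>cover n. (\<Sum>i. ennreal (c * snd x i ^ N)) < sph_pre c \<delta> (A n) + e * (1/2) ^ Suc n" for n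
  proof -
    have "sph_pre c \<delta> (A n) < sph_pre c \<delta> (A n) + e * (1/2) ^ Suc n"
      using e fin by (auto simp: less_top dest!: ennreal_suminf_lessD)
    then show ?thesis
      unfolding sph_pre_def N_def cover_def INF_less_iff by (simp add: case_prod_beta)
  qed
  then obtain x where x: "\<And>n. x n \<in> cover n"
    and le: "\<And>n. (\<Sum>i. ennreal (c * snd (x n) i ^ N)) < sph_pre c \<delta> (A n) + e * (1/2) ^ Suc n"
    by metis
  define p where "p = (\<lambda>k. case prod_decode k of (n, i) \<Rightarrow> fst (x n) i)"
  define r where "r = (\<lambda>k. case prod_decode k of (n, i) \<Rightarrow> snd (x n) i)"
  have pr: "p (prod_encode (n, i)) = fst (x n) i" "r (prod_encode (n, i)) = snd (x n) i" for n i
    by (simp_all add: p_def r_def)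
  have cov: "(\<forall>k. 0 < r k \<and> r k < \<delta>) \<and> (\<Union>n. A n) \<subseteq> (\<Union>k. U_ball (p k) (r k))"
  proof (intro conjI allI subsetI)
    fix k
    show "0 < r k" "r k < \<delta>"
      using x[of "fst (prod_decode k)"] by (auto simp: r_def cover_def case_prod_beta)
  next
    fix q assume "q \<in> (\<Union>n. A n)"
    then obtain n where "q \<in> A n" by auto
    then obtain i where "q \<in> U_ball (fst (x n) i) (snd (x n) i)"
      using x[of n] by (auto simp: cover_def case_prod_beta)
    then show "q \<in> (\<Union>k. U_ball (p k) (r k))" using pr by (metis UN_I UNIV_I)
  qed
  have "sph_pre c \<delta> (\<Union>n. A n) \<le> (\<Sum>k. ennreal (c * r k ^ N))"
    unfolding sph_pre_def N_def by (rule INF_lower2[of "(p, r)"]) (use cov in auto)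
  also have "\<dots> = (\<Sum>n. \<Sum>i. ennreal (c * snd (x n) i ^ N))"
    using suminf_ennreal_2dimen[of "\<lambda>n. \<Sum>i. ennreal (c * snd (x n) i ^ N)"
        "\<lambda>(n, i). ennreal (c * snd (x n) i ^ N)"]
    by (simp add: r_def comp_def case_prod_beta)
  also have "\<dots> \<le> (\<Sum>n. sph_pre c \<delta> (A n) + e * (1/2) ^ Suc n)"
    using le by (intro suminf_le less_imp_le) auto
  also have "\<dots> = (\<Sum>n. sph_pre c \<delta> (A n)) + (\<Sum>n. ennreal e * ennreal ((1/2) ^ Suc n))"
    using e by (subst suminf_add[symmetric])
      (auto simp del: ennreal_suminf_cmult simp add: ennreal_mult[symmetric])
  also have "\<dots> = (\<Sum>n. sph_pre c \<delta> (A n)) + e"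
    unfolding ennreal_suminf_cmult
    by (subst suminf_ennreal_eq[OF zero_le_power power_half_series]) auto
  finally show "sph_pre c \<delta> (\<Union>n. A n) \<le> (\<Sum>n. sph_pre c \<delta> (A n)) + e" .
qed

lemma outer_measure_space_sph:
  assumes "c > 0"
  shows "outer_measure_space UNIV (sph_outer c :: 'n::finite heis set \<Rightarrow> ennreal)"
  unfolding outer_measure_space_def
proof (intro conjI)
  show "positive UNIV (sph_outer c :: 'n heis set \<Rightarrow> ennreal)"
    by (simp add: positive_def sph_outer_empty[OF assms])
  show "increasing UNIV (sph_outer c :: 'n heis set \<Rightarrow> ennreal)"
    unfolding increasing_def sph_outer_def by (auto intro!: SUP_mono sph_pre_mono)
  show "countably_subadditive UNIV (sph_outer c :: 'n heis set \<Rightarrow> ennreal)"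
    unfolding countably_subadditive_def
  proof (intro allI impI)
    fix A :: "nat \<Rightarrow> 'n heis set"
    show "sph_outer c (\<Union>i. A i) \<le> (\<Sum>i. sph_outer c (A i))"
      unfolding sph_outer_def[of c "\<Union>i. A i"]
    proof (rule SUP_least)
      fix \<delta> :: real assume "\<delta> \<in> {0<..}"
      then have "(\<Sum>i. sph_pre c \<delta> (A i)) \<le> (\<Sum>i. sph_outer c (A i))"
        unfolding sph_outer_def by (intro suminf_le) (auto intro: SUP_upper)
      then show "sph_pre c \<delta> (\<Union>i. A i) \<le> (\<Sum>i. sph_outer c (A i))"
        using sph_pre_subadditive order_trans by blast
    qed
  qed
qed

lemma measure_space_sph:
  assumes "c > 0"
  shows "measure_space UNIV (lambda_system UNIV UNIV (sph_outer c))
           (sph_outer c :: 'n::finite heis set \<Rightarrow> ennreal)"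
  using sigma_algebra.caratheodory_lemma[OF sigma_algebra_Pow, of UNIV "sph_outer c"]
    outer_measure_space_sph[OF assms] by simp

lemma
  fixes A :: "'n::finite heis set"
  assumes "c > 0"
  shows sets_sph_measure:
      "sets (sph_measure c :: 'n heis measure) = lambda_system UNIV UNIV (sph_outer c)"
    and emeasure_sph_measure:
      "A \<in> sets (sph_measure c) \<Longrightarrow> emeasure (sph_measure c) A = sph_outer c A"
proof -
  let ?L = "lambda_system UNIV UNIV (sph_outer c :: 'n heis set \<Rightarrow> ennreal)"
  have ms: "measure_space UNIV ?L (sph_outer c)" by (rule measure_space_sph[OF assms])
  then have sa: "sigma_algebra UNIV ?L" by (simp add: measure_space_def)
  show s: "sets (sph_measure c :: 'n heis measure) = ?L"
    unfolding sph_measure_def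
    by (rule sigma_algebra.sets_measure_of_eq[OF sa])
  show "A \<in> sets (sph_measure c) \<Longrightarrow> emeasure (sph_measure c) A = sph_outer c A"
    unfolding s unfolding sph_measure_def
    by (rule emeasure_measure_of_sigma[OF sa])
      (use ms in \<open>auto simp: measure_space_def\<close>)
qed


section \<open>H-perimeter and the normalization of the spherical measure\<close>

text \<open>Horizontal sections are given here by their coefficients in the orthonormal frame:
  \<open>\<phi> p $ j = a + i b\<close> stands for \<open>a X\<^sub>j + b Y\<^sub>j\<close>, so that the \<open>g\<close>-inner product and norm of
  horizontal vectors are the Euclidean ones of \<^typ>\<open>complex ^ 'n\<close>.\<close>

definition div_H :: "('n::finite heis \<Rightarrow> complex ^ 'n) \<Rightarrow> 'n heis \<Rightarrow> real" where
  "div_H \<phi> p = (\<Sum>j\<in>UNIV. deriv_along (hX j) (\<lambda>q. Re (\<phi> q $ j)) p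
                        + deriv_along (hY j) (\<lambda>q. Im (\<phi> q $ j)) p)"

definition H_perimeter :: "'n::finite heis set \<Rightarrow> 'n heis set \<Rightarrow> ennreal" where
  "H_perimeter E A =
     (SUP \<phi> \<in> {\<phi>. Ck_on 1 UNIV \<phi> \<and> compact_support_in A \<phi> \<and> (\<forall>p. norm (\<phi> p) \<le> 1)}.
        ennreal (LINT p:E|lebesgue. div_H \<phi> p))"

text \<open>For \<open>E\<close> of locally finite perimeter, this is the Borel measure with value
  \<open>H_perimeter E A\<close> on every open set \<open>A\<close>.\<close>

definition perimeter_measure :: "'n::finite heis set \<Rightarrow> 'n heis measure" where
  "perimeter_measure E =
     measure_of UNIV (sets borel) (\<lambda>B. INF A \<in> {A. open A \<and> B \<subseteq> A}. H_perimeter E A)"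

definition locally_finite_perimeter :: "'n::finite heis set \<Rightarrow> bool" where
  "locally_finite_perimeter E \<longleftrightarrow> E \<in> sets lebesgue \<and>
     (\<forall>A. open A \<and> bounded A \<longrightarrow> H_perimeter E A < \<infinity>)"

definition is_perimeter_normal :: "'n::finite heis set \<Rightarrow> ('n heis \<Rightarrow> complex ^ 'n) \<Rightarrow> bool" where
  "is_perimeter_normal E \<nu> \<longleftrightarrow> \<nu> \<in> borel_measurable borel \<and>
     (AE p in perimeter_measure E. norm (\<nu> p) = 1) \<and>
     (\<forall>\<phi>. Ck_on 1 UNIV \<phi> \<and> compact_support_in UNIV \<phi> \<longrightarrow>
        (LINT p:E|lebesgue. div_H \<phi> p) = - (LINT p|perimeter_measure E. \<phi> p \<bullet> \<nu> p))"

definition reduced_boundary :: "'n::finite heis set \<Rightarrow> ('n heis \<Rightarrow> complex ^ 'n) \<Rightarrow> 'n heis set" where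
  "reduced_boundary E \<nu> = {p.
     (\<forall>r>0. emeasure (perimeter_measure E) (U_ball p r) > 0) \<and>
     ((\<lambda>r. (1 / measure (perimeter_measure E) (U_ball p r)) *\<^sub>R
             (LINT q:U_ball p r|perimeter_measure E. \<nu> q)) \<longlongrightarrow> \<nu> p) (at_right 0) \<and>
     norm (\<nu> p) = 1}"

text \<open>The positive constant \<open>c = c(n)\<close> for which perimeter measures are spherical measures of
  reduced boundaries.  It only depends on the index type, passed as \<open>TYPE('n)\<close>.\<close>

definition perimeter_normalized :: "'n::finite itself \<Rightarrow> real \<Rightarrow> bool" where
  "perimeter_normalized (N :: 'n itself) c \<longleftrightarrow> c > 0 \<and>
     (\<forall>(E :: 'n heis set) \<nu>. locally_finite_perimeter E \<and> is_perimeter_normal E \<nu> \<longrightarrow>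
        (\<forall>B\<in>sets borel. emeasure (perimeter_measure E) B = sph_outer c (B \<inter> reduced_boundary E \<nu>)))"


section \<open>Rectifiable sets\<close>

definition rectifying_sequence ::
  "real \<Rightarrow> 'n::finite heis set \<Rightarrow> (nat \<Rightarrow> 'n heis set) \<Rightarrow> bool" where
  "rectifying_sequence c R S \<longleftrightarrow> (\<forall>j. H_regular (S j)) \<and> sph_outer c (R - (\<Union>j. S j)) = 0"

text \<open>Measurability is part of the notion: the measure of \<open>R\<close> and integrals over \<open>R\<close> have to make
  sense.\<close>

definition H_rectifiable :: "real \<Rightarrow> 'n::finite heis set \<Rightarrow> bool" where
  "H_rectifiable c R \<longleftrightarrow> R \<in> sets (sph_measure c) \<and> (\<exists>S. rectifying_sequence c R S)"

definition is_unit_normal ::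
  "real \<Rightarrow> 'n::finite heis set \<Rightarrow> ('n heis \<Rightarrow> 'n heis) \<Rightarrow> bool" where
  "is_unit_normal c R \<nu> \<longleftrightarrow> (\<exists>S. rectifying_sequence c R S \<and>
     (\<forall>p \<in> R \<inter> (\<Union>j. S j). is_normal_at (S (LEAST j. p \<in> S j)) p (\<nu> p)))"


section \<open>Radon measures on slices\<close>

definition level_set :: "'n::finite heis set \<Rightarrow> ('n heis \<Rightarrow> real) \<Rightarrow> real \<Rightarrow> 'n heis set" where
  "level_set \<Omega> u s = {p \<in> \<Omega>. u p = s}"

definition locally_finite_at :: "('n::finite heis set \<Rightarrow> ennreal) \<Rightarrow> 'n heis \<Rightarrow> bool" where
  "locally_finite_at m p \<longleftrightarrow> (\<exists>V. open V \<and> p \<in> V \<and> m V < \<infinity>)"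

text \<open>\<open>\<mu>\<close> is a Radon measure on \<open>R \<inter> L\<close>, regarded as a measure on \<open>\<Omega>\<close>: a Borel measure on \<open>\<Omega>\<close>,
  concentrated on \<open>R \<inter> L\<close>, sigma-finite, inner regular with respect to compact subsets of
  \<open>R \<inter> L\<close>, and locally finite.

  Local finiteness is claimed at those points of \<open>\<Omega>\<close> near which \<open>R\<close> has finite spherical measure.
  It cannot be claimed elsewhere: for \<open>n = 1\<close>, the union \<open>R\<close> of the vertical planes \<open>x = q\<close> with
  \<open>q\<close> rational and \<open>u(z, t) = t\<close>, the coarea formula forces almost every slice measure to have
  infinite mass near each point of \<open>R\<close>.  If \<open>R\<close> has locally finite spherical measure in \<open>\<Omega>\<close>, then
  \<open>\<mu>\<close> is a Radon measure on \<open>\<Omega>\<close> in the usual sense.\<close>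

definition radon_slice ::
  "real \<Rightarrow> 'n::finite heis set \<Rightarrow> 'n heis set \<Rightarrow> 'n heis set \<Rightarrow> 'n heis measure \<Rightarrow> bool" where
  "radon_slice c \<Omega> R L \<mu> \<longleftrightarrow>
     sets \<mu> = sets (restrict_space borel \<Omega>) \<and>
     (AE p in \<mu>. p \<in> R \<inter> L) \<and>
     sigma_finite_measure \<mu> \<and>
     (\<forall>A\<in>sets \<mu>. emeasure \<mu> A = (SUP K \<in> {K. compact K \<and> K \<subseteq> A \<inter> R \<inter> L}. emeasure \<mu> K)) \<and>
     (\<forall>p\<in>\<Omega>. locally_finite_at (\<lambda>V. sph_outer c (R \<inter> V)) p \<longrightarrow>
             locally_finite_at (\<lambda>V. emeasure \<mu> (\<Omega> \<inter> V)) p)"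

end

theory Submission
  imports Defs
begin

text \<open>
  Let \<open>W = sqrt (|\<nabla>\<^sub>H u|\<^sup>2 - \<langle>\<nu>, \<nabla>\<^sub>H u\<rangle>\<^sup>2)\<close>, which is nonzero where some horizontal field
  tangent to \<open>R\<close> does not annihilate \<open>u\<close>.  The formula asks for a disintegration over \<open>u\<close>, with respect to
  Lebesgue measure, of the measure with density \<open>W\<close> on \<open>R\<close>; so it suffices that the image of
  this measure under \<open>u\<close> is absolutely continuous.  Near a point with \<open>W \<noteq> 0\<close> of a hypersurface
  \<open>{f = 0}\<close>, integration by parts along horizontal fields bounds the volume of
  \<open>{|f| < a, |u - s| < b}\<close> by a multiple of \<open>a b\<close>, and a covering argument converts this into
  \<open>sph_outer c {f = 0, u \<in> N} = 0\<close> for every Lebesgue null set \<open>N\<close>.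
\<close>

subsection \<open>The group law and the horizontal flows\<close>

text \<open>The function \<open>f\<close> defining a hypersurface has continuous horizontal
  derivatives only and may fail to be differentiable in the Euclidean sense, so no Euclidean tangent
  plane or coarea formula applies to it. All information about \<open>f\<close> is therefore read
  off along the flows of the frame fields, which preserve Lebesgue measure, and second derivatives
  fall on \<open>u\<close> alone. A ball of radius r has volume of order r^(2n+2) but content of
  order r^(2n+1). Hence a bound for \<open>sph_outer c\<close> requires neighbourhoods of volume
  O(r); over a slice of width b the bound is O(r (b + r)), which after division by r leaves O(b) as
  r tends to 0. The set R may have infinite measure near each of its points, so the image of its
  measure under \<open>u\<close> need not be sigma-finite. The measure is first made finite by a
  positive weight, then disintegrated, and the weight is divided out again on every slice; local
  finiteness of the slices is then recovered separately, for almost every s.\<close>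

lemma Im_hdot: "Im (hdot z w) = z \<bullet> (\<chi> j. \<i> * w $ j)"
  by (simp add: hdot_def inner_vec_def inner_complex_def Im_sum algebra_simps)

text \<open>The form is the Euclidean inner product with the second argument rotated by i, so
  boundedness and later the Cauchy-Schwarz bound are inherited.\<close>

lemma bilinear_Im_hdot: "bounded_bilinear (\<lambda>z w. Im (hdot z w))"
proof -
  have "linear (\<lambda>w::complex ^ 'n. \<chi> j. \<i> * w $ j)"
    by (auto simp: linear_iff vec_eq_iff algebra_simps)
  then have "bounded_linear (\<lambda>w::complex ^ 'n. \<chi> j. \<i> * w $ j)"
    by (rule linear_conv_bounded_linear[THEN iffD1])
  from bounded_bilinear.comp[OF bounded_bilinear_inner bounded_linear_ident this]
  show ?thesis unfolding Im_hdot by simp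
qed

interpretation imh: bounded_bilinear "\<lambda>z w. Im (hdot z w)" by (rule bilinear_Im_hdot)

lemmas continuous_on_Im_hdot [continuous_intros] = imh.continuous_on

lemma Im_hdot_commute: "Im (hdot z w) = - Im (hdot w z)"
  by (simp add: hdot_def Im_sum algebra_simps flip: sum_negf)

lemma Im_hdot_self [simp]: "Im (hdot z z) = 0"
  using Im_hdot_commute[of z z] by simp

lemma abs_Im_hdot_le: "\<bar>Im (hdot z w)\<bar> \<le> norm z * norm w"
proof -
  have "norm (\<chi> j. \<i> * w $ j) = norm w"
    by (simp add: norm_vec_def L2_set_def norm_mult)
  then show ?thesis unfolding Im_hdot by (metis Cauchy_Schwarz_ineq2)
qed

lemmas imh_simps = imh.add_left imh.add_right imh.minus_left imh.minus_right imh.diff_left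
  imh.diff_right imh.scaleR_left imh.scaleR_right imh.zero_left imh.zero_right

lemma hmul_assoc: "(p \<star> q) \<star> r = p \<star> (q \<star> r)"
  by (simp add: hmul_def imh_simps algebra_simps del: minus_complex.simps plus_complex.simps)

lemma hmul_0 [simp]: "p \<star> 0 = p" "0 \<star> p = p" "p \<star> (0, 0) = p" "(0, 0) \<star> p = p"
  by (simp_all add: hmul_def imh_simps)

lemma hmul_uminus [simp]: "p \<star> (- p) = 0" "(- p) \<star> p = 0"
  by (simp_all add: hmul_def imh_simps prod_eq_iff)

lemma hmul_uminus_cancel [simp]: "(- p) \<star> (p \<star> q) = q" "p \<star> (- p \<star> q) = q"
  by (simp_all flip: hmul_assoc)

lemma fst_hmul [simp]: "fst (p \<star> q) = fst p + fst q"
  by (simp add: hmul_def)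

lemma snd_hmul: "snd (p \<star> q) = snd p + snd q + 2 * Im (hdot (fst p) (fst q))"
  by (simp add: hmul_def)

lemma continuous_on_hmul [continuous_intros]:
  "continuous_on S f \<Longrightarrow> continuous_on S g \<Longrightarrow> continuous_on S (\<lambda>x. f x \<star> g x)"
  unfolding hmul_def by (intro continuous_intros)

text \<open>Right translation by a horizontal one-parameter subgroup is the flow of a left-invariant
  field and commutes with left translations. Its orbits are straight lines in coordinates
  (\<open>hflow_alt\<close>), so derivatives along the field are ordinary derivatives in one real
  variable.\<close>

definition hflow :: "complex ^ 'n::finite \<Rightarrow> real \<Rightarrow> 'n heis \<Rightarrow> 'n heis" where
  "hflow e s p = p \<star> (s *\<^sub>R e, 0)"

lemma hflow_alt: "hflow e s p = p + s *\<^sub>R (e, 2 * Im (hdot (fst p) e))"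
  by (simp add: hflow_def hmul_def imh_simps prod_eq_iff)

lemma hflow_add: "hflow e s (hflow e t p) = hflow e (s + t) p"
  by (simp add: hflow_def hmul_assoc) (simp add: hmul_def imh_simps algebra_simps)

lemma hflow_0 [simp]: "hflow e 0 p = p"
  by (simp add: hflow_def)

lemma hmul_hflow: "p \<star> hflow e s q = hflow e s (p \<star> q)"
  by (simp add: hflow_def hmul_assoc)

lemma continuous_on_hflow [continuous_intros]:
  "continuous_on S s \<Longrightarrow> continuous_on S f \<Longrightarrow> continuous_on S (\<lambda>x. hflow e (s x) (f x))"
  unfolding hflow_def by (intro continuous_intros)

text \<open>A single family indexed by vectors of C^n: the elements of \<open>Basis\<close> give all
  the fields \<open>hX j\<close> and \<open>hY j\<close> at once.\<close>

definition hor :: "complex ^ 'n::finite \<Rightarrow> 'n heis \<Rightarrow> 'n heis" where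
  "hor e p = (e, 2 * Im (hdot (fst p) e))"

lemma hX_eq_hor: "hX j = hor (axis j 1)" and hY_eq_hor: "hY j = hor (axis j \<i>)"
  by (auto simp: hX_def hY_def hor_def Im_hdot_axis fun_eq_iff)

lemma hflow_has_derivative:
  "((\<lambda>s. hflow e s p) has_derivative (\<lambda>s. s *\<^sub>R hor e p)) (at t)"
  unfolding hflow_alt hor_def by (auto intro!: derivative_eq_intros)

lemma hor_hflow [simp]: "hor e (hflow e s p) = hor e p"
  by (simp add: hor_def hflow_def imh_simps)

text \<open>A condition on one orbit only. Nothing is asked in other directions, which is all that
  functions of class \<open>C1_H\<close> provide.\<close>

definition has_hderiv :: "('n::finite heis \<Rightarrow> real) \<Rightarrow> complex ^ 'n \<Rightarrow> real \<Rightarrow> 'n heis \<Rightarrow> bool" where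
  "has_hderiv f e d p \<longleftrightarrow> ((\<lambda>s. f (hflow e s p)) has_real_derivative d) (at 0)"

lemma has_hderiv_at:
  assumes "has_hderiv f e d (hflow e t p)"
  shows "((\<lambda>s. f (hflow e s p)) has_real_derivative d) (at t)"
  using assms DERIV_shift[of "\<lambda>s. f (hflow e s p)" d 0 t]
  unfolding has_hderiv_def hflow_add by simp

lemma differentiable_has_hderiv:
  assumes "f differentiable (at p)"
  shows "has_hderiv f e (frechet_derivative f (at p) (hor e p)) p"
proof -
  let ?D = "frechet_derivative f (at p)"
  have D: "(f has_derivative ?D) (at p)"
    using assms by (simp add: frechet_derivative_works)
  have "((\<lambda>s. f (hflow e s p)) has_derivative (\<lambda>s. ?D (s *\<^sub>R hor e p))) (at 0)"
    using has_derivative_compose[OF hflow_has_derivative[of e p 0], of f ?D] D by simp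
  moreover have "?D (s *\<^sub>R hor e p) = ?D (hor e p) * s" for s
    using D by (simp add: linear_cmul[OF has_derivative_linear] mult.commute)
  ultimately show ?thesis
    unfolding has_hderiv_def has_field_derivative_def by simp
qed

lemma has_hderiv_mult:
  "has_hderiv f e a p \<Longrightarrow> has_hderiv g e b p \<Longrightarrow> has_hderiv (\<lambda>q. f q * g q) e (f p * b + a * g p) p"
  unfolding has_hderiv_def by (auto intro!: derivative_eq_intros)

lemma has_hderiv_chain:
  assumes "(\<psi> has_real_derivative d) (at (f p))" and "has_hderiv f e a p"
  shows "has_hderiv (\<lambda>q. \<psi> (f q)) e (d * a) p"
  using DERIV_chain2[of \<psi> d "\<lambda>s. f (hflow e s p)" 0] assms unfolding has_hderiv_def by simp

subsection \<open>Invariance of the Lebesgue measure\<close>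

text \<open>Fubini and translation invariance in each variable. Left translations and horizontal
  flows both have this shape, because the group law shifts the vertical coordinate by a function of
  the horizontal one.\<close>

lemma lborel_distr_shear:
  fixes l :: "'a::euclidean_space \<Rightarrow> real"
  assumes [measurable]: "l \<in> borel_measurable borel"
  shows "distr lborel borel (\<lambda>p. (fst p + a, snd p + l (fst p))) = (lborel :: ('a \<times> real) measure)"
proof -
  have [measurable]: "(\<lambda>p. (fst p + a, snd p + l (fst p))) \<in> borel_measurable (borel \<Otimes>\<^sub>M borel)"
    by measurable
  have [measurable]: "(\<lambda>p. (fst p + a, snd p + l (fst p))) \<in> borel_measurable borel"
    by (subst borel_prod[symmetric]) measurable
  show ?thesis
  proof (rule measure_eqI)
    fix A :: "('a \<times> real) set" assume "A \<in> sets (distr lborel borel (\<lambda>p. (fst p + a, snd p + l (fst p))))"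
    then have A[measurable]: "A \<in> sets borel" by simp
    then have A2[measurable]: "A \<in> sets (borel \<Otimes>\<^sub>M borel)"
      unfolding borel_prod .
    have *: "(\<integral>\<^sup>+x. h (x + b) \<partial>lborel) = (\<integral>\<^sup>+x. h x \<partial>lborel)"
      if [measurable]: "h \<in> borel_measurable borel" for h :: "'b::euclidean_space \<Rightarrow> ennreal" and b
    proof -
      have "(\<integral>\<^sup>+x. h x \<partial>lborel) = (\<integral>\<^sup>+x. h x \<partial>distr lborel borel ((+) b))"
        by (simp add: lborel_distr_plus)
      also have "\<dots> = (\<integral>\<^sup>+x. h (x + b) \<partial>lborel)"
        by (subst nn_integral_distr) (auto simp: add.commute)
      finally show ?thesis by simp
    qed
    have "emeasure (distr lborel borel (\<lambda>p. (fst p + a, snd p + l (fst p)))) A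
        = (\<integral>\<^sup>+p. indicator A p \<partial>distr lborel borel (\<lambda>p. (fst p + a, snd p + l (fst p))))"
      by simp
    also have "\<dots> = (\<integral>\<^sup>+p. indicator A (fst p + a, snd p + l (fst p)) \<partial>(lborel \<Otimes>\<^sub>M lborel))"
      by (subst nn_integral_distr) (auto simp: lborel_prod)
    also have "\<dots> = (\<integral>\<^sup>+x. \<integral>\<^sup>+t. indicator A (x + a, t + l x) \<partial>lborel \<partial>lborel)"
      by (subst lborel.nn_integral_fst[symmetric]) auto
    also have "\<dots> = (\<integral>\<^sup>+x. \<integral>\<^sup>+t. indicator A (x + a, t) \<partial>lborel \<partial>lborel)"
      by (intro nn_integral_cong *[of "\<lambda>t. indicator A (_, t)"]) measurable
    also have "\<dots> = (\<integral>\<^sup>+x. \<integral>\<^sup>+t. indicator A (x, t) \<partial>lborel \<partial>lborel)"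
      by (intro *[of "\<lambda>x. \<integral>\<^sup>+t. indicator A (x, t) \<partial>lborel"]) measurable
    also have "\<dots> = (\<integral>\<^sup>+p. indicator A p \<partial>(lborel \<Otimes>\<^sub>M lborel))"
      by (subst lborel.nn_integral_fst[symmetric]) auto
    also have "\<dots> = emeasure lborel A" by (simp add: lborel_prod)
    finally show "emeasure (distr lborel borel (\<lambda>p. (fst p + a, snd p + l (fst p)))) A = emeasure lborel A" .
  qed simp
qed

lemma lborel_distr_hmul_left: "distr lborel borel (\<lambda>q. p \<star> q) = (lborel :: 'n::finite heis measure)"
proof -
  have "(\<lambda>z. snd p + 2 * Im (hdot (fst p) z)) \<in> borel_measurable borel"
    by (intro borel_measurable_continuous_onI continuous_intros)
  from lborel_distr_shear[OF this, of "fst p"] show ?thesis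
    by (simp add: hmul_def algebra_simps)
qed

lemma lborel_distr_hflow: "distr lborel borel (hflow e s) = (lborel :: 'n::finite heis measure)"
proof -
  have "(\<lambda>z. 2 * Im (hdot z (s *\<^sub>R e))) \<in> borel_measurable borel"
    by (intro borel_measurable_continuous_onI continuous_intros)
  from lborel_distr_shear[OF this, of "s *\<^sub>R e"] show ?thesis
    by (simp add: hflow_def[abs_def] hmul_def)
qed

lemma hflow_measurable [measurable]: "hflow e s \<in> borel_measurable borel"
  by (intro borel_measurable_continuous_onI continuous_intros)

subsection \<open>Differentiation under the integral along a horizontal flow\<close>

lemma bounded_on_compact_real:
  fixes f :: "'a::topological_space \<Rightarrow> real"
  assumes "compact K" "continuous_on K f"
  obtains B where "B > 0" "\<And>x. x \<in> K \<Longrightarrow> \<bar>f x\<bar> \<le> B"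
proof -
  have "bounded (f ` K)" by (intro compact_imp_bounded compact_continuous_image assms)
  then show ?thesis using that by (auto simp: bounded_pos)
qed

text \<open>Dominated convergence for the difference quotients of \<phi>, bounded through the mean
  value theorem. Since the flow acts on \<phi> only, \<open>f\<close> may be merely bounded and
  measurable.\<close>

lemma integral_hflow_DERIV_0:
  fixes f \<phi> :: "'n::finite heis \<Rightarrow> real"
  assumes f: "f \<in> borel_measurable borel" "\<And>p. \<bar>f p\<bar> \<le> B"
    and K: "compact K" "\<And>p. p \<notin> K \<Longrightarrow> \<phi> p = 0"
    and \<phi>: "continuous_on UNIV \<phi>" "continuous_on UNIV \<phi>'"
    and d: "\<And>p. has_hderiv \<phi> e (\<phi>' p) p"
  shows "((\<lambda>s. LINT p|lborel. f p * \<phi> (hflow e s p)) has_real_derivative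
           (LINT p|lborel. f p * \<phi>' p)) (at 0)"
proof -
  note [measurable] = f(1)
  have [measurable]: "\<phi> \<in> borel_measurable borel" "\<phi>' \<in> borel_measurable borel"
    using \<phi> by (auto intro: borel_measurable_continuous_onI)
  \<comment> \<open>The set swept out by \<open>K\<close> during times in [-1, 1]; it carries all
    the flowed copies of \<phi> with |s| \<le> 1 and hence the dominating function.\<close>
  define K1 where "K1 = (\<lambda>(s, p). hflow e s p) ` ({-1..1} \<times> K)"
  have K1: "compact K1"
    unfolding K1_def by (intro compact_continuous_image compact_Times K)
      (auto simp: case_prod_beta intro!: continuous_intros)
  have inK1: "p \<in> K1" if "hflow e s p \<in> K" "\<bar>s\<bar> \<le> 1" for s p
    unfolding K1_def using that
    by (intro image_eqI[of _ _ "(-s, hflow e s p)"]) (auto simp: hflow_add)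
  \<comment> \<open>Off the closed set \<open>K\<close> the orbit stays off \<open>K\<close> for a
    short time, so \<phi> is locally constant along it.\<close>
  have \<phi>'0: "\<phi>' p = 0" if "p \<notin> K" for p
  proof -
    have "open (- K)" using K by (simp add: compact_imp_closed open_Compl)
    then have "open ((\<lambda>s. hflow e s p) -` (- K))"
      by (intro open_vimage) (auto intro!: continuous_intros)
    then have "\<forall>\<^sub>F s in nhds 0. hflow e s p \<notin> K"
      using that by (subst eventually_nhds) (auto intro!: exI[of _ "(\<lambda>s. hflow e s p) -` (- K)"])
    then have "\<forall>\<^sub>F s in nhds 0. \<phi> (hflow e s p) = 0"
      by eventually_elim (rule K)
    then have "((\<lambda>s. \<phi> (hflow e s p)) has_real_derivative 0) (at 0)"
      by (subst DERIV_cong_ev[where g = "\<lambda>_. 0" and y = 0 and v = 0]) auto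
    then show ?thesis using d[of p] DERIV_unique unfolding has_hderiv_def by blast
  qed
  obtain C where C: "C > 0" "\<And>p. \<bar>\<phi>' p\<bar> \<le> C"
  proof -
    obtain C where "C > 0" "\<And>p. p \<in> K \<Longrightarrow> \<bar>\<phi>' p\<bar> \<le> C"
      using bounded_on_compact_real[OF K(1), of \<phi>'] \<phi>(2) continuous_on_subset by (metis subset_UNIV)
    then show ?thesis using that \<phi>'0 by (metis abs_zero less_imp_le)
  qed
  have B: "B \<ge> 0" using f(2)[of undefined] by linarith
  have lip: "\<bar>\<phi> (hflow e s p) - \<phi> p\<bar> \<le> C * \<bar>s\<bar> * indicator K1 p" if "\<bar>s\<bar> \<le> 1" for s p
  proof (cases "p \<in> K1")
    case True
    have "norm (\<phi> (hflow e s p) - \<phi> (hflow e 0 p)) \<le> C * norm (s - 0)"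
      by (rule field_differentiable_bound[of UNIV "\<lambda>s. \<phi> (hflow e s p)" "\<lambda>s. \<phi>' (hflow e s p)"])
        (use C has_hderiv_at[OF d] in simp_all)
    then show ?thesis using True by simp
  next
    case False
    then have "hflow e s p \<notin> K" "hflow e 0 p \<notin> K"
      using inK1[of s p] inK1[of 0 p] that by auto
    then show ?thesis using False K by simp
  qed
  have int: "integrable lborel (\<lambda>p. B * C * indicator K1 p)"
    using K1 by (intro integrable_mult_right integrable_real_indicator)
      (use emeasure_compact_finite[of K1] in \<open>auto simp: borel_compact top.not_eq_extremum\<close>)
  have int\<phi>: "integrable lborel (\<lambda>p. f p * \<phi> (hflow e s p))" if s: "\<bar>s\<bar> \<le> 1" for s
  proof -
    obtain D where D: "D > 0" "\<And>p. p \<in> K \<Longrightarrow> \<bar>\<phi> p\<bar> \<le> D"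
      using bounded_on_compact_real[OF K(1), of \<phi>] \<phi>(1) continuous_on_subset by (metis subset_UNIV)
    have "integrable lborel (\<lambda>p. B * D * indicator K1 p)"
      using K1 by (intro integrable_mult_right integrable_real_indicator)
        (use emeasure_compact_finite[of K1] in \<open>auto simp: borel_compact top.not_eq_extremum\<close>)
    then show ?thesis
    proof (rule Bochner_Integration.integrable_bound, goal_cases)
      case 2
      have "\<bar>\<phi> (hflow e s p)\<bar> \<le> D * indicator K1 p" for p
        using inK1[of s p] K(2)[of "hflow e s p"] D(1) D(2)[of "hflow e s p"] s
        by (cases "hflow e s p \<in> K") (auto simp: indicator_def)
      then have "\<bar>f p\<bar> * \<bar>\<phi> (hflow e s p)\<bar> \<le> B * (D * indicator K1 p)" for p
        using f(2) B by (intro mult_mono) auto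
      then have "norm (f p * \<phi> (hflow e s p)) \<le> norm (B * D * indicator K1 p)" for p
        using B D(1) by (simp add: abs_mult mult.assoc)
      then show ?case by (rule AE_I2)
    qed simp
  qed
  have "((\<lambda>s. ((LINT p|lborel. f p * \<phi> (hflow e s p)) - (LINT p|lborel. f p * \<phi> (hflow e 0 p))) / (s - 0))
         \<longlongrightarrow> (LINT p|lborel. f p * \<phi>' p)) (at 0)"
    unfolding tendsto_at_iff_sequentially comp_def
  proof (intro allI impI)
    fix X :: "nat \<Rightarrow> real" assume X0: "\<forall>i. X i \<in> UNIV - {0}" and X: "X \<longlonglongrightarrow> 0"
    then have "\<forall>\<^sub>F i in sequentially. \<bar>X i\<bar> < 1"
      using tendstoD[of X 0 sequentially 1] by simp
    then obtain N where N: "\<And>i. i \<ge> N \<Longrightarrow> \<bar>X i\<bar> < 1" by (auto simp: eventually_sequentially)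
    \<comment> \<open>Dropping the first terms makes all times at most 1, the range in which the
      dominating function is valid.\<close>
    define Y where "Y i = X (i + N)" for i
    have Y: "Y \<longlonglongrightarrow> 0" "\<And>i. Y i \<noteq> 0" "\<And>i. \<bar>Y i\<bar> \<le> 1"
      using LIMSEQ_ignore_initial_segment[OF X, of N] X0 N
      by (auto simp: Y_def[abs_def] less_imp_le)
    have "(\<lambda>i. LINT p|lborel. f p * ((\<phi> (hflow e (Y i) p) - \<phi> p) / Y i))
       \<longlonglongrightarrow> (LINT p|lborel. f p * \<phi>' p)"
    proof (rule integral_dominated_convergence[where w = "\<lambda>p. B * C * indicator K1 p"])
      show "AE p in lborel. (\<lambda>i. f p * ((\<phi> (hflow e (Y i) p) - \<phi> p) / Y i)) \<longlonglongrightarrow> f p * \<phi>' p"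
      proof (rule AE_I2, rule tendsto_mult_left)
        fix p :: "'n heis"
        have "((\<lambda>s. (\<phi> (hflow e s p) - \<phi> p) / s) \<longlongrightarrow> \<phi>' p) (at 0)"
          using d[of p] unfolding has_hderiv_def has_field_derivative_iff by simp
        then show "(\<lambda>i. (\<phi> (hflow e (Y i) p) - \<phi> p) / Y i) \<longlonglongrightarrow> \<phi>' p"
          unfolding tendsto_at_iff_sequentially comp_def using Y by auto
      qed
      show "AE p in lborel. norm (f p * ((\<phi> (hflow e (Y i) p) - \<phi> p) / Y i)) \<le> B * C * indicator K1 p" for i
      proof (rule AE_I2)
        fix p :: "'n heis"
        have "\<bar>(\<phi> (hflow e (Y i) p) - \<phi> p) / Y i\<bar> \<le> C * indicator K1 p"
          using lip[OF Y(3)[of i], of p] Y(2)[of i] by (simp add: divide_simps mult_ac)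
        then have "\<bar>f p\<bar> * \<bar>(\<phi> (hflow e (Y i) p) - \<phi> p) / Y i\<bar> \<le> B * (C * indicator K1 p)"
          using f(2) B by (intro mult_mono) auto
        then show "norm (f p * ((\<phi> (hflow e (Y i) p) - \<phi> p) / Y i)) \<le> B * C * indicator K1 p"
          by (simp add: abs_mult mult_ac)
      qed
    qed (use int in auto)
    moreover have "(LINT p|lborel. f p * ((\<phi> (hflow e (Y i) p) - \<phi> p) / Y i)) =
       ((LINT p|lborel. f p * \<phi> (hflow e (Y i) p)) - (LINT p|lborel. f p * \<phi> (hflow e 0 p))) / (Y i - 0)" for i
    proof -
      have "(LINT p|lborel. f p * ((\<phi> (hflow e (Y i) p) - \<phi> p) / Y i)) =
          (LINT p|lborel. (f p * \<phi> (hflow e (Y i) p) - f p * \<phi> (hflow e 0 p)) / Y i)"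
        by (simp add: right_diff_distrib)
      then show ?thesis using int\<phi>[OF Y(3)[of i]] int\<phi>[of 0] by simp
    qed
    ultimately have "(\<lambda>i. ((LINT p|lborel. f p * \<phi> (hflow e (Y i) p)) - (LINT p|lborel. f p * \<phi> (hflow e 0 p))) / (Y i - 0))
         \<longlonglongrightarrow> (LINT p|lborel. f p * \<phi>' p)" by (simp only:)
    then show "(\<lambda>i. ((LINT p|lborel. f p * \<phi> (hflow e (X i) p)) - (LINT p|lborel. f p * \<phi> (hflow e 0 p))) / (X i - 0))
         \<longlonglongrightarrow> (LINT p|lborel. f p * \<phi>' p)"
      unfolding Y_def by (rule LIMSEQ_offset)
  qed
  then show ?thesis unfolding has_field_derivative_iff by simp
qed

text \<open>By invariance of the measure the integral of the flowed function does not depend on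
  time, and its derivative at time 0 is the integral of \<phi>'. Applied to products, this is
  integration by parts.\<close>

lemma integral_hderiv_eq_0:
  fixes \<phi> :: "'n::finite heis \<Rightarrow> real"
  assumes K: "compact K" "\<And>p. p \<notin> K \<Longrightarrow> \<phi> p = 0"
    and \<phi>: "continuous_on UNIV \<phi>" "continuous_on UNIV \<phi>'"
    and d: "\<And>p. has_hderiv \<phi> e (\<phi>' p) p"
  shows "(LINT p|lborel. \<phi>' p) = 0"
proof -
  have [measurable]: "\<phi> \<in> borel_measurable borel"
    using \<phi> by (auto intro: borel_measurable_continuous_onI)
  have "(LINT p|lborel. \<phi> (hflow e s p)) = (LINT p|lborel. \<phi> p)" for s
  proof -
    have "(LINT p|lborel. \<phi> p) = (LINT p|distr lborel borel (hflow e s). \<phi> p)"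
      by (simp add: lborel_distr_hflow)
    also have "\<dots> = (LINT p|lborel. \<phi> (hflow e s p))" by (rule integral_distr) auto
    finally show ?thesis by simp
  qed
  then have "((\<lambda>s. LINT p|lborel. \<phi> p) has_real_derivative (LINT p|lborel. \<phi>' p)) (at 0)"
    using integral_hflow_DERIV_0[OF _ _ K \<phi> d, of "\<lambda>_. 1" 1] by simp
  then show ?thesis using DERIV_const DERIV_unique by blast
qed

subsection \<open>Smooth bump functions\<close>

lemma Ck_on_UNIV_SucI:
  assumes "\<And>x. (f has_derivative (\<lambda>v. f' v x)) (at x)" and "\<And>v. Ck_on k UNIV (f' v)"
  shows "Ck_on (Suc k) UNIV f"
proof -
  have "frechet_derivative f (at x) = (\<lambda>v. f' v x)" for x
    using frechet_derivative_at[OF assms(1)] by simp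
  then show ?thesis using assms by (auto simp: differentiable_def)
qed

lemma Ck_on_UNIV_SucD:
  assumes "Ck_on (Suc k) UNIV f"
  shows "(f has_derivative frechet_derivative f (at x)) (at x)"
    and "Ck_on k UNIV (\<lambda>x. frechet_derivative f (at x) v)"
  using assms by (auto simp: frechet_derivative_works)

lemma Ck_on_Suc_imp: "Ck_on (Suc k) S f \<Longrightarrow> Ck_on k S f"
proof (induction k arbitrary: f)
  case 0
  then show ?case
    by (auto intro!: continuous_at_imp_continuous_on differentiable_imp_continuous_within)
qed auto

lemma Ck_on_const: "Ck_on k UNIV (\<lambda>x. c)"
proof (induction k arbitrary: c)
  case (Suc k)
  show ?case by (rule Ck_on_UNIV_SucI[of _ "\<lambda>v x. 0"]) (auto intro: Suc)
qed simp

lemma Ck_on_add: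
  "Ck_on k UNIV f \<Longrightarrow> Ck_on k UNIV g \<Longrightarrow> Ck_on k UNIV (\<lambda>x. f x + g x)"
proof (induction k arbitrary: f g)
  case (Suc k)
  note D = Ck_on_UNIV_SucD[OF Suc.prems(1)] Ck_on_UNIV_SucD[OF Suc.prems(2)]
  show ?case
    by (rule Ck_on_UNIV_SucI[where f' = "\<lambda>v x. frechet_derivative f (at x) v + frechet_derivative g (at x) v"])
      (use D in \<open>auto intro!: has_derivative_add Suc.IH\<close>)
qed (auto intro: continuous_intros)

lemma Ck_on_mult:
  fixes f g :: "'a::euclidean_space \<Rightarrow> real"
  shows "Ck_on k UNIV f \<Longrightarrow> Ck_on k UNIV g \<Longrightarrow> Ck_on k UNIV (\<lambda>x. f x * g x)"
proof (induction k arbitrary: f g)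
  case (Suc k)
  note D = Ck_on_UNIV_SucD[OF Suc.prems(1)] Ck_on_UNIV_SucD[OF Suc.prems(2)]
  show ?case
    by (rule Ck_on_UNIV_SucI[where f' = "\<lambda>v x. f x * frechet_derivative g (at x) v + frechet_derivative f (at x) v * g x"])
      (use D Ck_on_Suc_imp[OF Suc.prems(1)] Ck_on_Suc_imp[OF Suc.prems(2)]
       in \<open>auto intro!: has_derivative_mult Ck_on_add Suc.IH\<close>)
qed (auto intro: continuous_intros)

lemma Ck_on_inner: "Ck_on k UNIV (\<lambda>x. (x - a) \<bullet> v)"
proof (cases k)
  case (Suc m)
  show ?thesis unfolding Suc
    by (rule Ck_on_UNIV_SucI[where f' = "\<lambda>w x. w \<bullet> v"])
      (auto intro!: derivative_eq_intros Ck_on_const)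
qed (auto intro!: continuous_intros)

text \<open>The derivatives of \<open>exp (- 1 / x)\<close>, extended by zero, are combinations of these functions.\<close>

definition flat_exp :: "nat \<Rightarrow> real \<Rightarrow> real" where
  "flat_exp j x = (if x > 0 then inverse x ^ j * exp (- inverse x) else 0)"

lemma flat_exp_at_right: "(flat_exp j \<longlongrightarrow> 0) (at_right 0)"
proof -
  have "((\<lambda>x. inverse x ^ j / exp (inverse x)) \<longlongrightarrow> (0::real)) (at_right 0)"
    by (rule filterlim_compose[OF tendsto_power_div_exp_0 filterlim_inverse_at_top_right])
  moreover have "\<forall>\<^sub>F x in at_right 0. inverse x ^ j / exp (inverse x) = flat_exp j x"
    by (auto simp: eventually_at_right_field flat_exp_def exp_minus divide_inverse intro!: exI[of _ 1])
  ultimately show ?thesis by (rule Lim_transform_eventually)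
qed

lemma flat_exp_DERIV:
  "(flat_exp j has_real_derivative flat_exp (j + 2) x - j * flat_exp (j + 1) x) (at x)"
proof (cases x "0::real" rule: linorder_cases)
  case greater
  have "((\<lambda>x. inverse x ^ j * exp (- inverse x)) has_real_derivative
      flat_exp (j + 2) x - j * flat_exp (j + 1) x) (at x)"
    using greater power_eq_if[of "inverse x" "j - 1"]
    by (cases j) (auto intro!: derivative_eq_intros simp: flat_exp_def power2_eq_square algebra_simps)
  moreover have "\<forall>\<^sub>F y in nhds x. inverse y ^ j * exp (- inverse y) = flat_exp j y"
    using eventually_nhds_in_open[of "{0<..}" x] greater
    by (auto simp: flat_exp_def elim!: eventually_mono)
  ultimately show ?thesis by (rule DERIV_cong_ev[OF refl _ refl, THEN iffD1, rotated])
next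
  case less
  have "\<forall>\<^sub>F y in nhds x. 0 = flat_exp j y"
    using eventually_nhds_in_open[of "{..<0}" x] less
    by (auto simp: flat_exp_def elim!: eventually_mono)
  then have "((\<lambda>x. 0) has_real_derivative flat_exp (j + 2) x - j * flat_exp (j + 1) x) (at x)
     \<longleftrightarrow> ?thesis" by (rule DERIV_cong_ev[OF refl _ refl])
  then show ?thesis using less by (simp add: flat_exp_def)
next
  case equal
  \<comment> \<open>To the right of 0 the difference quotient is again a flat function, with index
    raised by one.\<close>
  have "((\<lambda>h. flat_exp j h / h) \<longlongrightarrow> 0) (at_right 0)"
  proof (rule Lim_transform_eventually[OF flat_exp_at_right[of "Suc j"]])
    show "\<forall>\<^sub>F h in at_right 0. flat_exp (Suc j) h = flat_exp j h / h"
      by (auto simp: eventually_at_right_field flat_exp_def field_simps intro!: exI[of _ 1])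
  qed
  moreover have "((\<lambda>h. flat_exp j h / h) \<longlongrightarrow> 0) (at_left 0)"
  proof (rule Lim_transform_eventually[of "\<lambda>_. 0"])
    show "\<forall>\<^sub>F h in at_left 0. 0 = flat_exp j h / h"
      by (auto simp: eventually_at_left_field flat_exp_def intro!: exI[of _ "-1"])
  qed simp
  ultimately have "((\<lambda>h. flat_exp j h / h) \<longlongrightarrow> 0) (at 0)"
    by (rule filterlim_split_at[rotated])
  then show ?thesis using equal by (simp add: has_field_derivative_iff flat_exp_def)
qed

text \<open>The squared distance is a polynomial, so there is no singularity at the centre.\<close>

definition bump :: "'a::euclidean_space \<Rightarrow> real \<Rightarrow> 'a \<Rightarrow> real" where
  "bump a \<rho> x = flat_exp 0 (\<rho>\<^sup>2 - (x - a) \<bullet> (x - a))"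

lemma smooth_bump: "smooth_on UNIV (bump a \<rho>)"
proof -
  \<comment> \<open>Generalising over \<open>j\<close> closes the induction: the derivative of
    \<open>flat_exp j\<close> is a combination of those with indices \<open>j + 1\<close> and
    \<open>j + 2\<close>.\<close>
  have "Ck_on k UNIV (\<lambda>x. flat_exp j (\<rho>\<^sup>2 - (x - a) \<bullet> (x - a)))" for k j
  proof (induction k arbitrary: j)
    case 0
    have "isCont (flat_exp j) x" for x using flat_exp_DERIV DERIV_isCont by blast
    then have "continuous_on UNIV (flat_exp j)" by (simp add: continuous_on_eq_continuous_at)
    then show ?case
      by (auto intro!: continuous_on_compose2[of UNIV "flat_exp j"] continuous_intros)
  next
    case (Suc k)
    show ?case
    proof (rule Ck_on_UNIV_SucI)
      show "((\<lambda>x. flat_exp j (\<rho>\<^sup>2 - (x - a) \<bullet> (x - a))) has_derivative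
        (\<lambda>v. (flat_exp (j + 2) (\<rho>\<^sup>2 - (x - a) \<bullet> (x - a)) +
           (- real j) * flat_exp (j + 1) (\<rho>\<^sup>2 - (x - a) \<bullet> (x - a))) * ((-2) * ((x - a) \<bullet> v)))) (at x)" for x
        by (rule has_derivative_eq_rhs[OF has_derivative_compose[OF _
              flat_exp_DERIV[THEN has_field_derivative_imp_has_derivative]]])
          (auto intro!: derivative_eq_intros simp: inner_commute algebra_simps)
      show "Ck_on k UNIV (\<lambda>x. (flat_exp (j + 2) (\<rho>\<^sup>2 - (x - a) \<bullet> (x - a)) +
           (- real j) * flat_exp (j + 1) (\<rho>\<^sup>2 - (x - a) \<bullet> (x - a))) * ((-2) * ((x - a) \<bullet> v)))" for v
        by (intro Ck_on_mult Ck_on_add Ck_on_const Ck_on_inner Suc.IH)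
    qed
  qed
  then show ?thesis by (auto simp: smooth_on_def bump_def[abs_def])
qed

lemma bump_nonneg: "bump a \<rho> x \<ge> 0"
  by (simp add: bump_def flat_exp_def)

lemma bump_pos_iff: "\<rho> > 0 \<Longrightarrow> bump a \<rho> x > 0 \<longleftrightarrow> x \<in> ball a \<rho>"
proof -
  assume "\<rho> > 0"
  then have "(norm (x - a))\<^sup>2 < \<rho>\<^sup>2 \<longleftrightarrow> norm (x - a) < \<rho>"
    using power_strict_mono[of "norm (x - a)" \<rho> 2] power2_less_imp_less[of "norm (x - a)" \<rho>] by auto
  then show ?thesis
    by (simp add: bump_def flat_exp_def dist_norm norm_minus_commute[of a x] flip: power2_norm_eq_inner)
qed

lemma bump_eq_0: "\<rho> > 0 \<Longrightarrow> x \<notin> ball a \<rho> \<Longrightarrow> bump a \<rho> x = 0"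
  using bump_pos_iff[of \<rho> a x] bump_nonneg[of a \<rho> x] by linarith

subsection \<open>Horizontal derivatives of differentiable functions\<close>

lemma frechet_derivative_Basis_sum:
  assumes "f differentiable (at p)"
  shows "frechet_derivative f (at p) v = (\<Sum>b\<in>Basis. (v \<bullet> b) *\<^sub>R frechet_derivative f (at p) b)"
proof -
  have "linear (frechet_derivative f (at p))"
    using assms by (simp add: linear_frechet_derivative)
  from linear_sum[OF this, of "\<lambda>b. (v \<bullet> b) *\<^sub>R b" Basis] linear_cmul[OF this]
  show ?thesis by (simp add: euclidean_representation)
qed

lemma continuous_on_frechet_field:
  assumes "Ck_on 1 S f" "continuous_on S V"
  shows "continuous_on S (\<lambda>p. frechet_derivative f (at p) (V p))"
proof -
  have "continuous_on S (\<lambda>p. \<Sum>b\<in>Basis. (V p \<bullet> b) *\<^sub>R frechet_derivative f (at p) b)"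
    using assms by (intro continuous_intros) auto
  moreover have "(\<Sum>b\<in>Basis. (V p \<bullet> b) *\<^sub>R frechet_derivative f (at p) b)
     = frechet_derivative f (at p) (V p)" if "p \<in> S" for p
    using frechet_derivative_Basis_sum[of f p "V p"] assms(1) that by simp
  ultimately show ?thesis by (rule continuous_on_eq)
qed

lemma continuous_on_hor [continuous_intros]: "continuous_on S (hor e)"
  unfolding hor_def by (intro continuous_intros)

text \<open>The field \<open>hor e\<close> has a coefficient depending on the point, so a second
  horizontal derivative contains a first-order vertical term, with factor
  \<open>2 * Im (hdot e' e)\<close>. This term is the reason why horizontal derivatives do not
  commute.\<close>

lemma Ck_on_2_hderiv:
  fixes f :: "'n::finite heis \<Rightarrow> real"
  assumes "Ck_on 2 S f" and S: "open S"
  obtains h where "continuous_on S h"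
    "\<And>p. p \<in> S \<Longrightarrow> has_hderiv (\<lambda>q. frechet_derivative f (at q) (hor e q)) e' (h p) p"
proof -
  let ?D = "\<lambda>v q. frechet_derivative f (at q) v"
  have f: "Ck_on (Suc 1) S f" using assms(1) by (simp add: numeral_2_eq_2)
  have C: "Ck_on 1 S (?D v)" for v using f unfolding Ck_on.simps(2) by blast
  define h where "h p = frechet_derivative (?D (e, 0)) (at p) (hor e' p)
     + (2 * Im (hdot (fst p) e) * frechet_derivative (?D (0, 1)) (at p) (hor e' p)
        + 2 * Im (hdot e' e) * ?D (0, 1) p)" for p
  have eq: "?D (hor e q) q = ?D (e, 0) q + 2 * Im (hdot (fst q) e) * ?D (0, 1) q" if "q \<in> S" for q
  proof -
    have "linear (\<lambda>v. ?D v q)" using f that by (simp add: linear_frechet_derivative)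
    from linear_add[OF this, of "(e, 0)" "(2 * Im (hdot (fst q) e)) *\<^sub>R (0, 1)"]
      linear_cmul[OF this, of "2 * Im (hdot (fst q) e)" "(0,1)"]
    show ?thesis by (simp add: hor_def)
  qed
  have "continuous_on S (?D (0, 1))" using C[of "(0, 1)"] Ck_on_Suc_imp[of 0 S "?D (0, 1)"] by simp
  moreover have "continuous_on S (\<lambda>p. frechet_derivative (?D v) (at p) (hor e' p))" for v
    by (intro continuous_on_frechet_field C continuous_on_hor)
  moreover have "continuous_on S (\<lambda>p. Im (hdot (fst p) e))"
    by (intro continuous_on_Im_hdot continuous_intros)
  ultimately have 1: "continuous_on S h" unfolding h_def
    by (intro continuous_on_add continuous_on_mult continuous_on_const)
  have 2: "has_hderiv (\<lambda>q. ?D (hor e q) q) e' (h p) p" if p: "p \<in> S" for p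
  proof -
    have d: "?D v differentiable at p" for v using C[of v] p by simp
    have lin: "has_hderiv (\<lambda>q. 2 * Im (hdot (fst q) e)) e' (2 * Im (hdot e' e)) p"
      unfolding has_hderiv_def by (auto intro!: derivative_eq_intros simp: hflow_alt imh_simps)
    have "has_hderiv (\<lambda>q. ?D (e, 0) q + 2 * Im (hdot (fst q) e) * ?D (0, 1) q) e' (h p) p"
      using differentiable_has_hderiv[OF d, of "(e, 0)" e']
        has_hderiv_mult[OF lin differentiable_has_hderiv[OF d, of "(0, 1)" e']]
      unfolding has_hderiv_def h_def by (rule DERIV_add)
    moreover have "\<forall>\<^sub>F s in nhds 0. ?D (hor e (hflow e' s p)) (hflow e' s p) =
       ?D (e, 0) (hflow e' s p) + 2 * Im (hdot (fst (hflow e' s p)) e) * ?D (0, 1) (hflow e' s p)"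
    proof -
      have "open ((\<lambda>s. hflow e' s p) -` S)"
        using S by (intro open_vimage) (auto intro!: continuous_intros)
      from eventually_nhds_in_open[OF this, of 0] p show ?thesis
        by (auto elim!: eventually_mono intro: eq)
    qed
    ultimately show ?thesis
      unfolding has_hderiv_def by (subst DERIV_cong_ev[OF refl _ refl])
  qed
  show ?thesis using that 1 2 by blast
qed

subsection \<open>From distributional to classical horizontal derivatives\<close>

text \<open>Common interface for smooth functions and for functions of class \<open>C1_H\<close>:
  \<open>F\<close> is the horizontal gradient, written by its frame coefficients, and it is attained
  pointwise along flows.\<close>

definition hgrad_on :: "'n::finite heis set \<Rightarrow> ('n heis \<Rightarrow> real) \<Rightarrow> ('n heis \<Rightarrow> complex ^ 'n) \<Rightarrow> bool" where
  "hgrad_on U f F \<longleftrightarrow> open U \<and> continuous_on U f \<and> continuous_on U F \<and>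
     (\<forall>q\<in>U. \<forall>e\<in>Basis. has_hderiv f e (F q \<bullet> e) q)"

text \<open>The derivative \<open>L\<close> is the same at every point, so differentiating the
  composition along v gives the derivative of \<open>f\<close> along \<open>L v\<close>, composed
  with \<open>A\<close>, and the induction meets no new terms.\<close>

lemma smooth_on_affine_compose:
  assumes "smooth_on UNIV f" and A: "\<And>x. (A has_derivative L) (at x)"
  shows "smooth_on UNIV (\<lambda>x. f (A x))"
proof -
  have "Ck_on k UNIV f \<Longrightarrow> Ck_on k UNIV (\<lambda>x. f (A x))" for k
  proof (induction k arbitrary: f)
    case 0
    have "isCont A x" for x using A has_derivative_continuous by blast
    then have "continuous_on UNIV A" by (simp add: continuous_on_eq_continuous_at)
    then show ?case using 0 by (auto intro: continuous_on_compose2)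
  next
    case (Suc k)
    show ?case
      by (rule Ck_on_UNIV_SucI[OF has_derivative_compose[OF A Ck_on_UNIV_SucD(1)[OF Suc.prems]]])
        (rule Suc.IH[OF Ck_on_UNIV_SucD(2)[OF Suc.prems]])
  qed
  then show ?thesis using assms(1) by (auto simp: smooth_on_def)
qed

lemma hflow_affine:
  "((\<lambda>q. hflow e s q) has_derivative (\<lambda>v. v + s *\<^sub>R (0, 2 * Im (hdot (fst v) e)))) (at q)"
proof -
  have "bounded_linear (\<lambda>q. Im (hdot (fst q) e))"
    by (rule bounded_linear_compose[OF imh.bounded_linear_left bounded_linear_fst])
  note [derivative_intros] = bounded_linear.has_derivative[OF this]
  show ?thesis unfolding hflow_alt by (auto intro!: derivative_eq_intros)
qed

lemma bump_integrable:
  fixes h :: "'a::euclidean_space \<Rightarrow> real"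
  assumes "h \<in> borel_measurable borel" "\<And>x. \<bar>h x\<bar> \<le> B" "r > 0"
  shows "integrable lborel (\<lambda>x. h x * bump a r x)"
proof -
  have cont: "continuous_on S (bump a r)" for S
  proof -
    have "Ck_on 0 UNIV (bump a r)" using smooth_bump[of a r] unfolding smooth_on_def by blast
    then show ?thesis using continuous_on_subset by force
  qed
  have [measurable]: "bump a r \<in> borel_measurable borel"
    by (intro borel_measurable_continuous_onI cont)
  obtain C where C: "C > 0" "\<And>x. x \<in> cball a r \<Longrightarrow> \<bar>bump a r x\<bar> \<le> C"
    using bounded_on_compact_real[OF compact_cball cont] by blast
  have "integrable lborel (\<lambda>x. B * C * indicator (cball a r) x)"
    using emeasure_compact_finite[OF compact_cball, of a r]
    by (intro integrable_mult_right integrable_real_indicator) auto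
  then show ?thesis
  proof (rule Bochner_Integration.integrable_bound)
    show "AE x in lborel. norm (h x * bump a r x) \<le> norm (B * C * indicator (cball a r) x)"
    proof (rule AE_I2)
      fix x
      have B: "B \<ge> 0" using assms(2)[of x] by linarith
      have "\<bar>bump a r x\<bar> \<le> C * indicator (cball a r) x"
        using bump_eq_0[OF assms(3), of x a] C by (auto simp: indicator_def)
      then have "\<bar>h x\<bar> * \<bar>bump a r x\<bar> \<le> B * (C * indicator (cball a r) x)"
        using assms(2) B by (intro mult_mono) auto
      then show "norm (h x * bump a r x) \<le> norm (B * C * indicator (cball a r) x)"
        using B C(1) by (simp add: abs_mult mult.assoc)
    qed
  qed (use assms(1) in measurable)
qed

lemma bump_integral_pos:
  assumes "r > 0" shows "(LINT x|lborel. bump (a::'a::euclidean_space) r x) > 0"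
proof -
  have int: "integrable lborel (bump a r)"
    using bump_integrable[of "\<lambda>_. 1" 1 r a] assms by simp
  have "(LINT x|lborel. bump a r x) \<noteq> 0"
  proof
    assume "(LINT x|lborel. bump a r x) = 0"
    then have "AE x in lborel. bump a r x = 0"
      using integral_nonneg_eq_0_iff_AE[OF int] bump_nonneg by auto
    then have "AE x in lborel. x \<notin> ball a r"
      by eventually_elim (metis bump_pos_iff[OF assms] less_irrefl)
    then have "ball a r \<in> null_sets lborel"
      by (subst (asm) AE_iff_null_sets[symmetric]) auto
    then show False using content_ball_gt_0_iff[of a r] assms by (auto simp: measure_def null_sets_def)
  qed
  moreover have "(LINT x|lborel. bump a r x) \<ge> 0" using bump_nonneg by (intro integral_nonneg_AE) auto
  ultimately show ?thesis by simp
qed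

lemma hflow_near:
  assumes "open V" "p \<in> V"
  obtains r t where "r > 0" "t > 0" "\<And>s q. \<bar>s\<bar> \<le> t \<Longrightarrow> q \<in> ball p r \<Longrightarrow> hflow e s q \<in> V"
proof -
  have "open ((\<lambda>x. hflow e (fst x) (snd x)) -` V)"
    using assms(1) by (intro open_vimage) (auto intro!: continuous_intros)
  moreover have "(0, p) \<in> (\<lambda>x. hflow e (fst x) (snd x)) -` V" using assms(2) by simp
  ultimately obtain d where "d > 0" "ball (0, p) d \<subseteq> (\<lambda>x. hflow e (fst x) (snd x)) -` V"
    by (rule openE)
  then have d: "d > 0" "\<And>x. dist x (0, p) < d \<Longrightarrow> hflow e (fst x) (snd x) \<in> V"
    by (auto simp: subset_eq dist_commute simp del: split_paired_All)
  show ?thesis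
  proof (rule that[of "d / 2" "d / 4"])
    fix s q assume "\<bar>s\<bar> \<le> d / 4" "q \<in> ball p (d / 2)"
    then have "dist (s, q) (0, p) < d"
      using sqrt_sum_squares_le_sum_abs[of "\<bar>s\<bar>" "dist q p"] d(1)
      by (simp add: dist_Pair_Pair dist_commute)
    then show "hflow e s q \<in> V" using d(2)[of "(s, q)"] by simp
  qed (use d in auto)
qed

text \<open>An averaged first-order expansion. Testing against the bump carried along the flow, the
  distributional identity computes the derivative in s of the average of
  \<open>f (hflow e s q)\<close> as the average of \<open>g (hflow e s q)\<close>, which is within
  \<epsilon> of \<open>g p\<close>; the mean value theorem then integrates this.\<close>

lemma distr_deriv_estimate:
  fixes f g :: "'n::finite heis \<Rightarrow> real"
  assumes U: "cball p \<delta> \<subseteq> U"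
    and f: "continuous_on U f" and g: "continuous_on U g"
    and fg: "is_distr_deriv U (hor e) f g"
    and r: "r > 0" "\<And>s q. \<bar>s\<bar> \<le> t \<Longrightarrow> q \<in> ball p r \<Longrightarrow> hflow e s q \<in> cball p \<delta>"
    and \<epsilon>: "\<And>s q. \<bar>s\<bar> \<le> t \<Longrightarrow> q \<in> ball p r \<Longrightarrow> \<bar>g (hflow e s q) - g p\<bar> \<le> \<epsilon>"
    and s: "\<bar>s\<bar> \<le> t"
  shows "\<bar>LINT q|lborel. (f (hflow e s q) - f q - s * g p) * bump p r q\<bar>
           \<le> \<epsilon> * \<bar>s\<bar> * (LINT q|lborel. bump p r q)"
proof -
  define \<phi> where "\<phi> = bump p r"
  define W where "W = deriv_along (hor e) \<phi>"
  define K where "K = cball p \<delta>"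
  \<comment> \<open>The compact \<open>K\<close> contains the supports of all test functions that
    occur, so cutting off changes no integral and makes both functions bounded and Borel.\<close>
  define fK where "fK q = indicator K q * f q" for q
  define gK where "gK q = indicator K q * g q" for q
  define I where "I = (LINT q|lborel. \<phi> q)"
  have K: "compact K" "closed K" "K \<subseteq> U" by (auto simp: K_def U compact_imp_closed)
  have meas: "fK \<in> borel_measurable borel" "gK \<in> borel_measurable borel"
    unfolding fK_def[abs_def] gK_def[abs_def]
    using borel_measurable_continuous_on_indicator[of K f] borel_measurable_continuous_on_indicator[of K g]
      continuous_on_subset[OF f K(3)] continuous_on_subset[OF g K(3)] K
    by (auto simp: borel_closed)
  note [measurable] = meas
  have bdd: "\<exists>B. \<forall>q. \<bar>indicator K q * h q\<bar> \<le> B" if hU: "continuous_on U h" for h :: "'n heis \<Rightarrow> real"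
  proof -
    obtain B where "B > 0" "\<And>q. q \<in> K \<Longrightarrow> \<bar>h q\<bar> \<le> B"
      using bounded_on_compact_real[OF K(1) continuous_on_subset[OF hU K(3)]] by blast
    then have "\<bar>indicator K q * h q\<bar> \<le> B" for q by (auto simp: indicator_def)
    then show ?thesis by blast
  qed
  obtain Bf where Bf: "\<And>q. \<bar>fK q\<bar> \<le> Bf" using bdd[OF f] by (auto simp: fK_def)
  obtain Bg where Bg: "\<And>q. \<bar>gK q\<bar> \<le> Bg" using bdd[OF g] by (auto simp: gK_def)
  have sm: "smooth_on UNIV \<phi>" unfolding \<phi>_def by (rule smooth_bump)
  then have C: "Ck_on 1 UNIV \<phi>" "Ck_on 0 UNIV \<phi>" unfolding smooth_on_def by blast+
  have cont: "continuous_on UNIV \<phi>" "continuous_on UNIV W"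
    using C continuous_on_frechet_field[OF C(1) continuous_on_hor, of e]
    by (auto simp: W_def deriv_along_def[abs_def])
  have [measurable]: "\<phi> \<in> borel_measurable borel"
    by (intro borel_measurable_continuous_onI cont)
  have dW: "has_hderiv \<phi> e (W q) q" for q
    unfolding W_def deriv_along_def by (rule differentiable_has_hderiv) (use C(1) in \<open>simp del: split_paired_All\<close>)
  define \<phi>s where "\<phi>s s q = \<phi> (hflow e (- s) q)" for s q
  have supp: "q \<in> K" if "\<bar>s\<bar> \<le> t" "hflow e (- s) q \<in> ball p r" for s q
    using r(2)[OF that] by (simp add: hflow_add K_def)
  have \<phi>s0: "\<phi>s s q = 0" if "\<bar>s\<bar> \<le> t" "q \<notin> K" for s q
    using supp that bump_eq_0[OF r(1)] unfolding \<phi>s_def \<phi>_def by blast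
  have dWs: "has_hderiv (\<phi>s s) e (W (hflow e (- s) q)) q" for s q
  proof -
    have "((\<lambda>u. \<phi> (hflow e u q)) has_real_derivative W (hflow e (- s) q)) (at (0 + (- s)))"
      using has_hderiv_at[OF dW, where t = "- s" and p = q] by simp
    then have "((\<lambda>u. \<phi> (hflow e (u + (- s)) q)) has_real_derivative W (hflow e (- s) q)) (at 0)"
      by (rule DERIV_shift[THEN iffD1])
    moreover have "\<phi> (hflow e (u + (- s)) q) = \<phi>s s (hflow e u q)" for u
      unfolding \<phi>s_def hflow_add by (simp only: add.commute)
    ultimately show ?thesis unfolding has_hderiv_def by (simp only:)
  qed
  \<comment> \<open>A nonnegative function has a minimum at each of its zeros, so its derivative
    along the flow vanishes there.\<close>
  have W0: "W (hflow e (- s) q) = 0" if "\<bar>s\<bar> \<le> t" "q \<notin> K" for s q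
  proof (rule DERIV_local_min[OF dWs[unfolded has_hderiv_def] zero_less_one])
    show "\<forall>y. \<bar>0 - y\<bar> < 1 \<longrightarrow> \<phi>s s (hflow e 0 q) \<le> \<phi>s s (hflow e y q)"
      using \<phi>s0[OF that] bump_nonneg by (auto simp: \<phi>s_def \<phi>_def)
  qed
  have shift: "(LINT q|lborel. h q * \<phi>s s q) = (LINT q|lborel. h (hflow e s q) * \<phi> q)"
    if [measurable]: "h \<in> borel_measurable borel" for h :: "'n heis \<Rightarrow> real" and s
  proof -
    have "(LINT q|lborel. h q * \<phi>s s q) = (LINT q|distr lborel borel (hflow e s). h q * \<phi>s s q)"
      by (simp add: lborel_distr_hflow)
    also have "\<dots> = (LINT q|lborel. h (hflow e s q) * \<phi> q)"
      unfolding \<phi>s_def by (subst integral_distr) (auto simp: hflow_add)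
    finally show ?thesis .
  qed
  define H where "H s = (LINT q|lborel. fK q * \<phi>s s q)" for s
  have dH: "(H has_real_derivative (LINT q|lborel. gK (hflow e s q) * \<phi> q)) (at s)" if st: "\<bar>s\<bar> \<le> t" for s
  proof -
    have smooth: "smooth_on UNIV (\<phi>s s)"
      unfolding \<phi>s_def by (rule smooth_on_affine_compose[OF sm hflow_affine])
    have cs: "compact_support_in U (\<phi>s s)"
    proof -
      have "closure {x. \<phi>s s x \<noteq> 0} \<subseteq> K"
        using \<phi>s0[OF st] K by (intro closure_minimal) auto
      then show ?thesis using K compact_Int_closed[OF K(1), of "closure {x. \<phi>s s x \<noteq> 0}"]
        unfolding compact_support_in_def by (auto simp: Int_absorb1)
    qed
    have da: "deriv_along (hor e) (\<phi>s s) q = W (hflow e (- s) q)" for q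
    proof -
      have "\<phi>s s differentiable (at q)" using smooth unfolding smooth_on_def by (metis Ck_on.simps(2) UNIV_I)
      from differentiable_has_hderiv[OF this, of e] dWs[of s q] show ?thesis
        unfolding deriv_along_def has_hderiv_def by (rule DERIV_unique)
    qed
    have "(LINT q:U|lborel. f q * deriv_along (hor e) (\<phi>s s) q) = - (LINT q:U|lborel. g q * \<phi>s s q)"
      using fg smooth cs unfolding is_distr_deriv_def by blast
    moreover have "(LINT q:U|lborel. f q * deriv_along (hor e) (\<phi>s s) q) = (LINT q|lborel. fK q * W (hflow e (- s) q))"
      unfolding set_lebesgue_integral_def da fK_def using W0[OF st] K(3)
      by (intro Bochner_Integration.integral_cong) (auto simp: indicator_def)
    moreover have "(LINT q:U|lborel. g q * \<phi>s s q) = (LINT q|lborel. gK q * \<phi>s s q)"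
      unfolding set_lebesgue_integral_def gK_def using \<phi>s0[OF st] K(3)
      by (intro Bochner_Integration.integral_cong) (auto simp: indicator_def)
    ultimately have eq: "(LINT q|lborel. fK q * W (hflow e (- s) q)) = - (LINT q|lborel. gK (hflow e s q) * \<phi> q)"
      using shift[OF meas(2), of s] by simp
    \<comment> \<open>Moving on by u from time s leads to the value of \<open>H\<close> at s - u;
      the reversal cancels the minus sign in the distributional identity.\<close>
    have "((\<lambda>u. LINT q|lborel. fK q * \<phi>s s (hflow e u q)) has_real_derivative
           (LINT q|lborel. fK q * W (hflow e (- s) q))) (at 0)"
    proof (rule integral_hflow_DERIV_0[OF meas(1) Bf K(1) \<phi>s0[OF st] _ _ dWs])
      have ch: "continuous_on UNIV (hflow e (- s))" by (intro continuous_intros)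
      show "continuous_on UNIV (\<phi>s s)" unfolding \<phi>s_def
        by (rule continuous_on_compose2[OF cont(1) ch]) simp
      show "continuous_on UNIV (\<lambda>q. W (hflow e (- s) q))"
        by (rule continuous_on_compose2[OF cont(2) ch]) simp
    qed
    moreover have "(LINT q|lborel. fK q * \<phi>s s (hflow e u q)) = H (s - u)" for u
      by (simp add: H_def \<phi>s_def hflow_add)
    ultimately have "((\<lambda>u. H (s - u)) has_real_derivative (LINT q|lborel. fK q * W (hflow e (- s) q))) (at (s - s))"
      by simp
    moreover have "((\<lambda>x. s - x) has_real_derivative - 1) (at s)"
      by (auto intro!: derivative_eq_intros)
    ultimately have "((\<lambda>x. H (s - (s - x))) has_real_derivative
        (LINT q|lborel. fK q * W (hflow e (- s) q)) * - 1) (at s)"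
      by (rule DERIV_chain2[where f = "\<lambda>u. H (s - u)" and g = "\<lambda>x. s - x"])
    then show ?thesis using eq by simp
  qed
  have int: "integrable lborel (\<lambda>q. h (hflow e s q) * \<phi> q)"
    if "h \<in> borel_measurable borel" "\<And>q. \<bar>h q\<bar> \<le> B" for h B s
    unfolding \<phi>_def using that r(1) by (intro bump_integrable[where B = B]) auto
  have int\<phi>: "integrable lborel \<phi>" using int[of "\<lambda>_. 1" 1] by simp
  have bound: "\<bar>(LINT q|lborel. gK (hflow e s q) * \<phi> q) - g p * I\<bar> \<le> \<epsilon> * I" if st: "\<bar>s\<bar> \<le> t" for s
  proof -
    have "(LINT q|lborel. gK (hflow e s q) * \<phi> q) - g p * I = (LINT q|lborel. gK (hflow e s q) * \<phi> q - g p * \<phi> q)"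
      unfolding I_def using int[OF meas(2) Bg] int\<phi> by simp
    also have "\<bar>\<dots>\<bar> \<le> (LINT q|lborel. \<epsilon> * \<phi> q)"
    proof (rule integral_abs_bound_integral)
      show "integrable lborel (\<lambda>q. gK (hflow e s q) * \<phi> q - g p * \<phi> q)"
        using int[OF meas(2) Bg] int\<phi> by simp
      show "integrable lborel (\<lambda>q. \<epsilon> * \<phi> q)" using int\<phi> by simp
      show "\<bar>gK (hflow e s q) * \<phi> q - g p * \<phi> q\<bar> \<le> \<epsilon> * \<phi> q" for q
      proof (cases "q \<in> ball p r")
        case True
        then have "gK (hflow e s q) = g (hflow e s q)" using r(2)[OF st True] by (simp add: gK_def K_def)
        then have "\<bar>gK (hflow e s q) - g p\<bar> * \<bar>\<phi> q\<bar> \<le> \<epsilon> * \<phi> q"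
          using \<epsilon>[OF st True] bump_nonneg[of p r q] by (auto simp: \<phi>_def intro!: mult_right_mono)
        then show ?thesis by (simp add: left_diff_distrib flip: abs_mult)
      next
        case False
        then show ?thesis using bump_eq_0[OF r(1) False] by (simp add: \<phi>_def)
      qed
    qed
    finally show ?thesis by (simp add: I_def)
  qed
  \<comment> \<open>Subtracting the expected linear part leaves a function of s with derivative at
    most \<open>\<epsilon> * I\<close>.\<close>
  have "norm ((H s - s * (g p * I)) - (H 0 - 0 * (g p * I))) \<le> \<epsilon> * I * norm (s - 0)"
  proof (rule field_differentiable_bound[of "{-\<bar>s\<bar>..\<bar>s\<bar>}" "\<lambda>s. H s - s * (g p * I)"
        "\<lambda>s. (LINT q|lborel. gK (hflow e s q) * \<phi> q) - g p * I"])
    fix z assume "z \<in> {-\<bar>s\<bar>..\<bar>s\<bar>}"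
    then have z: "\<bar>z\<bar> \<le> t" using s by auto
    show "((\<lambda>s. H s - s * (g p * I)) has_field_derivative (LINT q|lborel. gK (hflow e z q) * \<phi> q) - g p * I)
         (at z within {-\<bar>s\<bar>..\<bar>s\<bar>})"
    proof (rule has_field_derivative_at_within, rule DERIV_diff[OF dH[OF z]])
      show "((\<lambda>s. s * (g p * I)) has_field_derivative g p * I) (at z)"
        by (auto intro!: derivative_eq_intros)
    qed
    show "norm ((LINT q|lborel. gK (hflow e z q) * \<phi> q) - g p * I) \<le> \<epsilon> * I" using bound[OF z] by simp
  qed auto
  moreover have "H s - H 0 - s * (g p * I) = (LINT q|lborel. (f (hflow e s q) - f q - s * g p) * \<phi> q)"
  proof -
    have "H s = (LINT q|lborel. fK (hflow e s q) * \<phi> q)" for s unfolding H_def by (rule shift) simp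
    then have "H s - H 0 - s * (g p * I) = (LINT q|lborel. fK (hflow e s q) * \<phi> q - fK (hflow e 0 q) * \<phi> q - s * (g p * \<phi> q))"
      unfolding I_def using int[OF meas(1) Bf, of s] int[OF meas(1) Bf, of 0] int\<phi> by simp
    also have "\<dots> = (LINT q|lborel. (f (hflow e s q) - f q - s * g p) * \<phi> q)"
    proof (rule Bochner_Integration.integral_cong[OF refl])
      fix q
      show "fK (hflow e s q) * \<phi> q - fK (hflow e 0 q) * \<phi> q - s * (g p * \<phi> q) = (f (hflow e s q) - f q - s * g p) * \<phi> q"
      proof (cases "q \<in> ball p r")
        case True
        have "\<bar>0::real\<bar> \<le> t" using s by simp
        from r(2)[OF this True] r(2)[OF s True] show ?thesis
          by (simp add: fK_def K_def algebra_simps)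
      next
        case False
        then show ?thesis using bump_eq_0[OF r(1) False] by (simp add: \<phi>_def)
      qed
    qed
    finally show ?thesis .
  qed
  ultimately show ?thesis unfolding \<phi>_def I_def by (simp add: algebra_simps)
qed

text \<open>If the pointwise remainder at \<open>p\<close> were too large for some s, then by
  continuity it would be large with constant sign near \<open>p\<close>, and its average against a
  small bump would violate \<open>distr_deriv_estimate\<close>.\<close>

lemma distr_has_hderiv:
  fixes f g :: "'n::finite heis \<Rightarrow> real"
  assumes U: "open U" and f: "continuous_on U f" and g: "continuous_on U g"
    and fg: "is_distr_deriv U (hor e) f g" and p: "p \<in> U"
  shows "has_hderiv f e (g p) p"
proof -
  obtain \<delta> where \<delta>: "\<delta> > 0" "cball p \<delta> \<subseteq> U" using U p open_contains_cball by blast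
  have "\<exists>d>0. \<forall>s. s \<noteq> 0 \<and> \<bar>s\<bar> < d \<longrightarrow> \<bar>(f (hflow e s p) - f p) / s - g p\<bar> < \<epsilon>" if "\<epsilon> > 0" for \<epsilon>
  proof -
    define \<eta> where "\<eta> = \<epsilon> / 2"
    have \<eta>: "0 < \<eta>" "\<eta> < \<epsilon>" using that by (auto simp: \<eta>_def)
    have "isCont g p" using g U p by (simp add: continuous_on_eq_continuous_at)
    then obtain \<delta>1 where \<delta>1: "\<delta>1 > 0" "\<And>q. dist q p < \<delta>1 \<Longrightarrow> \<bar>g q - g p\<bar> < \<eta>"
      using \<eta> unfolding continuous_at_eps_delta dist_real_def by blast
    obtain r t where rt: "r > 0" "t > 0"
      "\<And>s q. \<bar>s\<bar> \<le> t \<Longrightarrow> q \<in> ball p r \<Longrightarrow> hflow e s q \<in> ball p (min \<delta> \<delta>1)"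
      using hflow_near[of "ball p (min \<delta> \<delta>1)" p e] \<delta> \<delta>1 by (metis centre_in_ball min_less_iff_conj open_ball)
    have est: "\<bar>f (hflow e s p) - f p - s * g p\<bar> \<le> \<eta> * \<bar>s\<bar>" if s: "\<bar>s\<bar> \<le> t" for s
    proof (rule ccontr)
      let ?D = "\<lambda>q. f (hflow e s q) - f q - s * g p"
      assume "\<not> \<bar>?D p\<bar> \<le> \<eta> * \<bar>s\<bar>"
      then obtain \<kappa> where \<kappa>: "\<eta> * \<bar>s\<bar> < \<kappa>" "\<kappa> < \<bar>?D p\<bar>" using dense[of "\<eta> * \<bar>s\<bar>" "\<bar>?D p\<bar>"] by auto
      \<comment> \<open>Multiplying by the sign turns the violated bound on an absolute value into a
        one-sided bound that survives averaging.\<close>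
      define \<sigma> where "\<sigma> = sgn (?D p)"
      have "\<kappa> > 0" using \<kappa>(1) \<eta>(1) by (smt (verit) mult_nonneg_nonneg abs_ge_zero)
      then have "?D p \<noteq> 0" using \<kappa>(2) by auto
      then have \<sigma>: "\<sigma> * ?D p > \<kappa>" "\<bar>\<sigma>\<bar> = 1" using \<kappa>(2) by (auto simp: \<sigma>_def sgn_if)
      have flow: "q \<in> ball p r \<Longrightarrow> hflow e s q \<in> U" "q \<in> ball p r \<Longrightarrow> q \<in> U" for q
      proof -
        have "ball p (min \<delta> \<delta>1) \<subseteq> U" using \<delta>(2) by auto
        moreover have "q \<in> ball p r \<Longrightarrow> q \<in> ball p (min \<delta> \<delta>1)" using rt(3)[of 0 q] rt(2) by simp
        ultimately show "q \<in> ball p r \<Longrightarrow> hflow e s q \<in> U" "q \<in> ball p r \<Longrightarrow> q \<in> U"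
          using rt(3)[OF s, of q] by blast+
      qed
      have cD: "continuous_on (ball p r) ?D"
      proof -
        have "continuous_on (ball p r) (\<lambda>q. f (hflow e s q))"
          by (rule continuous_on_compose2[OF f]) (use flow in \<open>auto intro!: continuous_intros\<close>)
        moreover have "continuous_on (ball p r) f" using flow by (intro continuous_on_subset[OF f]) auto
        ultimately show ?thesis by (intro continuous_on_diff continuous_on_const)
      qed
      then have "open (ball p r \<inter> (\<lambda>q. \<sigma> * ?D q) -` {\<kappa><..})"
        by (intro continuous_open_preimage continuous_on_mult[OF continuous_on_const cD]) auto
      moreover have "p \<in> ball p r \<inter> (\<lambda>q. \<sigma> * ?D q) -` {\<kappa><..}" using \<sigma> rt(1) by simp
      \<comment> \<open>The radius may depend on s, because the averaged estimate holds with the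
        same constants for every smaller bump.\<close>
      ultimately obtain r' where r': "r' > 0" "ball p r' \<subseteq> ball p r \<inter> (\<lambda>q. \<sigma> * ?D q) -` {\<kappa><..}"
        using open_contains_ball by meson
      define I where "I = (LINT q|lborel. bump p r' q)"
      have I: "I > 0" unfolding I_def by (rule bump_integral_pos[OF r'(1)])
      have sub: "q \<in> ball p r' \<Longrightarrow> q \<in> ball p r" for q using r' by blast
      have "\<bar>LINT q|lborel. ?D q * bump p r' q\<bar> \<le> \<eta> * \<bar>s\<bar> * I"
        unfolding I_def
      proof (rule distr_deriv_estimate[OF \<delta>(2) f g fg r'(1) _ _ s])
        fix s' q assume "\<bar>s'\<bar> \<le> t" "q \<in> ball p r'"
        then have "hflow e s' q \<in> ball p (min \<delta> \<delta>1)" using rt(3) sub by blast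
        then show "hflow e s' q \<in> cball p \<delta>" "\<bar>g (hflow e s' q) - g p\<bar> \<le> \<eta>"
          using \<delta>1(2)[of "hflow e s' q"] by (auto simp: dist_commute)
      qed
      moreover have "\<kappa> * I \<le> \<bar>LINT q|lborel. ?D q * bump p r' q\<bar>"
      proof -
        have "\<kappa> * I = (LINT q|lborel. \<kappa> * bump p r' q)" by (simp add: I_def)
        also have "\<dots> \<le> (LINT q|lborel. \<sigma> * (?D q * bump p r' q))"
        proof (cases "integrable lborel (\<lambda>q. \<sigma> * (?D q * bump p r' q))")
          case True
          show ?thesis
          proof (rule integral_mono)
            show "integrable lborel (\<lambda>q. \<kappa> * bump p r' q)"
              using bump_integrable[of "\<lambda>_. \<kappa>" "\<bar>\<kappa>\<bar>" r' p] r'(1) by simp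
            fix q
            show "\<kappa> * bump p r' q \<le> \<sigma> * (?D q * bump p r' q)"
            proof (cases "q \<in> ball p r'")
              case True
              then have "\<kappa> \<le> \<sigma> * ?D q" using r'(2) by auto
              then show ?thesis using bump_nonneg[of p r' q] mult_right_mono by (metis mult.assoc)
            next
              case False
              then show ?thesis using bump_eq_0[OF r'(1) False] by simp
            qed
          qed (rule True)
        next
          case False
          \<comment> \<open>This case is contradictory: on the support of the bump the remainder is
            bounded and Borel.\<close>
          have "integrable lborel (\<lambda>q. ?D q * bump p r' q)"
          proof -
            define G where "G q = indicator (ball p r') q * ?D q" for q
            have "ball p r' \<subseteq> ball p r" using sub by blast
            from borel_measurable_continuous_on_indicator[OF _ continuous_on_subset[OF cD this]]
            have Gm: "G \<in> borel_measurable borel" by (simp add: G_def[abs_def])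
            obtain B where B: "\<And>q. \<bar>G q\<bar> \<le> B"
            proof -
              have K: "compact (cball p \<delta>)" by simp
              obtain B where B: "B > 0" "\<And>q. q \<in> cball p \<delta> \<Longrightarrow> \<bar>f q\<bar> \<le> B"
                using bounded_on_compact_real[OF K continuous_on_subset[OF f \<delta>(2)]] by blast
              have "\<bar>G q\<bar> \<le> B + B + \<bar>s * g p\<bar>" for q
              proof (cases "q \<in> ball p r'")
                case True
                then have "hflow e s q \<in> cball p \<delta>" "q \<in> cball p \<delta>"
                  using rt(3)[OF s sub[OF True]] rt(3)[of 0 q] rt(2) sub[OF True]
                  by (auto simp: less_imp_le)
                then have "\<bar>f (hflow e s q)\<bar> \<le> B" "\<bar>f q\<bar> \<le> B" using B(2) by blast+
                then have "\<bar>?D q\<bar> \<le> B + B + \<bar>s * g p\<bar>" by linarith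
                then show ?thesis using True by (simp add: G_def)
              qed (use B(1) in \<open>simp add: G_def\<close>)
              then show ?thesis using that by blast
            qed
            have "?D q * bump p r' q = G q * bump p r' q" for q
              using bump_eq_0[OF r'(1), of q p] by (auto simp: G_def indicator_def)
            then show ?thesis using bump_integrable[OF Gm B r'(1), of p] by (simp only:)
          qed
          then show ?thesis using False by simp
        qed
        also have "\<dots> = \<sigma> * (LINT q|lborel. ?D q * bump p r' q)" by simp
        also have "\<dots> \<le> \<bar>\<sigma> * (LINT q|lborel. ?D q * bump p r' q)\<bar>" by simp
        also have "\<dots> = \<bar>LINT q|lborel. ?D q * bump p r' q\<bar>" using \<sigma>(2) by (simp add: abs_mult)
        finally show ?thesis .
      qed
      ultimately have "\<kappa> * I \<le> \<eta> * \<bar>s\<bar> * I" by simp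
      then show False using \<kappa>(1) I by simp
    qed
    show ?thesis
    proof (intro exI[of _ t] conjI allI impI rt(2))
      fix s :: real assume s: "s \<noteq> 0 \<and> \<bar>s\<bar> < t"
      have "(f (hflow e s p) - f p) / s - g p = (f (hflow e s p) - f p - s * g p) / s"
        using s by (simp add: field_simps)
      then have "\<bar>(f (hflow e s p) - f p) / s - g p\<bar> = \<bar>f (hflow e s p) - f p - s * g p\<bar> / \<bar>s\<bar>"
        by simp
      also have "\<dots> \<le> \<eta>" using est[of s] s by (simp add: divide_le_eq)
      finally show "\<bar>(f (hflow e s p) - f p) / s - g p\<bar> < \<epsilon>" using \<eta> by simp
    qed
  qed
  then show ?thesis
    unfolding has_hderiv_def has_field_derivative_iff LIM_eq by simp
qed

subsection \<open>The box norm\<close>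

lemma box_norm_nonneg [simp]: "box_norm q \<ge> 0"
  by (simp add: box_norm_def le_max_iff_disj)

lemma box_norm_le_iff: "c \<ge> 0 \<Longrightarrow> box_norm q \<le> c \<longleftrightarrow> norm (fst q) \<le> c \<and> \<bar>snd q\<bar> \<le> c\<^sup>2"
  using real_sqrt_le_iff[of "\<bar>snd q\<bar>" "c\<^sup>2"] by (simp add: box_norm_def del: real_sqrt_le_iff)

lemma box_norm_less_iff: "c > 0 \<Longrightarrow> box_norm q < c \<longleftrightarrow> norm (fst q) < c \<and> \<bar>snd q\<bar> < c\<^sup>2"
  using real_sqrt_less_iff[of "\<bar>snd q\<bar>" "c\<^sup>2"] by (simp add: box_norm_def del: real_sqrt_less_iff)

lemma box_norm_fst_le: "norm (fst q) \<le> box_norm q"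
  and box_norm_snd_le: "\<bar>snd q\<bar> \<le> (box_norm q)\<^sup>2"
  using box_norm_le_iff[of "box_norm q" q] by auto

lemma box_norm_0 [simp]: "box_norm 0 = 0"
  by (simp add: box_norm_def)

lemma box_norm_uminus [simp]: "box_norm (- q) = box_norm q"
  by (simp add: box_norm_def)

text \<open>The twist in the group law is at most 2ab, precisely the mixed term of (a + b)^2, so the
  triangle inequality holds with constant 1.\<close>

lemma box_norm_hmul: "box_norm (p \<star> q) \<le> box_norm p + box_norm q"
proof (subst box_norm_le_iff)
  let ?a = "box_norm p" and ?b = "box_norm q"
  have "\<bar>Im (hdot (fst p) (fst q))\<bar> \<le> norm (fst p) * norm (fst q)" by (rule abs_Im_hdot_le)
  also have "\<dots> \<le> ?a * ?b" by (intro mult_mono box_norm_fst_le) auto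
  finally have "\<bar>snd p + snd q + 2 * Im (hdot (fst p) (fst q))\<bar> \<le> ?a\<^sup>2 + ?b\<^sup>2 + 2 * (?a * ?b)"
    using box_norm_snd_le[of p] box_norm_snd_le[of q] by linarith
  then show "norm (fst (p \<star> q)) \<le> ?a + ?b \<and> \<bar>snd (p \<star> q)\<bar> \<le> (?a + ?b)\<^sup>2"
    using norm_triangle_mono[OF box_norm_fst_le[of p] box_norm_fst_le[of q]]
    by (simp add: snd_hmul power2_sum)
qed simp

lemma box_norm_axis: "box_norm (s *\<^sub>R e, 0) = \<bar>s\<bar> * norm e"
  by (simp add: box_norm_def)

lemma U_ball_iff: "q \<in> U_ball p r \<longleftrightarrow> box_norm (- p \<star> q) < r"
proof
  assume "box_norm (- p \<star> q) < r"
  then show "q \<in> U_ball p r"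
    unfolding U_ball_def by (intro image_eqI[of _ _ "- p \<star> q"]) simp_all
qed (auto simp: U_ball_def)

lemma hmul_near:
  fixes p0 :: "'n::finite heis"
  assumes "\<delta> > 0"
  obtains \<rho> R where "\<rho> > 0" "R > 0"
    "\<And>p m. p \<in> ball p0 \<rho> \<Longrightarrow> box_norm m < R \<Longrightarrow> p \<star> m \<in> ball p0 \<delta>"
proof -
  have "open ((\<lambda>x. fst x \<star> snd x) -` ball p0 \<delta>)"
    by (intro open_vimage) (auto intro!: continuous_intros)
  moreover have "(p0, 0) \<in> (\<lambda>x. fst x \<star> snd x) -` ball p0 \<delta>" using assms by simp
  ultimately obtain d where d0: "d > 0" "ball (p0, 0) d \<subseteq> (\<lambda>x. fst x \<star> snd x) -` ball p0 \<delta>"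
    by (rule openE)
  then have d: "\<And>p m :: 'n heis. dist (p, m) (p0, 0) < d \<Longrightarrow> p \<star> m \<in> ball p0 \<delta>"
    by (force simp: subset_eq dist_commute simp del: split_paired_All)
  \<comment> \<open>For R \<le> 1 one has R^2 \<le> R, so box norm below R gives Euclidean norm
    below 2R \<le> d / 2.\<close>
  define R where "R = min 1 (d / 4)"
  show ?thesis
  proof (rule that[of "d / 2" R])
    fix p m :: "'n heis" assume p: "p \<in> ball p0 (d / 2)" and m: "box_norm m < R"
    have R: "R > 0" "R \<le> 1" "R \<le> d / 4" using d0(1) by (auto simp: R_def)
    have "norm m \<le> norm (fst m) + \<bar>snd m\<bar>"
      using norm_Pair_le[of "fst m" "snd m"] by simp
    also have "\<dots> < R + R\<^sup>2" using m box_norm_less_iff[OF R(1), of m] by linarith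
    also have "R\<^sup>2 \<le> R" using R mult_left_le[of R R] by (simp add: power2_eq_square)
    finally have "norm m < d / 2" using R by linarith
    then have "dist (p, m) (p0, 0) < d"
      using p sqrt_sum_squares_le_sum_abs[of "dist p p0" "norm m"]
      by (simp add: dist_Pair_Pair dist_commute)
    then show "p \<star> m \<in> ball p0 \<delta>" by (rule d)
  qed (use d0 in \<open>auto simp: R_def\<close>)
qed

lemma U_ball_mem_ball:
  assumes "open V" "p \<in> V"
  obtains r where "r > 0" "U_ball p r \<subseteq> V"
proof -
  obtain \<delta> where \<delta>: "\<delta> > 0" "ball p \<delta> \<subseteq> V" using assms openE by blast
  obtain \<rho> R where *: "\<rho> > 0" "R > 0" "\<And>q m. q \<in> ball p \<rho> \<Longrightarrow> box_norm m < R \<Longrightarrow> q \<star> m \<in> ball p \<delta>"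
    using hmul_near[OF \<delta>(1)] by metis
  have "p \<in> ball p \<rho>" using *(1) by simp
  from *(3)[OF this] \<delta>(2) have "U_ball p R \<subseteq> V" unfolding U_ball_def by blast
  then show ?thesis using that *(2) by blast
qed

lemma continuous_on_box_norm [continuous_intros]:
  "continuous_on S f \<Longrightarrow> continuous_on S (\<lambda>x. box_norm (f x))"
  unfolding box_norm_def by (intro continuous_intros)

lemma open_U_ball: "open (U_ball p r)"
proof -
  have "U_ball p r = (\<lambda>q. box_norm (- p \<star> q)) -` {..<r}"
    by (auto simp: U_ball_iff simp del: split_paired_All)
  then show ?thesis by (auto intro!: open_vimage continuous_intros)
qed

lemma open_B_ball: "open (B_ball p r)"
proof -
  have "B_ball p r = (\<lambda>q. root 4 (norm (fst (- p \<star> q)) ^ 4 + snd (- p \<star> q) ^ 2)) -` {..<r}"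
  proof (intro equalityI subsetI)
    fix q assume "q \<in> (\<lambda>q. root 4 (norm (fst (- p \<star> q)) ^ 4 + snd (- p \<star> q) ^ 2)) -` {..<r}"
    then show "q \<in> B_ball p r"
      unfolding B_ball_def by (intro image_eqI[of _ _ "- p \<star> q"]) simp_all
  qed (auto simp: B_ball_def simp del: fst_hmul)
  moreover have "continuous_on UNIV (\<lambda>q. - p \<star> q)"
    by (intro continuous_intros)
  then have "continuous_on UNIV (\<lambda>q. root 4 (norm (fst (- p \<star> q)) ^ 4 + snd (- p \<star> q) ^ 2))"
    by (intro continuous_on_real_root continuous_on_add continuous_on_power continuous_on_norm
        continuous_on_fst continuous_on_snd)
  ultimately show ?thesis by (auto intro!: open_vimage)
qed

lemma mem_B_ball: "r > 0 \<Longrightarrow> p \<in> B_ball p r"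
  unfolding B_ball_def by (intro image_eqI[of _ _ 0]) auto

subsection \<open>Horizontal paths and the Lipschitz estimate\<close>

text \<open>Endpoints of finitely many flow segments in basis directions starting at the origin,
  with total length \<open>c\<close>. Such segments are the only curves along which a horizontal
  gradient gives control.\<close>

inductive hpath :: "'n::finite heis \<Rightarrow> real \<Rightarrow> bool" where
  start: "hpath 0 0"
| move: "hpath m c \<Longrightarrow> e \<in> Basis \<Longrightarrow> hpath (hflow e s m) (c + \<bar>s\<bar>)"

lemma hpath_box_norm: "hpath m c \<Longrightarrow> box_norm m \<le> c"
proof (induction rule: hpath.induct)
  case (move m c e s)
  have "box_norm (hflow e s m) \<le> box_norm m + box_norm (s *\<^sub>R e, 0)"
    unfolding hflow_def by (rule box_norm_hmul)
  then show ?case using move by (simp add: box_norm_axis)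
qed simp

lemma hpath_hmul: "hpath m' c' \<Longrightarrow> hpath m c \<Longrightarrow> hpath (m \<star> m') (c + c')"
proof (induction rule: hpath.induct)
  case (move m' c' e s)
  then show ?case using hpath.move[of "m \<star> m'" "c + c'" e s] by (simp add: hmul_hflow add.assoc)
qed simp

text \<open>The coordinates are travelled one after another, each costing at most
  \<open>norm z\<close>. The vertical coordinate picked up on the way is left uncontrolled and is
  corrected in \<open>hpath_bound\<close>.\<close>

lemma hpath_horizontal:
  fixes z :: "complex ^ 'n::finite"
  assumes "finite B" "B \<subseteq> Basis"
  shows "\<exists>t c. hpath (\<Sum>b\<in>B. (z \<bullet> b) *\<^sub>R b, t) c \<and> c \<le> card B * norm z"
  using assms
proof (induction B rule: finite_induct)
  case empty
  then show ?case using hpath.start by (auto simp: zero_prod_def)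
next
  case (insert b B)
  then obtain t c where tc: "hpath (\<Sum>b\<in>B. (z \<bullet> b) *\<^sub>R b, t) c" "c \<le> card B * norm z" by auto
  have "hpath (hflow b (z \<bullet> b) (\<Sum>b\<in>B. (z \<bullet> b) *\<^sub>R b, t)) (c + \<bar>z \<bullet> b\<bar>)"
    using tc(1) insert by (intro hpath.move) auto
  moreover have "hflow b (z \<bullet> b) (\<Sum>b\<in>B. (z \<bullet> b) *\<^sub>R b, t)
      = (\<Sum>b\<in>insert b B. (z \<bullet> b) *\<^sub>R b, t + (z \<bullet> b) * (2 * Im (hdot (\<Sum>b\<in>B. (z \<bullet> b) *\<^sub>R b) b)))"
    using insert.hyps by (simp add: hflow_alt)
  ultimately have "hpath (\<Sum>b\<in>insert b B. (z \<bullet> b) *\<^sub>R b, t + (z \<bullet> b) * (2 * Im (hdot (\<Sum>b\<in>B. (z \<bullet> b) *\<^sub>R b) b)))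
      (c + \<bar>z \<bullet> b\<bar>)"
    by (simp only:)
  moreover have "\<bar>z \<bullet> b\<bar> \<le> norm z" using insert.prems by (simp add: Basis_le_norm)
  then have "c + \<bar>z \<bullet> b\<bar> \<le> card (insert b B) * norm z"
    using tc(2) insert.hyps by (simp add: algebra_simps)
  ultimately show ?case by blast
qed

lemma axis_Basis: "axis j 1 \<in> (Basis :: (complex ^ 'n::finite) set)" "axis j \<i> \<in> (Basis :: (complex ^ 'n::finite) set)"
  by (simp_all add: axis_in_Basis_iff Basis_complex_def)

text \<open>The vertical direction is reached by a commutator of two horizontal ones.\<close>

lemma hpath_vertical: "hpath ((0, \<tau>) :: 'n::finite heis) (2 * sqrt \<bar>\<tau>\<bar>)"
proof -
  define j :: 'n where "j = undefined"
  \<comment> \<open>The loop with sides a, b, -a, -b ends at height -4ab. Equal lengths |a| = |b|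
    and the sign of b make this height \<tau>, at total length 4|a|.\<close>
  define a where "a = sqrt \<bar>\<tau>\<bar> / 2"
  define b where "b = - sgn \<tau> * a"
  let ?X = "axis j 1 :: complex ^ 'n" and ?Y = "axis j \<i> :: complex ^ 'n"
  have "hpath (hflow ?Y (- b) (hflow ?X (- a) (hflow ?Y b (hflow ?X a 0)))) (0 + \<bar>a\<bar> + \<bar>b\<bar> + \<bar>- a\<bar> + \<bar>- b\<bar>)"
    by (intro hpath.intros axis_Basis)
  moreover have "hflow ?Y (- b) (hflow ?X (- a) (hflow ?Y b (hflow ?X a 0))) = (0, - 4 * a * b)"
    by (simp add: hflow_alt imh_simps Im_hdot_axis prod_eq_iff algebra_simps)
  moreover have "- 4 * a * b = sgn \<tau> * (sqrt \<bar>\<tau>\<bar>)\<^sup>2" by (simp add: a_def b_def power2_eq_square)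
  moreover have "sgn \<tau> * (sqrt \<bar>\<tau>\<bar>)\<^sup>2 = \<tau>" by (simp add: sgn_if)
  moreover have "\<bar>b\<bar> = \<bar>a\<bar>" by (cases "\<tau> = 0") (auto simp: a_def b_def sgn_if)
  then have "0 + \<bar>a\<bar> + \<bar>b\<bar> + \<bar>- a\<bar> + \<bar>- b\<bar> = 2 * sqrt \<bar>\<tau>\<bar>" by (simp add: a_def)
  ultimately show ?thesis by simp
qed

text \<open>The horizontal part is reached at cost at most D times the box norm. The height picked
  up is at most the square of that cost, so the vertical correction costs at most 2 (1 + D) times
  the box norm.\<close>

lemma hpath_bound:
  obtains N where "N > 0" "\<And>q :: 'n::finite heis. \<exists>c. hpath q c \<and> c \<le> N * box_norm q"
proof -
  define D :: real where "D = card (Basis :: (complex ^ 'n) set)"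
  show ?thesis
  proof (rule that[of "D + 2 * (1 + D)"])
    fix q :: "'n heis"
    let ?r = "box_norm q"
    have D: "D \<ge> 0" by (simp add: D_def)
    obtain t c where "hpath (\<Sum>b\<in>Basis. (fst q \<bullet> b) *\<^sub>R b, t) c" "c \<le> card (Basis :: (complex ^ 'n) set) * norm (fst q)"
      using hpath_horizontal[OF finite_Basis order_refl] by blast
    then have tc: "hpath (fst q, t) c" "c \<le> D * norm (fst q)"
      by (simp_all add: euclidean_representation D_def)
    have "D * norm (fst q) \<le> D * ?r" using box_norm_fst_le[of q] D by (intro mult_left_mono)
    then have c: "c \<le> D * ?r" using tc by linarith
    have c0: "c \<ge> 0" using hpath_box_norm[OF tc(1)] box_norm_nonneg order_trans by blast
    have "\<bar>t\<bar> \<le> (box_norm (fst q, t))\<^sup>2" using box_norm_snd_le[of "(fst q, t)"] by simp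
    also have "\<dots> \<le> (D * ?r)\<^sup>2" using hpath_box_norm[OF tc(1)] c by (intro power_mono) auto
    finally have "\<bar>snd q - t\<bar> \<le> ?r\<^sup>2 + (D * ?r)\<^sup>2" using box_norm_snd_le[of q] by linarith
    also have "\<dots> \<le> ((1 + D) * ?r)\<^sup>2" using D by (simp add: power2_eq_square algebra_simps)
    finally have "sqrt \<bar>snd q - t\<bar> \<le> (1 + D) * ?r" using D by (intro real_le_lsqrt) auto
    moreover have "hpath ((fst q, t) \<star> (0, snd q - t)) (c + 2 * sqrt \<bar>snd q - t\<bar>)"
      by (rule hpath_hmul[OF hpath_vertical tc(1)])
    moreover have "(fst q, t) \<star> (0, snd q - t) = q" by (simp add: hmul_def imh_simps)
    ultimately show "\<exists>c. hpath q c \<and> c \<le> (D + 2 * (1 + D)) * ?r"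
      using c by (auto simp: algebra_simps intro!: exI[of _ "c + 2 * sqrt \<bar>snd q - t\<bar>"])
  qed (auto simp: D_def add_nonneg_pos)
qed

text \<open>The mean value theorem on each segment; since length bounds the box norm, the whole path
  stays where the gradient is bounded by \<open>G\<close>.\<close>

lemma hpath_Lipschitz:
  assumes f: "hgrad_on U f F" and G: "G \<ge> 0"
    "\<And>m. box_norm m < R \<Longrightarrow> p \<star> m \<in> U \<and> norm (F (p \<star> m)) \<le> G"
  shows "hpath m c \<Longrightarrow> c < R \<Longrightarrow> \<bar>f (p \<star> m) - f p\<bar> \<le> G * c"
proof (induction rule: hpath.induct)
  case (move m c e s)
  have c: "c < R" "box_norm m \<le> c" using move hpath_box_norm[of m c] by auto
  have "norm (f (hflow e s (p \<star> m)) - f (hflow e 0 (p \<star> m))) \<le> G * norm (s - 0)"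
  proof (rule field_differentiable_bound[of "{-\<bar>s\<bar>..\<bar>s\<bar>}" "\<lambda>s. f (hflow e s (p \<star> m))"
        "\<lambda>s. F (hflow e s (p \<star> m)) \<bullet> e"])
    fix t assume "t \<in> {-\<bar>s\<bar>..\<bar>s\<bar>}"
    then have t: "\<bar>t\<bar> \<le> \<bar>s\<bar>" by auto
    have "box_norm (hflow e t m) \<le> box_norm m + \<bar>t\<bar>"
      using box_norm_hmul[of m "(t *\<^sub>R e, 0)"] move by (simp add: hflow_def box_norm_axis)
    then have "box_norm (hflow e t m) < R" using t c move by linarith
    from G(2)[OF this] have U: "hflow e t (p \<star> m) \<in> U" "norm (F (hflow e t (p \<star> m))) \<le> G"
      by (auto simp: hmul_hflow)
    then have "has_hderiv f e (F (hflow e t (p \<star> m)) \<bullet> e) (hflow e t (p \<star> m))"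
      using f move unfolding hgrad_on_def by blast
    then show "((\<lambda>s. f (hflow e s (p \<star> m))) has_field_derivative F (hflow e t (p \<star> m)) \<bullet> e) (at t within {-\<bar>s\<bar>..\<bar>s\<bar>})"
      by (intro DERIV_subset[OF has_hderiv_at]) auto
    show "norm (F (hflow e t (p \<star> m)) \<bullet> e) \<le> G"
      using Basis_le_norm[OF move(2), of "F (hflow e t (p \<star> m))"] U(2) by simp
  qed auto
  then have "\<bar>f (p \<star> hflow e s m) - f (p \<star> m)\<bar> \<le> G * \<bar>s\<bar>" by (simp add: hmul_hflow)
  moreover have "\<bar>f (p \<star> m) - f p\<bar> \<le> G * c" using move c by simp
  ultimately show ?case by (simp add: algebra_simps)
qed simp

text \<open>A bound on the horizontal gradient controls the function in every direction, vertical
  ones included, because every point is joined to the base point by a horizontal path of length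
  comparable to the box norm.\<close>

lemma hgrad_on_Lipschitz:
  fixes f :: "'n::finite heis \<Rightarrow> real"
  assumes f: "hgrad_on U f F" and p0: "p0 \<in> U"
  obtains \<rho> R L where "\<rho> > 0" "R > 0" "L > 0" "ball p0 \<rho> \<subseteq> U"
    "\<And>p q. p \<in> ball p0 \<rho> \<Longrightarrow> box_norm q < R \<Longrightarrow> p \<star> q \<in> U \<and> \<bar>f (p \<star> q) - f p\<bar> \<le> L * box_norm q"
proof -
  obtain \<delta> where \<delta>: "\<delta> > 0" "cball p0 \<delta> \<subseteq> U"
    using f p0 open_contains_cball unfolding hgrad_on_def by blast
  have "continuous_on (cball p0 \<delta>) (\<lambda>q. norm (F q))"
    using f \<delta>(2) unfolding hgrad_on_def by (auto intro!: continuous_intros intro: continuous_on_subset)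
  then obtain G where G: "G > 0" "\<And>q. q \<in> cball p0 \<delta> \<Longrightarrow> \<bar>norm (F q)\<bar> \<le> G"
    using bounded_on_compact_real[OF compact_cball] by metis
  obtain \<rho> R where \<rho>: "\<rho> > 0" "R > 0" "\<And>p m. p \<in> ball p0 \<rho> \<Longrightarrow> box_norm m < R \<Longrightarrow> p \<star> m \<in> ball p0 \<delta>"
    using hmul_near[OF \<delta>(1)] by metis
  obtain N where N: "N > 0" "\<And>q :: 'n heis. \<exists>c. hpath q c \<and> c \<le> N * box_norm q" using hpath_bound by blast
  show ?thesis
  \<comment> \<open>Dividing \<open>R\<close> by \<open>N\<close> keeps the joining path, of length
    up to \<open>N * box_norm q\<close>, inside the region where the gradient bound holds.\<close>
  proof (rule that[of "min \<rho> \<delta>" "min R (R / N)" "G * N"])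
    fix p q :: "'n heis" assume p: "p \<in> ball p0 (min \<rho> \<delta>)" and q: "box_norm q < min R (R / N)"
    have near: "p \<star> m \<in> cball p0 \<delta>" if "box_norm m < R" for m
      using \<rho>(3)[of p m] p that by (auto simp: less_imp_le)
    obtain c where c: "hpath q c" "c \<le> N * box_norm q" using N by blast
    have "N * box_norm q < R" using q N(1) by (simp add: field_simps)
    have "\<bar>f (p \<star> q) - f p\<bar> \<le> G * c"
    proof (rule hpath_Lipschitz[OF f _ _ c(1), of G R])
      show "p \<star> m \<in> U \<and> norm (F (p \<star> m)) \<le> G" if "box_norm m < R" for m
        using near[OF that] G(2)[OF near[OF that]] \<delta>(2) by auto
      show "c < R" using c(2) \<open>N * box_norm q < R\<close> by linarith
    qed (use G in simp)
    also have "\<dots> \<le> G * (N * box_norm q)" using c(2) G(1) by simp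
    finally show "p \<star> q \<in> U \<and> \<bar>f (p \<star> q) - f p\<bar> \<le> G * N * box_norm q"
      using near[of q] q \<delta>(2) by (auto simp: mult.assoc)
  qed (use \<rho> \<delta> G N in \<open>auto intro: less_imp_le\<close>)
qed

subsection \<open>Horizontal gradients in the two settings\<close>

lemma sum_axis_Basis_inner:
  fixes g :: "complex ^ 'n::finite \<Rightarrow> real"
  assumes "e \<in> Basis"
  shows "(\<Sum>j\<in>UNIV. g (axis j 1) *\<^sub>R axis j 1 + g (axis j \<i>) *\<^sub>R axis j \<i>) \<bullet> e = g e"
proof -
  obtain k b where e: "e = axis k b" "b = 1 \<or> b = \<i>"
    using assms by (auto simp: Basis_vec_def Basis_complex_def)
  have "(\<Sum>j\<in>UNIV. g (axis j 1) *\<^sub>R axis j 1 + g (axis j \<i>) *\<^sub>R axis j \<i>) $ k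
      = (\<Sum>j\<in>UNIV. if j = k then g (axis k 1) *\<^sub>R 1 + g (axis k \<i>) *\<^sub>R \<i> else 0)"
    unfolding sum_component by (rule sum.cong) (auto simp: axis_def)
  then show ?thesis
    using e(2) unfolding e(1) inner_axis by (auto simp: inner_complex_def)
qed

lemma continuous_on_Basis_inner:
  fixes F :: "'a::topological_space \<Rightarrow> 'b::euclidean_space"
  assumes "\<And>e. e \<in> Basis \<Longrightarrow> continuous_on S (\<lambda>x. F x \<bullet> e)"
  shows "continuous_on S F"
proof -
  have "continuous_on S (\<lambda>x. \<Sum>e\<in>Basis. (F x \<bullet> e) *\<^sub>R e)"
    by (intro continuous_intros assms)
  then show ?thesis by (simp add: euclidean_representation)
qed

lemma fst_grad_H_inner:
  assumes "e \<in> Basis"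
  shows "fst (grad_H f p) \<bullet> e = frechet_derivative f (at p) (hor e p)"
proof -
  define D where "D e = frechet_derivative f (at p) (hor e p)" for e
  have "fst (grad_H f p) = (\<Sum>j\<in>UNIV. D (axis j 1) *\<^sub>R axis j 1 + D (axis j \<i>) *\<^sub>R axis j \<i>)"
    unfolding grad_H_def deriv_along_def hX_eq_hor hY_eq_hor D_def[symmetric]
    by (simp only: fst_sum fst_add fst_scaleR) (simp add: hor_def)
  then show ?thesis using sum_axis_Basis_inner[OF assms, of D] by (simp only: D_def)
qed

lemma fst_distr_grad_H_inner:
  assumes "e \<in> Basis"
  shows "fst (distr_grad_H U f p) \<bullet> e = distr_deriv U (hor e) f p"
proof -
  define D where "D e = distr_deriv U (hor e) f p" for e
  have "fst (distr_grad_H U f p) = (\<Sum>j\<in>UNIV. D (axis j 1) *\<^sub>R axis j 1 + D (axis j \<i>) *\<^sub>R axis j \<i>)"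
    unfolding distr_grad_H_def hX_eq_hor hY_eq_hor D_def[symmetric]
    by (simp only: fst_sum fst_add fst_scaleR) (simp add: hor_def)
  then show ?thesis using sum_axis_Basis_inner[OF assms, of D] by (simp only: D_def)
qed

lemma Ck_on_hgrad_on:
  assumes "open S" "Ck_on 1 S f"
  shows "hgrad_on S f (\<lambda>p. fst (grad_H f p))"
  unfolding hgrad_on_def
proof (intro conjI ballI)
  show "open S" by fact
  show "continuous_on S f" using Ck_on_Suc_imp[of 0 S f] assms(2) by simp
  show "continuous_on S (\<lambda>p. fst (grad_H f p))"
    by (rule continuous_on_Basis_inner, simp only: fst_grad_H_inner)
      (rule continuous_on_frechet_field[OF assms(2) continuous_on_hor])
  show "has_hderiv f e (fst (grad_H f q) \<bullet> e) q" if "q \<in> S" "e \<in> Basis" for q e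
    unfolding fst_grad_H_inner[OF that(2)]
    by (rule differentiable_has_hderiv) (use assms(2) that in \<open>simp del: split_paired_All\<close>)
qed

lemma C1_H_hgrad_on:
  assumes U: "open U" and f: "C1_H U f"
  shows "hgrad_on U f (\<lambda>p. fst (distr_grad_H U f p))"
proof -
  have g: "continuous_on U (distr_deriv U (hor e) f) \<and> is_distr_deriv U (hor e) f (distr_deriv U (hor e) f)"
    if "e \<in> Basis" for e
  proof -
    have "\<exists>g. continuous_on U g \<and> is_distr_deriv U (hor e) f g"
      using f that unfolding C1_H_def hX_eq_hor hY_eq_hor
      by (auto simp: Basis_vec_def Basis_complex_def)
    then show ?thesis unfolding distr_deriv_def by (rule someI_ex)
  qed
  have cf: "continuous_on U f" using f by (simp add: C1_H_def)
  show ?thesis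
    unfolding hgrad_on_def
  proof (intro conjI ballI U cf)
    show "continuous_on U (\<lambda>p. fst (distr_grad_H U f p))"
      by (rule continuous_on_Basis_inner, simp only: fst_distr_grad_H_inner) (use g in blast)
    show "has_hderiv f e (fst (distr_grad_H U f q) \<bullet> e) q" if "q \<in> U" "e \<in> Basis" for q e
      unfolding fst_distr_grad_H_inner[OF that(2)]
      using distr_has_hderiv[OF U cf _ _ that(1)] g[OF that(2)] by blast
  qed
qed

subsection \<open>Volume estimates by integration by parts\<close>

lemma bump_hderiv:
  fixes a :: "'n::finite heis"
  obtains w where "continuous_on UNIV w" "\<And>q. has_hderiv (bump a r) e (w q) q"
    "\<And>q. r > 0 \<Longrightarrow> q \<notin> ball a r \<Longrightarrow> w q = 0"
proof -
  have C: "Ck_on 1 UNIV (bump a r)" using smooth_bump[of a r] unfolding smooth_on_def by blast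
  define w where "w q = frechet_derivative (bump a r) (at q) (hor e q)" for q
  have d: "has_hderiv (bump a r) e (w q) q" for q
    unfolding w_def by (rule differentiable_has_hderiv) (use C in \<open>simp del: split_paired_All\<close>)
  show ?thesis
  proof (rule that[OF _ d])
    show "continuous_on UNIV w"
      unfolding w_def by (rule continuous_on_frechet_field[OF C continuous_on_hor])
    show "w q = 0" if "r > 0" "q \<notin> ball a r" for q
    proof (rule DERIV_local_min[OF d[unfolded has_hderiv_def] zero_less_one])
      show "\<forall>y. \<bar>0 - y\<bar> < 1 \<longrightarrow> bump a r (hflow e 0 q) \<le> bump a r (hflow e y q)"
        using bump_eq_0[OF that] bump_nonneg by auto
    qed
  qed
qed

lemma continuous_on_extend_0:
  fixes f g :: "'a::real_normed_vector \<Rightarrow> real"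
  assumes "open U" "closed K" "K \<subseteq> U" "continuous_on U f"
    and "\<And>q. q \<in> U \<Longrightarrow> g q = f q" "\<And>q. q \<notin> K \<Longrightarrow> g q = 0"
  shows "continuous_on UNIV g"
proof -
  have "continuous_on U g" using assms by (subst continuous_on_cong[OF refl assms(5)]) auto
  moreover have "continuous_on (- K) g"
    by (subst continuous_on_cong[OF refl, of _ _ "\<lambda>_. 0"]) (use assms in auto)
  ultimately have "continuous_on (U \<union> - K) g"
    using assms by (intro continuous_on_open_Un) auto
  moreover have "U \<union> - K = UNIV" using assms by auto
  ultimately show ?thesis by simp
qed

lemma integrable_compact_support:
  fixes g :: "'a::euclidean_space \<Rightarrow> real"
  assumes "continuous_on UNIV g" "compact K" "\<And>q. q \<notin> K \<Longrightarrow> g q = 0"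
  shows "integrable lborel g"
proof -
  have "integrable lborel (\<lambda>x. indicator K x *\<^sub>R g x)"
    using assms(2) continuous_on_subset[OF assms(1) subset_UNIV] by (intro borel_integrable_compact)
  moreover have "indicator K x *\<^sub>R g x = g x" for x using assms by (auto simp: indicator_def)
  ultimately show ?thesis by (simp only:)
qed

text \<open>The bump turns a function living on \<open>U\<close> into one that extends by zero to
  the whole group, so that \<open>integral_hderiv_eq_0\<close> applies to the product.\<close>

lemma bump_parts:
  fixes G G' :: "'n::finite heis \<Rightarrow> real"
  assumes U: "open U" "cball a r \<subseteq> U" "r > 0"
    and G: "continuous_on U G" "continuous_on U G'" "\<And>q. q \<in> U \<Longrightarrow> has_hderiv G e (G' q) q"
    and w: "continuous_on UNIV w" "\<And>q. has_hderiv (bump a r) e (w q) q"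
      "\<And>q. q \<notin> ball a r \<Longrightarrow> w q = 0"
  shows "integrable lborel (\<lambda>q. bump a r q * G' q + w q * G q)"
    and "(LINT q|lborel. bump a r q * G' q + w q * G q) = 0"
proof -
  let ?K = "cball a r"
  let ?\<phi> = "\<lambda>q. bump a r q * G q" and ?\<phi>' = "\<lambda>q. bump a r q * G' q + w q * G q"
  have out: "bump a r q = 0" "w q = 0" if "q \<notin> ?K" for q
    using that w(3)[of q] bump_eq_0[OF U(3), of q a] by simp_all
  have cb: "continuous_on UNIV (bump a r)"
    using smooth_bump[of a r] unfolding smooth_on_def by (metis Ck_on.simps(1))
  have cb': "continuous_on S (bump a r)" "continuous_on S w" for S
    using cb w(1) continuous_on_subset by blast+
  have c1: "continuous_on UNIV ?\<phi>"
    by (rule continuous_on_extend_0[OF U(1) _ U(2), of ?\<phi>])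
      (auto simp: out intro!: continuous_on_mult G cb')
  have c2: "continuous_on UNIV ?\<phi>'"
    by (rule continuous_on_extend_0[OF U(1) _ U(2), of ?\<phi>'])
      (auto simp: out intro!: continuous_on_mult continuous_on_add G cb')
  show "integrable lborel ?\<phi>'"
    by (rule integrable_compact_support[OF c2, of ?K]) (auto simp: out)
  show "(LINT q|lborel. ?\<phi>' q) = 0"
  proof (rule integral_hderiv_eq_0[OF compact_cball _ c1 c2])
    show "?\<phi> q = 0" if "q \<notin> ?K" for q using out that by simp
    show "has_hderiv ?\<phi> e (?\<phi>' q) q" for q
    proof (cases "q \<in> U")
      case True
      show ?thesis using has_hderiv_mult[OF w(2) G(3)[OF True]] .
    next
      case False
      then have "q \<in> - ?K" using U(2) by auto
      then obtain \<rho> t where "\<rho> > 0" "t > 0" and *: "\<And>s p. \<bar>s\<bar> \<le> t \<Longrightarrow> p \<in> ball q \<rho> \<Longrightarrow> hflow e s p \<in> - ?K"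
        using hflow_near[of "- ?K" q e] by (metis closed_cball open_Compl)
      then have "\<forall>\<^sub>F s in nhds 0. 0 = ?\<phi> (hflow e s q)"
        unfolding eventually_nhds_metric
        by (intro exI[of _ t] conjI allI impI) (auto simp: dist_real_def out simp del: mem_cball)
      then have "((\<lambda>s. 0) has_real_derivative 0) (at 0) \<longleftrightarrow> has_hderiv ?\<phi> e 0 q"
        unfolding has_hderiv_def by (rule DERIV_cong_ev[OF refl _ refl])
      moreover have "?\<phi>' q = 0" using out[of q] \<open>q \<in> - ?K\<close> by simp
      ultimately show ?thesis by simp
    qed
  qed
qed

text \<open>Replaces the indicator of \<open>[-1, 1]\<close>, up to a factor 2: unlike the latter it is smooth, and its
  primitive is bounded, so that integration by parts turns \<open>cauchy (f / a)\<close> into \<open>a arctan (f / a)\<close>.\<close>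

definition cauchy :: "real \<Rightarrow> real" where
  "cauchy x = inverse (1 + x\<^sup>2)"

lemma cauchy_bounds: "0 < cauchy x" "cauchy x \<le> 1" "\<bar>x\<bar> \<le> 1 \<Longrightarrow> cauchy x \<ge> 1 / 2"
proof -
  have "1 + x\<^sup>2 \<ge> 1" by simp
  then show "0 < cauchy x" "cauchy x \<le> 1"
    by (auto simp: cauchy_def divide_simps add_pos_nonneg)
  assume "\<bar>x\<bar> \<le> 1"
  then have "x\<^sup>2 \<le> 1" by (simp add: abs_square_le_1)
  then show "cauchy x \<ge> 1 / 2"
    using le_imp_inverse_le[of "1 + x\<^sup>2" 2] \<open>1 + x\<^sup>2 \<ge> 1\<close> by (simp add: cauchy_def)
qed

lemma cauchy_DERIV: "(cauchy has_real_derivative - 2 * x * (cauchy x)\<^sup>2) (at x)"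
proof -
  have "1 + x\<^sup>2 > 0" by (simp add: add_pos_nonneg)
  then show ?thesis unfolding cauchy_def[abs_def]
    by (auto intro!: derivative_eq_intros simp: power2_eq_square)
qed

lemma arctan_DERIV: "(arctan has_real_derivative cauchy x) (at x)"
  unfolding cauchy_def by (rule DERIV_arctan)

lemma abs_arctan_le: "\<bar>arctan x\<bar> \<le> 2"
  using arctan_bounded[of x] pi_less_4 by linarith

lemma continuous_on_cauchy [continuous_intros]:
  "continuous_on S f \<Longrightarrow> continuous_on S (\<lambda>x. cauchy (f x))"
  unfolding cauchy_def by (intro continuous_intros) (auto simp: add_nonneg_eq_0_iff)

lemma has_hderiv_affine:
  "has_hderiv f e d p \<Longrightarrow> has_hderiv (\<lambda>q. (f q - m) / a) e (d / a) p"
  unfolding has_hderiv_def by (cases "a = 0") (auto intro!: derivative_eq_intros)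

lemma bump_lower:
  assumes "r > 0"
  obtains \<beta> where "\<beta> > 0" "\<And>q. q \<in> ball (p::'a::euclidean_space) (r / 2) \<Longrightarrow> bump p r q \<ge> \<beta>"
proof -
  have "continuous_on (cball p (r / 2)) (bump p r)"
    using smooth_bump[of p r] unfolding smooth_on_def by (metis Ck_on.simps(1) continuous_on_subset subset_UNIV)
  moreover have "p \<in> cball p (r / 2)" using assms by simp
  ultimately obtain q0 where q0: "q0 \<in> cball p (r / 2)" "\<And>q. q \<in> cball p (r / 2) \<Longrightarrow> bump p r q0 \<le> bump p r q"
    using continuous_attains_inf[OF compact_cball] by (metis empty_iff)
  have "q0 \<in> ball p r" using q0(1) assms by simp
  then have "bump p r q0 > 0" using bump_pos_iff[OF assms] by blast
  then show ?thesis using q0(2) that[of "bump p r q0"] by (simp add: less_imp_le)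
qed

lemma continuous_sign_near:
  fixes D :: "'a::euclidean_space \<Rightarrow> real"
  assumes "open U" "p \<in> U" "continuous_on U D" "D p \<noteq> 0"
  obtains r \<kappa> \<sigma> where "r > 0" "\<kappa> > 0" "\<bar>\<sigma>\<bar> = 1" "cball p r \<subseteq> U" "\<And>q. q \<in> cball p r \<Longrightarrow> \<sigma> * D q \<ge> \<kappa>"
proof -
  define \<sigma> where "\<sigma> = sgn (D p)"
  have s: "\<bar>\<sigma>\<bar> = 1" "\<sigma> * D p = \<bar>D p\<bar>" using assms(4) by (auto simp: \<sigma>_def sgn_if)
  have "open (U \<inter> (\<lambda>q. \<sigma> * D q) -` {\<bar>D p\<bar> / 2<..})"
    using assms by (intro continuous_open_preimage continuous_on_mult continuous_on_const) auto
  moreover have "p \<in> U \<inter> (\<lambda>q. \<sigma> * D q) -` {\<bar>D p\<bar> / 2<..}" using assms s by simp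
  ultimately obtain r where "r > 0" "cball p r \<subseteq> U \<inter> (\<lambda>q. \<sigma> * D q) -` {\<bar>D p\<bar> / 2<..}"
    using open_contains_cball by blast
  then show ?thesis using that[of r "\<bar>D p\<bar> / 2" \<sigma>] assms(4) s(1) by (auto simp: less_imp_le subset_eq)
qed

text \<open>The function \<open>a * arctan ((f - m) / a)\<close> is bounded by 2a, and its
  derivative along \<open>e\<close> is the kernel times \<open>F \<bullet> e\<close>, which is
  bounded away from 0 near \<open>p\<close>. Moving this derivative onto the bump gives a bound
  linear in a and uniform in the level m.\<close>

lemma volume_transversal:
  fixes f :: "'n::finite heis \<Rightarrow> real"
  assumes f: "hgrad_on U f F" and p: "p \<in> U" and e: "e \<in> Basis" and nz: "F p \<bullet> e \<noteq> 0"
  obtains \<rho> C where "\<rho> > 0" "C > 0" "ball p \<rho> \<subseteq> U"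
    "\<And>a m. a > 0 \<Longrightarrow> integrable lborel (\<lambda>q. indicator (ball p \<rho>) q * cauchy ((f q - m) / a)) \<and>
       (LINT q|lborel. indicator (ball p \<rho>) q * cauchy ((f q - m) / a)) \<le> C * a"
proof -
  have U: "open U" and cf: "continuous_on U f" and cF: "continuous_on U F"
    and d: "\<And>q. q \<in> U \<Longrightarrow> has_hderiv f e (F q \<bullet> e) q"
    using f e by (auto simp: hgrad_on_def)
  have cFe: "continuous_on U (\<lambda>q. F q \<bullet> e)" by (intro continuous_intros cF)
  obtain r \<kappa> \<sigma> where r: "r > 0" "\<kappa> > 0" "\<bar>\<sigma>\<bar> = 1" "cball p r \<subseteq> U" "\<And>q. q \<in> cball p r \<Longrightarrow> \<sigma> * (F q \<bullet> e) \<ge> \<kappa>"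
    using continuous_sign_near[OF U p cFe nz] by blast
  obtain w where w: "continuous_on UNIV w" "\<And>q. has_hderiv (bump p r) e (w q) q" "\<And>q. q \<notin> ball p r \<Longrightarrow> w q = 0"
    using bump_hderiv[of p r e] r(1) by metis
  obtain \<beta> where \<beta>: "\<beta> > 0" "\<And>q. q \<in> ball p (r / 2) \<Longrightarrow> bump p r q \<ge> \<beta>" using bump_lower[OF r(1)] by blast
  define M where "M = (LINT q|lborel. \<bar>w q\<bar>)"
  have intw: "integrable lborel (\<lambda>q. \<bar>w q\<bar>)"
    using w by (intro integrable_abs integrable_compact_support[OF w(1), of "cball p r"]) auto
  have M: "M \<ge> 0" unfolding M_def by (intro integral_nonneg_AE) auto
  have sub: "ball p (r / 2) \<subseteq> U" using r(1,4) by (force simp: subset_eq)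
  show ?thesis
  \<comment> \<open>The factor 2 bounds the arctangent, and the summand 1 keeps the constant
    positive if M = 0.\<close>
  proof (rule that[of "r / 2" "(2 * M + 1) / (\<kappa> * \<beta>)"])
    fix a m :: real assume a: "a > 0"
    let ?k = "\<lambda>q. cauchy ((f q - m) / a)"
    let ?G = "\<lambda>q. a * arctan ((f q - m) / a)" and ?G' = "\<lambda>q. ?k q * (F q \<bullet> e)"
    have ck: "continuous_on U ?k" using a by (intro continuous_intros cf) auto
    have dG: "has_hderiv ?G e (?G' q) q" if "q \<in> U" for q
    proof -
      have "has_hderiv (\<lambda>q. arctan ((f q - m) / a)) e (?k q * ((F q \<bullet> e) / a)) q"
        by (rule has_hderiv_chain[OF arctan_DERIV has_hderiv_affine[OF d[OF that]]])
      from has_hderiv_mult[OF _ this, of "\<lambda>_. a" 0] show ?thesis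
        using a by (simp add: has_hderiv_def)
    qed
    have "continuous_on U ?G" using a by (intro continuous_intros cf) auto
    moreover have "continuous_on U ?G'" by (intro continuous_on_mult ck cFe)
    ultimately have IBP: "integrable lborel (\<lambda>q. bump p r q * ?G' q + w q * ?G q)"
        "(LINT q|lborel. bump p r q * ?G' q + w q * ?G q) = 0"
      using bump_parts[OF U r(4) r(1) _ _ dG w] by blast+
    have km: "(\<lambda>q. indicator (ball p (r / 2)) q * ?k q) \<in> borel_measurable borel"
      using borel_measurable_continuous_on_indicator[OF _ continuous_on_subset[OF ck sub]] by simp
    have intk: "integrable lborel (\<lambda>q. indicator (ball p (r / 2)) q * ?k q)"
    proof (rule Bochner_Integration.integrable_bound)
      show "integrable lborel (indicator (cball p r) :: _ \<Rightarrow> real)"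
        using emeasure_compact_finite[OF compact_cball, of p r] by (intro integrable_real_indicator) auto
      show "AE q in lborel. norm (indicator (ball p (r / 2)) q * ?k q) \<le> norm (indicator (cball p r) q :: real)"
        using r(1) cauchy_bounds(2) cauchy_bounds(1) by (intro AE_I2) (auto simp: indicator_def less_imp_le)
    qed (use km in simp)
    have "\<kappa> * \<beta> * (LINT q|lborel. indicator (ball p (r / 2)) q * ?k q)
        = (LINT q|lborel. \<kappa> * \<beta> * (indicator (ball p (r / 2)) q * ?k q))" by simp
    also have "\<dots> \<le> (LINT q|lborel. \<sigma> * (bump p r q * ?G' q + w q * ?G q) + 2 * a * \<bar>w q\<bar>)"
    proof (rule integral_mono)
      show "integrable lborel (\<lambda>q. \<kappa> * \<beta> * (indicator (ball p (r / 2)) q * ?k q))" using intk by simp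
      show "integrable lborel (\<lambda>q. \<sigma> * (bump p r q * ?G' q + w q * ?G q) + 2 * a * \<bar>w q\<bar>)"
        using IBP(1) intw by simp
      fix q
      have "\<bar>\<sigma> * (w q * ?G q)\<bar> = a * (\<bar>w q\<bar> * \<bar>arctan ((f q - m) / a)\<bar>)"
        using r(3) a by (simp add: abs_mult)
      also have "\<dots> \<le> a * (\<bar>w q\<bar> * 2)"
        using abs_arctan_le a by (intro mult_left_mono) auto
      finally have 1: "\<sigma> * (w q * ?G q) + 2 * a * \<bar>w q\<bar> \<ge> 0" by (simp add: abs_le_iff)
      have 2: "\<kappa> * \<beta> * (indicator (ball p (r / 2)) q * ?k q) \<le> \<sigma> * (bump p r q * ?G' q)"
      proof (cases "q \<in> cball p r")
        case True
        have "indicator (ball p (r / 2)) q * \<beta> \<le> bump p r q"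
          using \<beta>(2)[of q] bump_nonneg[of p r q] by (auto simp: indicator_def)
        then have "\<kappa> * (indicator (ball p (r / 2)) q * \<beta>) \<le> \<sigma> * (F q \<bullet> e) * bump p r q"
          using r(2) r(5)[OF True] \<beta>(1) by (intro mult_mono) (auto simp: indicator_def)
        then have "\<kappa> * (indicator (ball p (r / 2)) q * \<beta>) * ?k q \<le> \<sigma> * (F q \<bullet> e) * bump p r q * ?k q"
          using cauchy_bounds(1) by (intro mult_right_mono) (auto simp: less_imp_le)
        then show ?thesis by (simp add: mult_ac)
      next
        case False
        then have "q \<notin> ball p r" "q \<notin> ball p (r / 2)" using r(1) by auto
        then show ?thesis using bump_eq_0[OF r(1) \<open>q \<notin> ball p r\<close>] by simp
      qed
      show "\<kappa> * \<beta> * (indicator (ball p (r / 2)) q * ?k q) \<le> \<sigma> * (bump p r q * ?G' q + w q * ?G q) + 2 * a * \<bar>w q\<bar>"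
        using 1 2 by (simp only: distrib_left)
    qed
    also have "\<dots> = \<sigma> * (LINT q|lborel. bump p r q * ?G' q + w q * ?G q) + 2 * a * M"
      unfolding M_def using IBP(1) intw by (subst Bochner_Integration.integral_add) auto
    also have "\<dots> \<le> (2 * M + 1) * a" using IBP(2) a by (simp add: algebra_simps)
    finally have "(LINT q|lborel. indicator (ball p (r / 2)) q * ?k q) \<le> (2 * M + 1) / (\<kappa> * \<beta>) * a"
      using r(2) \<beta>(1) by (simp add: field_simps)
    then show "integrable lborel (\<lambda>q. indicator (ball p (r / 2)) q * ?k q) \<and>
       (LINT q|lborel. indicator (ball p (r / 2)) q * ?k q) \<le> (2 * M + 1) / (\<kappa> * \<beta>) * a"
      using intk by simp
  qed (use r M \<beta> sub in auto)
qed

text \<open>The field \<open>V = (W\<^sub>1 u) W\<^sub>2 - (W\<^sub>2 u) W\<^sub>1\<close> annihilates \<open>u\<close>, so integrating by parts along \<open>V\<close>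
  puts no derivative on functions of \<open>u\<close>; this gives a bound that is linear in both widths.\<close>

lemma volume_double_transversal:
  fixes f u :: "'n::finite heis \<Rightarrow> real"
  assumes f: "hgrad_on U f F" and u: "hgrad_on U u A" and u2: "Ck_on 2 U u" and p: "p \<in> U"
    and A: "\<And>q e. q \<in> U \<Longrightarrow> e \<in> Basis \<Longrightarrow> A q \<bullet> e = frechet_derivative u (at q) (hor e q)"
    and e: "e1 \<in> Basis" "e2 \<in> Basis" and nz: "A p \<bullet> e1 \<noteq> 0"
      "(A p \<bullet> e1) * (F p \<bullet> e2) - (A p \<bullet> e2) * (F p \<bullet> e1) \<noteq> 0"
  obtains \<rho> C where "\<rho> > 0" "C > 0" "ball p \<rho> \<subseteq> U"
    "\<And>a b m. a > 0 \<Longrightarrow> b > 0 \<Longrightarrow>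
       integrable lborel (\<lambda>q. indicator (ball p \<rho>) q * (cauchy (f q / a) * cauchy ((u q - m) / b))) \<and>
       (LINT q|lborel. indicator (ball p \<rho>) q * (cauchy (f q / a) * cauchy ((u q - m) / b))) \<le> C * a * b"
proof -
  have U: "open U" and cf: "continuous_on U f" and cF: "continuous_on U F"
    and df: "\<And>q e. q \<in> U \<Longrightarrow> e \<in> Basis \<Longrightarrow> has_hderiv f e (F q \<bullet> e) q"
    using f by (auto simp: hgrad_on_def)
  have cu: "continuous_on U u" and cA: "continuous_on U A"
    and du: "\<And>q e. q \<in> U \<Longrightarrow> e \<in> Basis \<Longrightarrow> has_hderiv u e (A q \<bullet> e) q"
    using u by (auto simp: hgrad_on_def)
  let ?A1 = "\<lambda>q. A q \<bullet> e1" and ?A2 = "\<lambda>q. A q \<bullet> e2"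
  have "\<exists>h. continuous_on U h \<and> (\<forall>q\<in>U. has_hderiv (\<lambda>q. A q \<bullet> e) e' (h q) q)"
    if "e \<in> Basis" for e e'
  proof -
    obtain h where h: "continuous_on U h"
      "\<And>q. q \<in> U \<Longrightarrow> has_hderiv (\<lambda>q. frechet_derivative u (at q) (hor e q)) e' (h q) q"
      using Ck_on_2_hderiv[OF u2 U, of e e'] by blast
    have "has_hderiv (\<lambda>q. A q \<bullet> e) e' (h q) q" if "q \<in> U" for q
    proof -
      have "open ((\<lambda>s. hflow e' s q) -` U)"
        using U by (intro open_vimage) (auto intro!: continuous_intros)
      from eventually_nhds_in_open[OF this, of 0] \<open>q \<in> U\<close>
      have "\<forall>\<^sub>F s in nhds 0. A (hflow e' s q) \<bullet> e = frechet_derivative u (at (hflow e' s q)) (hor e (hflow e' s q))"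
        by (auto elim!: eventually_mono intro: A[OF _ \<open>e \<in> Basis\<close>])
      then show ?thesis using h(2)[OF \<open>q \<in> U\<close>]
        unfolding has_hderiv_def by (subst DERIV_cong_ev[OF refl _ refl])
    qed
    then show ?thesis using h(1) by blast
  qed
  then obtain A12 A21 where h: "continuous_on U A12" "\<And>q. q \<in> U \<Longrightarrow> has_hderiv ?A1 e2 (A12 q) q"
      "continuous_on U A21" "\<And>q. q \<in> U \<Longrightarrow> has_hderiv ?A2 e1 (A21 q) q"
    using e by metis
  define V where "V q = (A q \<bullet> e1) * (F q \<bullet> e2) - (A q \<bullet> e2) * (F q \<bullet> e1)" for q
  have cV: "continuous_on U V" unfolding V_def by (intro continuous_intros cA cF)
  \<comment> \<open>The estimate for \<open>u\<close> alone provides the factor b; the primitive of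
    the kernel in \<open>f\<close> will provide the factor a.\<close>
  obtain \<rho>0 C0 where C0: "\<rho>0 > 0" "C0 > 0" "ball p \<rho>0 \<subseteq> U"
    "\<And>b m. b > 0 \<Longrightarrow> integrable lborel (\<lambda>q. indicator (ball p \<rho>0) q * cauchy ((u q - m) / b)) \<and>
       (LINT q|lborel. indicator (ball p \<rho>0) q * cauchy ((u q - m) / b)) \<le> C0 * b"
    by (rule volume_transversal[OF u p e(1) nz(1)], rule that; blast)
  have "continuous_on (ball p \<rho>0) V" "V p \<noteq> 0" "p \<in> ball p \<rho>0"
    using continuous_on_subset[OF cV C0(3)] nz(2) C0(1) by (auto simp: V_def)
  then obtain r \<kappa> \<sigma> where r: "r > 0" "\<kappa> > 0" "\<bar>\<sigma>\<bar> = 1" "cball p r \<subseteq> ball p \<rho>0"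
    "\<And>q. q \<in> cball p r \<Longrightarrow> \<sigma> * V q \<ge> \<kappa>"
    using continuous_sign_near[OF open_ball, of p p \<rho>0 V] by blast
  have rU: "cball p r \<subseteq> U" using r(4) C0(3) by blast
  obtain w1 where w1: "continuous_on UNIV w1" "\<And>q. has_hderiv (bump p r) e1 (w1 q) q" "\<And>q. q \<notin> ball p r \<Longrightarrow> w1 q = 0"
    using bump_hderiv[of p r e1] r(1) by metis
  obtain w2 where w2: "continuous_on UNIV w2" "\<And>q. has_hderiv (bump p r) e2 (w2 q) q" "\<And>q. q \<notin> ball p r \<Longrightarrow> w2 q = 0"
    using bump_hderiv[of p r e2] r(1) by metis
  obtain \<beta> where \<beta>: "\<beta> > 0" "\<And>q. q \<in> ball p (r / 2) \<Longrightarrow> bump p r q \<ge> \<beta>" by (rule bump_lower[OF r(1)], rule that; blast)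
  have cb: "continuous_on S (bump p r)" for S
    using smooth_bump[of p r] unfolding smooth_on_def by (metis Ck_on.simps(1) continuous_on_subset subset_UNIV)
  \<comment> \<open>All terms in which the derivative falls on the bump or on the coefficients of
    the field. They involve second derivatives of \<open>u\<close> but no derivative of
    \<open>f\<close>, and are bounded on the ball.\<close>
  define Z where "Z q = bump p r q * (A12 q - A21 q) + w2 q * (A q \<bullet> e1) - w1 q * (A q \<bullet> e2)" for q
  have "continuous_on (cball p r) A12" "continuous_on (cball p r) A21" "continuous_on (cball p r) A"
    using continuous_on_subset[OF _ rU] h cA by blast+
  moreover have "continuous_on (cball p r) w1" "continuous_on (cball p r) w2"
    using continuous_on_subset[OF _ subset_UNIV] w1(1) w2(1) by blast+
  ultimately have "continuous_on (cball p r) Z"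
    unfolding Z_def
    by (intro continuous_on_add continuous_on_diff continuous_on_mult cb continuous_on_inner continuous_on_const)
  then obtain M where M: "M > 0" "\<And>q. q \<in> cball p r \<Longrightarrow> \<bar>Z q\<bar> \<le> M"
    using bounded_on_compact_real[OF compact_cball] by metis
  have Z0: "Z q = 0" if "q \<notin> ball p r" for q
    using w1(3)[OF that] w2(3)[OF that] bump_eq_0[OF r(1) that] by (simp add: Z_def)
  have sub: "ball p (r / 2) \<subseteq> U" using r(1) rU by (force simp: subset_eq)
  show ?thesis
  \<comment> \<open>The constant multiplies the bounds 2a for \<open>T\<close>, M for
    \<open>Z\<close> and \<open>C0 * b\<close> for the integral of the kernel in
    \<open>u\<close>.\<close>
  proof (rule that[of "r / 2" "2 * M * C0 / (\<kappa> * \<beta>)"])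
    fix a b m :: real assume a: "a > 0" and b: "b > 0"
    define fk where "fk q = cauchy (f q / a)" for q
    define T where "T q = a * arctan (f q / a)" for q
    define uk where "uk q = cauchy ((u q - m) / b)" for q
    define uk' where "uk' q = - 2 * ((u q - m) / b) * (uk q)\<^sup>2 / b" for q
    have cd: "continuous_on U (\<lambda>q. f q / a)" "continuous_on U (\<lambda>q. (u q - m) / b)"
      using a b by (intro continuous_on_divide continuous_on_diff continuous_on_const cf cu; simp)+
    have "continuous_on U fk" unfolding fk_def by (rule continuous_on_cauchy[OF cd(1)])
    moreover have "continuous_on U T"
      unfolding T_def by (rule continuous_on_mult[OF continuous_on_const continuous_on_arctan[OF cd(1)]])
    moreover have cuk: "continuous_on U uk" unfolding uk_def by (rule continuous_on_cauchy[OF cd(2)])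
    moreover have "continuous_on U uk'" unfolding uk'_def
      by (rule continuous_on_divide[OF continuous_on_mult[OF continuous_on_mult[OF continuous_on_const cd(2)]
            continuous_on_power[OF cuk]] continuous_on_const]) (use b in simp)
    ultimately have c: "continuous_on U fk" "continuous_on U T" "continuous_on U uk" "continuous_on U uk'"
      by blast+
    have dT: "has_hderiv T e (fk q * (F q \<bullet> e)) q" if "q \<in> U" "e \<in> Basis" for q e
    proof -
      have "has_hderiv (\<lambda>q. (f q - 0) / a) e ((F q \<bullet> e) / a) q"
        by (rule has_hderiv_affine[OF df[OF that]])
      then have "has_hderiv (\<lambda>q. f q / a) e ((F q \<bullet> e) / a) q" by (simp only: diff_0_right)
      then have "has_hderiv (\<lambda>q. arctan (f q / a)) e (fk q * ((F q \<bullet> e) / a)) q"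
        unfolding fk_def by (rule has_hderiv_chain[OF arctan_DERIV])
      moreover have "has_hderiv (\<lambda>_. a) e 0 q" by (simp add: has_hderiv_def)
      ultimately have "has_hderiv T e (a * (fk q * ((F q \<bullet> e) / a)) + 0 * arctan (f q / a)) q"
        unfolding T_def by (intro has_hderiv_mult)
      then show ?thesis using a by simp
    qed
    have dU: "has_hderiv uk e (uk' q * (A q \<bullet> e)) q" if "q \<in> U" "e \<in> Basis" for q e
    proof -
      have "has_hderiv uk e (- 2 * ((u q - m) / b) * (uk q)\<^sup>2 * ((A q \<bullet> e) / b)) q"
        unfolding uk_def by (rule has_hderiv_chain[OF cauchy_DERIV has_hderiv_affine[OF du[OF that]]])
      then show ?thesis by (simp add: uk'_def)
    qed
    \<comment> \<open>Integration by parts along the field is split into its two basis directions.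
      Both derivatives contain \<open>T * uk' * A1 * A2\<close>, the only terms with a factor 1/b,
      and these cancel in the difference.\<close>
    let ?G1 = "\<lambda>q. T q * (uk q * ?A2 q)" and ?G2 = "\<lambda>q. T q * (uk q * ?A1 q)"
    let ?G1' = "\<lambda>q. T q * (uk q * A21 q + uk' q * ?A1 q * ?A2 q) + fk q * (F q \<bullet> e1) * (uk q * ?A2 q)"
    let ?G2' = "\<lambda>q. T q * (uk q * A12 q + uk' q * ?A2 q * ?A1 q) + fk q * (F q \<bullet> e2) * (uk q * ?A1 q)"
    have d1: "has_hderiv ?G1 e1 (?G1' q) q" if q: "q \<in> U" for q
      by (rule has_hderiv_mult[OF dT[OF q e(1)] has_hderiv_mult[OF dU[OF q e(1)] h(4)[OF q]]])
    have d2: "has_hderiv ?G2 e2 (?G2' q) q" if q: "q \<in> U" for q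
      by (rule has_hderiv_mult[OF dT[OF q e(2)] has_hderiv_mult[OF dU[OF q e(2)] h(2)[OF q]]])
    have cAi: "continuous_on U ?A1" "continuous_on U ?A2" "continuous_on U (\<lambda>q. F q \<bullet> e1)" "continuous_on U (\<lambda>q. F q \<bullet> e2)"
      by (intro continuous_on_inner cA cF continuous_on_const)+
    have cG: "continuous_on U ?G1" "continuous_on U ?G2" "continuous_on U ?G1'" "continuous_on U ?G2'"
      by (intro continuous_on_mult continuous_on_add c(1) c(2) c(3) c(4) cAi h)+
    have I1: "integrable lborel (\<lambda>q. bump p r q * ?G1' q + w1 q * ?G1 q)"
        "(LINT q|lborel. bump p r q * ?G1' q + w1 q * ?G1 q) = 0"
      using bump_parts[OF U rU r(1) cG(1) cG(3) d1 w1] by blast+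
    have I2: "integrable lborel (\<lambda>q. bump p r q * ?G2' q + w2 q * ?G2 q)"
        "(LINT q|lborel. bump p r q * ?G2' q + w2 q * ?G2 q) = 0"
      using bump_parts[OF U rU r(1) cG(2) cG(4) d2 w2] by blast+
    let ?I = "\<lambda>q. (bump p r q * ?G2' q + w2 q * ?G2 q) - (bump p r q * ?G1' q + w1 q * ?G1 q)"
    have I: "integrable lborel ?I" "(LINT q|lborel. ?I q) = 0"
      using I1 I2 by simp_all
    have Ieq: "?I q = bump p r q * (fk q * uk q * V q) + T q * uk q * Z q" for q
      unfolding V_def Z_def by (simp add: algebra_simps)
    have km: "(\<lambda>q. indicator (ball p (r / 2)) q * (fk q * uk q)) \<in> borel_measurable borel"
      using borel_measurable_continuous_on_indicator[OF _ continuous_on_subset[OF continuous_on_mult[OF c(1,3)] sub]] by simp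
    have intk: "integrable lborel (\<lambda>q. indicator (ball p (r / 2)) q * (fk q * uk q))"
    proof (rule Bochner_Integration.integrable_bound)
      show "integrable lborel (indicator (cball p r) :: _ \<Rightarrow> real)"
        using emeasure_compact_finite[OF compact_cball, of p r] by (intro integrable_real_indicator) auto
      have "fk q * uk q \<le> 1" for q unfolding fk_def uk_def
        using cauchy_bounds(1,2) by (intro mult_le_one) (auto simp: less_imp_le)
      then show "AE q in lborel. norm (indicator (ball p (r / 2)) q * (fk q * uk q)) \<le> norm (indicator (cball p r) q :: real)"
        using r(1) cauchy_bounds(1) by (intro AE_I2) (auto simp: indicator_def less_imp_le fk_def uk_def)
    qed (use km in simp)
    have C0b: "integrable lborel (\<lambda>q. indicator (ball p \<rho>0) q * uk q)"
       "(LINT q|lborel. indicator (ball p \<rho>0) q * uk q) \<le> C0 * b" unfolding uk_def using C0(4)[OF b] by blast+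
    have "\<kappa> * \<beta> * (LINT q|lborel. indicator (ball p (r / 2)) q * (fk q * uk q))
        = (LINT q|lborel. \<kappa> * \<beta> * (indicator (ball p (r / 2)) q * (fk q * uk q)))" by simp
    also have "\<dots> \<le> (LINT q|lborel. \<sigma> * ?I q + 2 * a * M * (indicator (ball p \<rho>0) q * uk q))"
    proof (rule integral_mono)
      show "integrable lborel (\<lambda>q. \<kappa> * \<beta> * (indicator (ball p (r / 2)) q * (fk q * uk q)))" using intk by simp
      show "integrable lborel (\<lambda>q. \<sigma> * ?I q + 2 * a * M * (indicator (ball p \<rho>0) q * uk q))"
        by (intro Bochner_Integration.integrable_add integrable_mult_right I(1) C0b(1))
      fix q
      have k0: "fk q > 0" "uk q > 0" unfolding fk_def uk_def using cauchy_bounds(1) by blast+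
      show "\<kappa> * \<beta> * (indicator (ball p (r / 2)) q * (fk q * uk q)) \<le> \<sigma> * ?I q + 2 * a * M * (indicator (ball p \<rho>0) q * uk q)"
      proof (cases "q \<in> cball p r")
        case True
        have "\<bar>\<sigma> * (T q * uk q * Z q)\<bar> = a * \<bar>arctan (f q / a)\<bar> * \<bar>Z q\<bar> * uk q"
          using r(3) a k0 by (simp add: abs_mult T_def)
        also have "\<dots> \<le> a * 2 * M * uk q"
          using abs_arctan_le a M(2)[OF True] k0 by (intro mult_right_mono mult_mono mult_left_mono) auto
        finally have 1: "\<sigma> * (T q * uk q * Z q) + 2 * a * M * uk q \<ge> 0" by (simp add: abs_le_iff mult_ac)
        have "indicator (ball p (r / 2)) q * \<beta> \<le> bump p r q"
          using \<beta>(2)[of q] bump_nonneg[of p r q] by (auto simp: indicator_def)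
        then have "\<kappa> * (indicator (ball p (r / 2)) q * \<beta>) \<le> \<sigma> * V q * bump p r q"
          using r(2) r(5)[OF True] \<beta>(1) by (intro mult_mono) (auto simp: indicator_def)
        then have "\<kappa> * (indicator (ball p (r / 2)) q * \<beta>) * (fk q * uk q) \<le> \<sigma> * V q * bump p r q * (fk q * uk q)"
          using k0 by (intro mult_right_mono) auto
        then have 2: "\<kappa> * \<beta> * (indicator (ball p (r / 2)) q * (fk q * uk q)) \<le> \<sigma> * (bump p r q * (fk q * uk q * V q))"
          by (simp only: mult_ac)
        have 3: "indicator (ball p \<rho>0) q = (1 :: real)" using True r(4) by (auto simp: indicator_def)
        show ?thesis using 1 2 unfolding Ieq 3 distrib_left[of \<sigma>] by linarith
      next
        case False
        then have q: "q \<notin> ball p r" "q \<notin> ball p (r / 2)" using r(1) by auto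
        then have "?I q = 0" unfolding Ieq using Z0[OF q(1)] bump_eq_0[OF r(1) q(1)] by simp
        moreover have "2 * a * M * (indicator (ball p \<rho>0) q * uk q) \<ge> 0"
          using a M(1) k0 by simp
        moreover have "indicator (ball p (r / 2)) q = (0::real)" using q(2) by (simp add: indicator_def)
        ultimately show ?thesis by (simp only: mult_zero_right mult_zero_left add_0)
      qed
    qed
    also have "\<dots> = \<sigma> * (LINT q|lborel. ?I q) + 2 * a * M * (LINT q|lborel. indicator (ball p \<rho>0) q * uk q)"
      by (subst Bochner_Integration.integral_add[OF integrable_mult_right[OF I(1)] integrable_mult_right[OF C0b(1)]])
        (simp only: integral_mult_right_zero)
    also have "\<dots> \<le> 2 * a * M * (C0 * b)"
      unfolding I(2) using C0b(2) a M(1) by simp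
    finally have "(LINT q|lborel. indicator (ball p (r / 2)) q * (fk q * uk q)) \<le> 2 * M * C0 / (\<kappa> * \<beta>) * a * b"
      using r(2) \<beta>(1) by (simp add: field_simps)
    then show "integrable lborel (\<lambda>q. indicator (ball p (r / 2)) q * (cauchy (f q / a) * cauchy ((u q - m) / b))) \<and>
       (LINT q|lborel. indicator (ball p (r / 2)) q * (cauchy (f q / a) * cauchy ((u q - m) / b))) \<le> 2 * M * C0 / (\<kappa> * \<beta>) * a * b"
      using intk unfolding fk_def uk_def by blast
  qed (use r M C0 \<beta> sub in auto)
qed

subsection \<open>Volume of neighbourhoods of subsets of a hypersurface\<close>

lemma emeasure_le_integral:
  fixes g :: "'a::euclidean_space \<Rightarrow> real"
  assumes "integrable lborel g" "\<And>q. g q \<ge> 0" "\<And>q. q \<in> E \<Longrightarrow> g q \<ge> t" "t > 0" "E \<in> sets borel"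
  shows "emeasure lborel E \<le> ennreal ((LINT q|lborel. g q) / t)"
proof -
  have "emeasure lborel E = (\<integral>\<^sup>+q. indicator E q \<partial>lborel)" using assms(5) by simp
  also have "\<dots> \<le> (\<integral>\<^sup>+q. ennreal (g q / t) \<partial>lborel)"
  proof (rule nn_integral_mono)
    fix q
    show "indicator E q \<le> ennreal (g q / t)"
      using assms(3)[of q] assms(4) by (auto simp: indicator_def ennreal_leI le_divide_eq simp flip: ennreal_1)
  qed
  also have "\<dots> = ennreal (LINT q|lborel. g q / t)"
    using assms by (intro nn_integral_eq_integral) auto
  finally show ?thesis by simp
qed

text \<open>By the Lipschitz estimate the r-neighbourhood of the zeros lies in {|f| \<le> L r},
  where the kernel of width \<open>L * r\<close> is at least 1/2.\<close>

lemma nbhd_volume: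
  fixes f :: "'n::finite heis \<Rightarrow> real"
  assumes f: "hgrad_on U f F" and p: "p \<in> U" and nz: "F p \<noteq> 0"
  obtains \<rho> R D where "\<rho> > 0" "R > 0" "D > 0" "ball p \<rho> \<subseteq> U"
    "\<And>E r. E \<subseteq> {q \<in> ball p \<rho>. f q = 0} \<Longrightarrow> 0 < r \<Longrightarrow> r < R \<Longrightarrow>
       emeasure lborel (\<Union>q\<in>E. U_ball q r) \<le> ennreal (D * r)"
proof -
  obtain e where e: "e \<in> Basis" "F p \<bullet> e \<noteq> 0" using nz euclidean_all_zero_iff by blast
  obtain \<rho>1 C where C: "\<rho>1 > 0" "C > 0" "ball p \<rho>1 \<subseteq> U"
    "\<And>a m. a > 0 \<Longrightarrow> integrable lborel (\<lambda>q. indicator (ball p \<rho>1) q * cauchy ((f q - m) / a)) \<and>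
       (LINT q|lborel. indicator (ball p \<rho>1) q * cauchy ((f q - m) / a)) \<le> C * a"
    by (rule volume_transversal[OF f p e], rule that; blast)
  obtain \<rho>2 R2 where R2: "\<rho>2 > 0" "R2 > 0" "\<And>q m. q \<in> ball p \<rho>2 \<Longrightarrow> box_norm m < R2 \<Longrightarrow> q \<star> m \<in> ball p \<rho>1"
    by (rule hmul_near[OF C(1)], rule that; blast)
  obtain \<rho>3 R3 L where L: "\<rho>3 > 0" "R3 > 0" "L > 0" "ball p \<rho>3 \<subseteq> U"
    "\<And>q m. q \<in> ball p \<rho>3 \<Longrightarrow> box_norm m < R3 \<Longrightarrow> q \<star> m \<in> U \<and> \<bar>f (q \<star> m) - f q\<bar> \<le> L * box_norm m"
    by (rule hgrad_on_Lipschitz[OF f p], rule that; blast)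
  show ?thesis
  proof (rule that[of "min \<rho>2 \<rho>3" "min R2 R3" "2 * C * L"])
    fix E r assume E: "E \<subseteq> {q \<in> ball p (min \<rho>2 \<rho>3). f q = 0}" and r: "0 < r" "r < min R2 R3"
    have a: "L * r > 0" using L r by simp
    have near: "q' \<in> ball p \<rho>1 \<and> \<bar>f q'\<bar> \<le> L * r" if qE: "q \<in> E" and q': "q' \<in> U_ball q r" for q q'
    proof -
      have q: "q \<in> ball p \<rho>2" "q \<in> ball p \<rho>3" "f q = 0" using E qE by auto
      obtain m where m: "q' = q \<star> m" "box_norm m < r" using q' by (auto simp: U_ball_def)
      have "\<bar>f q'\<bar> \<le> L * box_norm m" using L(5)[OF q(2), of m] m r q(3) by simp
      also have "\<dots> \<le> L * r" using L(3) m(2) by simp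
      finally show ?thesis using R2(3)[OF q(1), of m] m r by simp
    qed
    have 1: "\<bar>f q / (L * r)\<bar> \<le> 1 \<and> q \<in> ball p \<rho>1" if "q \<in> (\<Union>q\<in>E. U_ball q r)" for q
    proof -
      have "q \<in> ball p \<rho>1 \<and> \<bar>f q\<bar> \<le> L * r" using that near by blast
      then show ?thesis using a by (simp add: abs_divide abs_of_pos del: abs_mult)
    qed
    note Ca = C(4)[OF a, of 0]
    have "emeasure lborel (\<Union>q\<in>E. U_ball q r)
       \<le> ennreal ((LINT q|lborel. indicator (ball p \<rho>1) q * cauchy ((f q - 0) / (L * r))) / (1 / 2))"
    proof (rule emeasure_le_integral)
      show "indicator (ball p \<rho>1) q * cauchy ((f q - 0) / (L * r)) \<ge> 1 / 2" if "q \<in> (\<Union>q\<in>E. U_ball q r)" for q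
        using 1[OF that] cauchy_bounds(3)[of "f q / (L * r)"] by (simp add: indicator_def)
      have "open (\<Union>q\<in>E. U_ball q r)" by (intro open_UN ballI open_U_ball)
      then show "(\<Union>q\<in>E. U_ball q r) \<in> sets borel" by simp
    qed (use Ca cauchy_bounds(1) in \<open>auto simp: less_imp_le\<close>)
    also have "\<dots> \<le> ennreal (2 * C * L * r)" using Ca by (intro ennreal_leI) simp
    finally show "emeasure lborel (\<Union>q\<in>E. U_ball q r) \<le> ennreal (2 * C * L * r)" .
  qed (use R2 L C in auto)
qed

text \<open>As for one function, with kernels of widths \<open>L * r\<close> for \<open>f\<close>
  and \<open>b + L * r\<close> for \<open>u\<close>: moving by r changes \<open>u\<close> by at most
  \<open>L * r\<close>. Linear independence of the two gradients at \<open>p\<close> provides a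
  nonzero 2 by 2 minor.\<close>

lemma nbhd_volume_slice:
  fixes f u :: "'n::finite heis \<Rightarrow> real"
  assumes f: "hgrad_on U f F" and u: "hgrad_on U u A" and u2: "Ck_on 2 U u" and p: "p \<in> U"
    and A: "\<And>q e. q \<in> U \<Longrightarrow> e \<in> Basis \<Longrightarrow> A q \<bullet> e = frechet_derivative u (at q) (hor e q)"
    and nz: "F p \<noteq> 0" "\<And>c. A p \<noteq> c *\<^sub>R F p"
  obtains \<rho> R D where "\<rho> > 0" "R > 0" "D > 0" "ball p \<rho> \<subseteq> U"
    "\<And>E r b m. E \<subseteq> {q \<in> ball p \<rho>. f q = 0 \<and> \<bar>u q - m\<bar> \<le> b} \<Longrightarrow> 0 < r \<Longrightarrow> r < R \<Longrightarrow> 0 \<le> b \<Longrightarrow>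
       emeasure lborel (\<Union>q\<in>E. U_ball q r) \<le> ennreal (D * r * (b + D * r))"
proof -
  obtain e0 where e0: "e0 \<in> Basis" "F p \<bullet> e0 \<noteq> 0" using nz(1) euclidean_all_zero_iff by blast
  have "\<exists>e\<in>Basis. A p \<bullet> e \<noteq> (A p \<bullet> e0) / (F p \<bullet> e0) * (F p \<bullet> e)"
  proof (rule ccontr)
    assume "\<not> ?thesis"
    then have "A p \<bullet> e = (((A p \<bullet> e0) / (F p \<bullet> e0)) *\<^sub>R F p) \<bullet> e" if "e \<in> Basis" for e
      using that unfolding inner_scaleR_left by blast
    then have "A p = ((A p \<bullet> e0) / (F p \<bullet> e0)) *\<^sub>R F p" by (rule euclidean_eqI)
    then show False using nz(2) by blast
  qed
  then obtain e' where e': "e' \<in> Basis" "(A p \<bullet> e') * (F p \<bullet> e0) \<noteq> (A p \<bullet> e0) * (F p \<bullet> e')"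
    using e0(2) by (metis nonzero_eq_divide_eq times_divide_eq_left)
  \<comment> \<open>If the minor is nonzero, the gradient of \<open>u\<close> cannot vanish in both
    directions; they are ordered so that it does not vanish in the first one.\<close>
  obtain e1 e2 where e: "e1 \<in> Basis" "e2 \<in> Basis" "A p \<bullet> e1 \<noteq> 0"
      "(A p \<bullet> e1) * (F p \<bullet> e2) - (A p \<bullet> e2) * (F p \<bullet> e1) \<noteq> 0"
  proof (cases "A p \<bullet> e' = 0")
    case True
    then show ?thesis using that[of e0 e'] e' e0 by auto
  next
    case False
    then show ?thesis using that[of e' e0] e' e0 by auto
  qed
  obtain \<rho>1 C where C: "\<rho>1 > 0" "C > 0" "ball p \<rho>1 \<subseteq> U"
    "\<And>a b m. a > 0 \<Longrightarrow> b > 0 \<Longrightarrow>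
       integrable lborel (\<lambda>q. indicator (ball p \<rho>1) q * (cauchy (f q / a) * cauchy ((u q - m) / b))) \<and>
       (LINT q|lborel. indicator (ball p \<rho>1) q * (cauchy (f q / a) * cauchy ((u q - m) / b))) \<le> C * a * b"
    by (rule volume_double_transversal[OF f u u2 p _ e], rule A, assumption, assumption, rule that; blast)
  obtain \<rho>2 R2 where R2: "\<rho>2 > 0" "R2 > 0" "\<And>q m. q \<in> ball p \<rho>2 \<Longrightarrow> box_norm m < R2 \<Longrightarrow> q \<star> m \<in> ball p \<rho>1"
    by (rule hmul_near[OF C(1)], rule that; blast)
  obtain \<rho>3 R3 L3 where L3: "\<rho>3 > 0" "R3 > 0" "L3 > 0" "ball p \<rho>3 \<subseteq> U"
    "\<And>q m. q \<in> ball p \<rho>3 \<Longrightarrow> box_norm m < R3 \<Longrightarrow> q \<star> m \<in> U \<and> \<bar>f (q \<star> m) - f q\<bar> \<le> L3 * box_norm m"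
    by (rule hgrad_on_Lipschitz[OF f p], rule that; blast)
  obtain \<rho>4 R4 L4 where L4: "\<rho>4 > 0" "R4 > 0" "L4 > 0" "ball p \<rho>4 \<subseteq> U"
    "\<And>q m. q \<in> ball p \<rho>4 \<Longrightarrow> box_norm m < R4 \<Longrightarrow> q \<star> m \<in> U \<and> \<bar>u (q \<star> m) - u q\<bar> \<le> L4 * box_norm m"
    by (rule hgrad_on_Lipschitz[OF u p], rule that; blast)
  define L where "L = max L3 L4"
  have L: "L > 0" "L3 \<le> L" "L4 \<le> L" using L3(3) by (auto simp: L_def)
  \<comment> \<open>One constant serves twice: it dominates the Lipschitz constant inside the
    bracket and the factor in front, whose 4 comes from the lower bound 1/2 on each kernel.\<close>
  define D where "D = max L (4 * C * L)"
  have D: "D > 0" "L \<le> D" "4 * C * L \<le> D" using L(1) by (auto simp: D_def)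
  show ?thesis
  proof (rule that[of "min \<rho>2 (min \<rho>3 \<rho>4)" "min R2 (min R3 R4)" D])
    fix E r b m assume E: "E \<subseteq> {q \<in> ball p (min \<rho>2 (min \<rho>3 \<rho>4)). f q = 0 \<and> \<bar>u q - m\<bar> \<le> b}"
      and r: "0 < r" "r < min R2 (min R3 R4)" and b: "0 \<le> b"
    have a: "L * r > 0" "b + L * r > 0" using L r b by (auto simp: add_nonneg_pos)
    have near: "q' \<in> ball p \<rho>1 \<and> \<bar>f q'\<bar> \<le> L * r \<and> \<bar>u q' - m\<bar> \<le> b + L * r" if qE: "q \<in> E" and q': "q' \<in> U_ball q r" for q q'
    proof -
      have q: "q \<in> ball p \<rho>2" "q \<in> ball p \<rho>3" "q \<in> ball p \<rho>4" "f q = 0" "\<bar>u q - m\<bar> \<le> b" using E qE by auto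
      obtain v where v: "q' = q \<star> v" "box_norm v < r" using q' by (auto simp: U_ball_def)
      have "L3 * box_norm v \<le> L * r" "L4 * box_norm v \<le> L * r"
        using v(2) L L3(3) L4(3) by (auto intro!: mult_mono)
      then show ?thesis using R2(3)[OF q(1), of v] v r L3(5)[OF q(2), of v] L4(5)[OF q(3), of v] q(4,5)
        by (auto simp del: mem_ball)
    qed
    have 1: "\<bar>f q / (L * r)\<bar> \<le> 1 \<and> \<bar>(u q - m) / (b + L * r)\<bar> \<le> 1 \<and> q \<in> ball p \<rho>1"
      if "q \<in> (\<Union>q\<in>E. U_ball q r)" for q
    proof -
      have "q \<in> ball p \<rho>1 \<and> \<bar>f q\<bar> \<le> L * r \<and> \<bar>u q - m\<bar> \<le> b + L * r" using that near by blast
      then show ?thesis using a by (simp add: abs_divide abs_of_pos del: abs_mult)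
    qed
    note Ca = C(4)[OF a, of m]
    have "emeasure lborel (\<Union>q\<in>E. U_ball q r)
       \<le> ennreal ((LINT q|lborel. indicator (ball p \<rho>1) q * (cauchy (f q / (L * r)) * cauchy ((u q - m) / (b + L * r)))) / (1 / 4))"
    proof (rule emeasure_le_integral)
      show "indicator (ball p \<rho>1) q * (cauchy (f q / (L * r)) * cauchy ((u q - m) / (b + L * r))) \<ge> 1 / 4"
        if "q \<in> (\<Union>q\<in>E. U_ball q r)" for q
      proof -
        have "cauchy (f q / (L * r)) * cauchy ((u q - m) / (b + L * r)) \<ge> 1/2 * (1/2)"
          using 1[OF that] by (intro mult_mono cauchy_bounds(3)) (auto simp: cauchy_bounds(1) less_imp_le)
        then show ?thesis using 1[OF that] by (simp add: indicator_def)
      qed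
      have "open (\<Union>q\<in>E. U_ball q r)" by (intro open_UN ballI open_U_ball)
      then show "(\<Union>q\<in>E. U_ball q r) \<in> sets borel" by simp
    qed (use Ca cauchy_bounds(1) in \<open>auto simp: less_imp_le\<close>)
    also have "\<dots> \<le> ennreal (4 * C * L * r * (b + L * r))" using Ca by (intro ennreal_leI) (simp add: algebra_simps)
    also have "\<dots> \<le> ennreal (D * r * (b + D * r))"
      using D L r b C(2) by (intro ennreal_leI mult_mono add_mono) auto
    finally show "emeasure lborel (\<Union>q\<in>E. U_ball q r) \<le> ennreal (D * r * (b + D * r))" .
  qed (use R2 L3 L4 C D in auto)
qed

subsection \<open>The spherical outer measure\<close>

lemma sph_outer_mono: "c > 0 \<Longrightarrow> A \<subseteq> B \<Longrightarrow> sph_outer c A \<le> sph_outer c B"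
  unfolding sph_outer_def by (auto intro!: SUP_mono sph_pre_mono)

lemma sph_pre_le_sph_outer: "\<delta> > 0 \<Longrightarrow> sph_pre c \<delta> E \<le> sph_outer c E"
  unfolding sph_outer_def by (intro SUP_upper) auto

lemma sph_outer_UN_le: "sph_outer c (\<Union>n::nat. A n) \<le> (\<Sum>n. sph_outer c (A n))"
  unfolding sph_outer_def[of c "\<Union>n. A n"]
proof (rule SUP_least)
  fix \<delta> :: real assume "\<delta> \<in> {0<..}"
  then have "(\<Sum>n. sph_pre c \<delta> (A n)) \<le> (\<Sum>n. sph_outer c (A n))"
    by (intro suminf_le sph_pre_le_sph_outer) auto
  then show "sph_pre c \<delta> (\<Union>n. A n) \<le> (\<Sum>n. sph_outer c (A n))"
    using sph_pre_subadditive order_trans by blast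
qed

lemma sph_pre_empty: "c > 0 \<Longrightarrow> \<delta> > 0 \<Longrightarrow> sph_pre c \<delta> ({} :: 'n::finite heis set) = 0"
  using sph_pre_le_sph_outer[of \<delta> c "{} :: 'n heis set"] sph_outer_empty[of c, where 'n = 'n] by simp

text \<open>Covers are infinite sequences of balls with positive radii, so the single ball is
  completed by a cover of the empty set of arbitrarily small content.\<close>

lemma sph_pre_U_ball:
  fixes p :: "'n::finite heis"
  assumes c: "c > 0" and r: "0 < r" "r < \<delta>"
  shows "sph_pre c \<delta> (U_ball p r) \<le> ennreal (c * r ^ (2 * CARD('n) + 1))"
proof (rule ennreal_le_epsilon)
  fix e :: real assume e: "0 < e"
  have "sph_pre c \<delta> ({} :: 'n heis set) < ennreal e"
    using sph_pre_empty[OF c, where 'n = 'n] r e by simp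
  then obtain r' where p': "\<forall>i::nat. 0 < r' i \<and> r' i < \<delta>"
    "(\<Sum>i. ennreal (c * r' i ^ (2 * CARD('n) + 1))) < ennreal e"
    unfolding sph_pre_def INF_less_iff by auto
  let ?p = "case_nat p (\<lambda>_. 0)" and ?r = "case_nat r r'"
  have "sph_pre c \<delta> (U_ball p r) \<le> (\<Sum>i. ennreal (c * ?r i ^ (2 * CARD('n) + 1)))"
    unfolding sph_pre_def
  proof (rule INF_lower2[of "(?p, ?r)"], safe)
    show "0 < ?r i" "?r i < \<delta>" for i using p'(1) r by (auto split: nat.split)
    show "x \<in> (\<Union>i. U_ball (?p i) (?r i))" if "x \<in> U_ball p r" for x
      using that by (intro UN_I[of 0]) simp_all
  qed
  also have "\<dots> = (\<Sum>i. ennreal (c * ?r (i + 1) ^ (2 * CARD('n) + 1))) + (\<Sum>i<1. ennreal (c * ?r i ^ (2 * CARD('n) + 1)))"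
    by (rule suminf_offset) (rule summableI)
  also have "\<dots> \<le> ennreal e + ennreal (c * r ^ (2 * CARD('n) + 1))"
    using p'(2) by (intro add_mono) auto
  finally show "sph_pre c \<delta> (U_ball p r) \<le> ennreal (c * r ^ (2 * CARD('n) + 1)) + ennreal e"
    by (simp add: add.commute)
qed

lemma sph_pre_finite_UN:
  fixes A :: "'i \<Rightarrow> 'n::finite heis set"
  assumes "c > 0" "\<delta> > 0" "finite I"
  shows "sph_pre c \<delta> (\<Union>i\<in>I. A i) \<le> (\<Sum>i\<in>I. sph_pre c \<delta> (A i))"
  using assms(3)
proof (induction I rule: finite_induct)
  case empty
  then show ?case using sph_pre_empty[OF assms(1,2), where 'n = 'n] by simp
next
  case (insert i I)
  define B where "B n = (case n of 0 \<Rightarrow> A i | Suc 0 \<Rightarrow> (\<Union>i\<in>I. A i) | _ \<Rightarrow> {})" for n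
  have "(\<Union>i\<in>insert i I. A i) \<subseteq> (\<Union>n. B n)"
  proof
    fix x assume "x \<in> (\<Union>i\<in>insert i I. A i)"
    then have "x \<in> B 0 \<or> x \<in> B (Suc 0)" by (auto simp: B_def)
    then show "x \<in> (\<Union>n. B n)" by blast
  qed
  then have "sph_pre c \<delta> (\<Union>i\<in>insert i I. A i) \<le> sph_pre c \<delta> (\<Union>n. B n)" by (rule sph_pre_mono)
  also have "\<dots> \<le> (\<Sum>n. sph_pre c \<delta> (B n))" by (rule sph_pre_subadditive)
  also have "\<dots> = (\<Sum>n\<in>{0, Suc 0}. sph_pre c \<delta> (B n))"
    using sph_pre_empty[OF assms(1,2), where 'n = 'n]
    by (intro suminf_finite) (auto simp: B_def split: nat.split)
  also have "\<dots> \<le> (\<Sum>i\<in>insert i I. sph_pre c \<delta> (A i))"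
    using insert by (simp add: B_def add_left_mono)
  finally show ?case .
qed

lemma box_norm_dist_commute: "box_norm (- p \<star> q) = box_norm (- q \<star> p)"
proof -
  have "- q \<star> p = - (- p \<star> q)"
    by (simp add: hmul_def imh_simps prod_eq_iff Im_hdot_commute[of "fst q"])
  then show ?thesis by simp
qed

lemma box_norm_dist_triangle: "box_norm (- p \<star> q) \<le> box_norm (- p \<star> x) + box_norm (- x \<star> q)"
proof -
  have "- p \<star> q = (- p \<star> x) \<star> (- x \<star> q)" by (simp add: hmul_assoc)
  then show ?thesis using box_norm_hmul by metis
qed

text \<open>After a left translation the ball is the product of a Euclidean ball of radius r in real
  dimension 2n and an interval of length 2 r^2; this yields the homogeneous dimension 2n +
  2.\<close>

lemma emeasure_U_ball:
  obtains v where "v > 0"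
    "\<And>(p :: 'n::finite heis) r. r > 0 \<Longrightarrow> emeasure lborel (U_ball p r) = ennreal (v * r ^ (2 * CARD('n) + 2))"
proof -
  define w where "w = unit_ball_vol (real DIM(complex ^ 'n))"
  have w: "w > 0" unfolding w_def by (rule unit_ball_vol_pos) simp
  have dim: "DIM(complex ^ 'n) = 2 * CARD('n)" by simp
  have "emeasure lborel (U_ball p r) = ennreal (2 * w * r ^ (2 * CARD('n) + 2))"
    if r: "r > 0" for p :: "'n heis" and r
  proof -
    let ?B = "ball (0 :: complex ^ 'n) r \<times> {- (r\<^sup>2)<..<r\<^sup>2}"
    have B: "?B \<in> sets borel" by (intro borel_open open_Times) auto
    have eq: "(\<lambda>q. - p \<star> q) -` ?B = U_ball p r"
    proof (rule set_eqI)
      fix q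
      show "q \<in> (\<lambda>q. - p \<star> q) -` ?B \<longleftrightarrow> q \<in> U_ball p r"
        unfolding U_ball_iff box_norm_less_iff[OF r] by (auto simp: mem_Times_iff abs_less_iff simp del: fst_hmul)
    qed
    have "emeasure lborel ?B = emeasure (distr lborel borel (\<lambda>q. - p \<star> q)) ?B"
      by (simp only: lborel_distr_hmul_left)
    also have "\<dots> = emeasure lborel (U_ball p r)"
    proof (subst emeasure_distr)
      show "(\<lambda>q. - p \<star> q) \<in> lborel \<rightarrow>\<^sub>M borel"
        by (auto intro!: borel_measurable_continuous_onI continuous_intros)
    qed (use B eq in auto)
    finally have "emeasure lborel (U_ball p r) = emeasure lborel ?B" by simp
    also have "\<dots> = emeasure (lborel \<Otimes>\<^sub>M lborel) ?B" by (simp only: lborel_prod)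
    also have "\<dots> = emeasure lborel (ball (0 :: complex ^ 'n) r) * emeasure lborel {- (r\<^sup>2)<..<r\<^sup>2}"
      by (rule lborel.emeasure_pair_measure_Times) auto
    also have "\<dots> = ennreal (w * r ^ (2 * CARD('n))) * ennreal (2 * r\<^sup>2)"
      using r emeasure_ball[of r "0 :: complex ^ 'n"] by (simp add: w_def mult.commute)
    also have "\<dots> = ennreal (2 * w * r ^ (2 * CARD('n) + 2))"
      using w r by (simp add: power_add power2_eq_square mult_ac flip: ennreal_mult)
    finally show ?thesis .
  qed
  then show ?thesis using that[of "2 * w"] w by simp
qed

text \<open>A maximal separated subset turns a bound on the volume of neighbourhoods into a bound on the
  number of balls of a cover.\<close>

lemma sph_outer_le_volume:
  assumes c: "c > 0"
  obtains K where "K > 0" "\<And>(E :: 'n::finite heis set) D R. R > 0 \<Longrightarrow> D \<ge> 0 \<Longrightarrow>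
    (\<And>r. 0 < r \<Longrightarrow> r < R \<Longrightarrow> emeasure lborel (\<Union>q\<in>E. U_ball q r) \<le> ennreal (D * r)) \<Longrightarrow>
    sph_outer c E \<le> ennreal (K * D)"
proof -
  let ?N = "2 * CARD('n) + 1"
  obtain v where v: "v > 0" "\<And>(p :: 'n heis) r. r > 0 \<Longrightarrow> emeasure lborel (U_ball p r) = ennreal (v * r ^ (2 * CARD('n) + 2))"
    by (rule emeasure_U_ball, rule that; blast)
  show ?thesis
  proof (rule that[of "c * 2 ^ ?N / v"])
    fix E :: "'n heis set" and D R :: real
    assume R: "R > 0" and D: "D \<ge> 0"
      and vol: "\<And>r. 0 < r \<Longrightarrow> r < R \<Longrightarrow> emeasure lborel (\<Union>q\<in>E. U_ball q r) \<le> ennreal (D * r)"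
    have "sph_pre c \<delta> E \<le> ennreal (c * 2 ^ ?N / v * D)" if \<delta>: "\<delta> > 0" for \<delta>
    proof -
      \<comment> \<open>Small enough for the volume bound at radius r and for covering balls of
        radius 2r below \<delta>.\<close>
      define r where "r = min R (\<delta> / 2) / 2"
      have r: "0 < r" "r < R" "2 * r < \<delta>" using R \<delta> by (auto simp: r_def)
      define sep where "sep P \<longleftrightarrow> finite P \<and> P \<subseteq> E \<and> (\<forall>p\<in>P. \<forall>q\<in>P. p \<noteq> q \<longrightarrow> box_norm (- p \<star> q) \<ge> 2 * r)" for P
      \<comment> \<open>Disjoint balls around separated points fit into the r-neighbourhood. One
        power of r cancels against \<open>D * r\<close>, and the power that remains is that of the
        content, so the final bound is independent of r.\<close>
      have card: "card P * (v * r ^ ?N) \<le> D" if P: "sep P" for P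
      proof -
        have disj: "disjoint_family_on (\<lambda>p. U_ball p r) P"
          unfolding disjoint_family_on_def
        proof (intro ballI impI)
          fix p q assume pq: "p \<in> P" "q \<in> P" "p \<noteq> q"
          have "False" if "x \<in> U_ball p r" "x \<in> U_ball q r" for x
            using box_norm_dist_triangle[of p q x] box_norm_dist_commute[of x q] that P pq
            unfolding sep_def U_ball_iff by fastforce
          then show "U_ball p r \<inter> U_ball q r = {}" by blast
        qed
        have "ennreal (card P * (v * r ^ (2 * CARD('n) + 2))) = (\<Sum>p\<in>P. emeasure lborel (U_ball p r))"
          using v r(1) by (simp add: ennreal_mult ennreal_of_nat_eq_real_of_nat)
        also have "\<dots> = emeasure lborel (\<Union>p\<in>P. U_ball p r)"
          using P disj by (intro sum_emeasure) (auto simp: sep_def open_U_ball borel_open)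
        also have "\<dots> \<le> emeasure lborel (\<Union>q\<in>E. U_ball q r)"
        proof (rule emeasure_mono)
          have "open (\<Union>q\<in>E. U_ball q r)" by (intro open_UN ballI open_U_ball)
          then show "(\<Union>q\<in>E. U_ball q r) \<in> sets lborel" by simp
        qed (use P in \<open>auto simp: sep_def\<close>)
        also have "\<dots> \<le> ennreal (D * r)" by (rule vol[OF r(1,2)])
        finally have "card P * (v * r ^ (2 * CARD('n) + 2)) \<le> D * r" using D r(1) by (subst (asm) ennreal_le_iff) auto
        then have "(card P * (v * r ^ ?N)) * r \<le> D * r" by (simp add: mult_ac)
        then show ?thesis using r(1) by (simp add: mult_ac)
      qed
      \<comment> \<open>The bound on cardinalities yields a separated set of greatest size; by
        maximality its points are within 2r of all of \<open>E\<close>.\<close>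
      have "sep {}" by (simp add: sep_def)
      moreover have "card P < nat \<lceil>D / (v * r ^ ?N)\<rceil> + 1" if "sep P" for P
      proof -
        have "real (card P) \<le> D / (v * r ^ ?N)" using card[OF that] v(1) r(1) by (simp add: le_divide_eq)
        then show ?thesis by linarith
      qed
      ultimately obtain P where P: "sep P" "\<And>Q. sep Q \<Longrightarrow> card Q \<le> card P"
        using ex_has_greatest_nat[of sep "{}" card] by blast
      have cover: "E \<subseteq> (\<Union>p\<in>P. U_ball p (2 * r))"
      proof
        fix q assume q: "q \<in> E"
        show "q \<in> (\<Union>p\<in>P. U_ball p (2 * r))"
        proof (rule ccontr)
          assume "q \<notin> (\<Union>p\<in>P. U_ball p (2 * r))"
          then have far: "box_norm (- p \<star> q) \<ge> 2 * r" if "p \<in> P" for p using that unfolding U_ball_iff UN_iff by (meson not_le)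
          then have "q \<notin> P" using r(1) far[of q] by auto
          moreover have "sep (insert q P)"
            using P(1) q far box_norm_dist_commute unfolding sep_def by (metis finite_insert insert_iff insert_subset)
          ultimately show False using P(2)[of "insert q P"] P(1) by (simp add: sep_def)
        qed
      qed
      have "sph_pre c \<delta> E \<le> sph_pre c \<delta> (\<Union>p\<in>P. U_ball p (2 * r))" by (rule sph_pre_mono[OF cover])
      also have "\<dots> \<le> (\<Sum>p\<in>P. sph_pre c \<delta> (U_ball p (2 * r)))"
        using P(1) by (intro sph_pre_finite_UN c \<delta>) (simp add: sep_def)
      also have "\<dots> \<le> (\<Sum>p\<in>P. ennreal (c * (2 * r) ^ ?N))"
        using r by (intro sum_mono sph_pre_U_ball c) auto
      also have "\<dots> = ennreal (card P * (c * (2 * r) ^ ?N))"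
        using c r by (simp add: ennreal_mult ennreal_of_nat_eq_real_of_nat)
      also have "\<dots> \<le> ennreal (c * 2 ^ ?N / v * D)"
      proof (rule ennreal_leI)
        have "card P * (c * (2 * r) ^ ?N) = c * 2 ^ ?N / v * (card P * (v * r ^ ?N))"
          using v(1) unfolding power_mult_distrib by (simp add: field_simps)
        also have "\<dots> \<le> c * 2 ^ ?N / v * D"
          using card[OF P(1)] c v(1) by (intro mult_left_mono) auto
        finally show "card P * (c * (2 * r) ^ ?N) \<le> c * 2 ^ ?N / v * D" .
      qed
      finally show ?thesis .
    qed
    then show "sph_outer c E \<le> ennreal (c * 2 ^ ?N / v * D)"
      unfolding sph_outer_def by (intro SUP_least) auto
  qed (use c v in auto)
qed

lemma sph_outer_hypersurface_finite:
  fixes f :: "'n::finite heis \<Rightarrow> real"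
  assumes c: "c > 0" and f: "hgrad_on U f F" and p: "p \<in> U" and nz: "F p \<noteq> 0"
  obtains \<rho> where "\<rho> > 0" "ball p \<rho> \<subseteq> U" "sph_outer c {q \<in> ball p \<rho>. f q = 0} < \<infinity>"
proof -
  obtain \<rho> R D where D: "\<rho> > 0" "R > 0" "D > 0" "ball p \<rho> \<subseteq> U"
    "\<And>E r. E \<subseteq> {q \<in> ball p \<rho>. f q = 0} \<Longrightarrow> 0 < r \<Longrightarrow> r < R \<Longrightarrow>
       emeasure lborel (\<Union>q\<in>E. U_ball q r) \<le> ennreal (D * r)"
    by (rule nbhd_volume[OF f p nz], rule that; blast)
  obtain K where K: "K > 0" "\<And>(E :: 'n heis set) D R. R > 0 \<Longrightarrow> D \<ge> 0 \<Longrightarrow>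
    (\<And>r. 0 < r \<Longrightarrow> r < R \<Longrightarrow> emeasure lborel (\<Union>q\<in>E. U_ball q r) \<le> ennreal (D * r)) \<Longrightarrow>
    sph_outer c E \<le> ennreal (K * D)"
    by (rule sph_outer_le_volume[OF c], rule that; blast)
  have "sph_outer c {q \<in> ball p \<rho>. f q = 0} \<le> ennreal (K * D)"
    using D by (intro K(2)[of R]) auto
  also have "\<dots> < \<infinity>" by simp
  finally show ?thesis using that D by blast
qed

text \<open>Outer measure expressed by a sequence of intervals, ready for countable subadditivity of
  \<open>sph_outer c\<close>.\<close>

lemma null_real_cover:
  assumes N: "N \<in> null_sets lborel" and b: "N \<subseteq> {-k..k::real}" and e: "e > 0"
  obtains a d where "\<And>i::nat. a i \<le> d i" "N \<subseteq> (\<Union>i. {a i..d i})" "(\<Sum>i. ennreal (d i - a i)) \<le> ennreal e"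
proof -
  have null: "N \<in> null_sets lebesgue" using null_sets_completionI[OF N] .
  then have lm: "N \<in> lmeasurable" and m0: "measure lebesgue N = 0"
    by (auto simp: fmeasurable_def null_sets_def measure_def)
  have sub: "N \<subseteq> cbox (- k) k" using b by simp
  obtain \<D> where D: "countable \<D>" "\<And>K. K \<in> \<D> \<Longrightarrow> K \<subseteq> cbox (-k) k \<and> K \<noteq> {} \<and> (\<exists>c d. K = cbox c d)"
    "pairwise (\<lambda>A B. interior A \<inter> interior B = {}) \<D>" "N \<subseteq> \<Union>\<D>" "\<Union>\<D> \<in> lmeasurable" "measure lebesgue (\<Union>\<D>) \<le> e"
    by (rule measurable_outer_intervals_bounded[OF lm sub e], rule that; (assumption | simp add: m0))
  define I where "I = to_nat_on \<D> ` \<D>"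
  define K where "K i = from_nat_into \<D> i" for i
  have K: "K i \<in> \<D>" "to_nat_on \<D> (K i) = i" if "i \<in> I" for i
    using that D(1) by (auto simp: I_def K_def)
  have "\<exists>c d. c \<le> d \<and> K i = {c..d}" if iI: "i \<in> I" for i
  proof -
    obtain c d where "K i = {c..d}" "{c..d} \<noteq> {}" using D(2)[OF K(1)[OF iI]] by (auto simp: cbox_interval)
    then show ?thesis by (intro exI[of _ c] exI[of _ d]) auto
  qed
  then obtain a0 d0 where ad: "\<And>i. i \<in> I \<Longrightarrow> a0 i \<le> d0 i \<and> K i = {a0 i..d0 i}" by metis
  \<comment> \<open>Indices that number no box receive the degenerate interval [0, 0], of length
    0.\<close>
  define a where "a i = (if i \<in> I then a0 i else 0)" for i
  define d where "d i = (if i \<in> I then d0 i else 0)" for i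
  \<comment> \<open>The closed boxes may share endpoints, so lengths are added up over their
    disjoint interiors.\<close>
  define w where "w i = (if i \<in> I then {a0 i<..<d0 i} else {})" for i
  have int: "interior (K i) = w i" if "i \<in> I" for i using ad[OF that] that by (simp add: w_def)
  have "disjoint_family w"
    unfolding disjoint_family_on_def
  proof (intro ballI impI)
    fix i j :: nat assume "i \<noteq> j"
    show "w i \<inter> w j = {}"
    proof (cases "i \<in> I \<and> j \<in> I")
      case True
      then have "K i \<noteq> K j" using K(2)[of i] K(2)[of j] \<open>i \<noteq> j\<close> by auto
      then have "interior (K i) \<inter> interior (K j) = {}"
        using D(3) K(1)[of i] K(1)[of j] True unfolding pairwise_def by blast
      then show ?thesis using int True by simp
    qed (auto simp: w_def)
  qed
  moreover have wm: "range w \<subseteq> sets lborel" by (auto simp: w_def)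
  ultimately have "(\<Sum>i. emeasure lborel (w i)) = emeasure lborel (\<Union>i. w i)"
    by (intro suminf_emeasure)
  also have "\<dots> = emeasure lebesgue (\<Union>i. w i)"
  proof -
    have "(\<Union>i. w i) \<in> sets lborel" using wm by blast
    then show ?thesis by (simp add: sets_completionI_sets)
  qed
  also have "\<dots> \<le> emeasure lebesgue (\<Union>\<D>)"
  proof (rule emeasure_mono)
    show "(\<Union>i. w i) \<subseteq> \<Union>\<D>"
    proof
      fix x assume "x \<in> (\<Union>i. w i)"
      then obtain i where i: "x \<in> w i" by blast
      then have "i \<in> I" by (simp add: w_def split: if_splits)
      then show "x \<in> \<Union>\<D>" using i int[of i] K(1)[of i] interior_subset[of "K i"] by blast
    qed
  qed (use D(5) in \<open>simp add: fmeasurableD\<close>)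
  also have "\<dots> \<le> ennreal e"
    using D(5,6) by (simp add: emeasure_eq_measure2 ennreal_leI)
  finally have "(\<Sum>i. emeasure lborel (w i)) \<le> ennreal e" .
  moreover have "emeasure lborel (w i) = ennreal (d i - a i)" for i
    using ad[of i] by (auto simp: w_def d_def a_def)
  ultimately have sum: "(\<Sum>i. ennreal (d i - a i)) \<le> ennreal e" by simp
  have "N \<subseteq> (\<Union>i. {a i..d i})"
  proof
    fix x assume "x \<in> N"
    then obtain A where A: "A \<in> \<D>" "x \<in> A" using D(4) by auto
    define i where "i = to_nat_on \<D> A"
    have i: "i \<in> I" "K i = A" using A(1) D(1) by (auto simp: I_def K_def i_def)
    then have "x \<in> {a i..d i}" using ad[OF i(1)] A(2) by (auto simp: a_def d_def)
    then show "x \<in> (\<Union>i. {a i..d i})" by blast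
  qed
  moreover have "a i \<le> d i" for i using ad[of i] by (simp add: a_def d_def)
  ultimately show ?thesis using sum by (intro that[of a d])
qed

lemma sph_outer_UN_null:
  fixes A :: "nat \<Rightarrow> 'n::finite heis set"
  assumes "\<And>n. sph_outer c (A n) = 0"
  shows "sph_outer c (\<Union>n. A n) = 0"
  using sph_outer_UN_le[of c A] assms by simp

lemma sph_outer_countable_null:
  fixes \<A> :: "'n::finite heis set set"
  assumes c: "c > 0" and A: "countable \<A>" "\<And>A. A \<in> \<A> \<Longrightarrow> sph_outer c A = 0"
  shows "sph_outer c (\<Union>\<A>) = 0"
proof (cases "\<A> = {}")
  case True
  then show ?thesis using sph_outer_empty[OF c, where 'n = 'n] by simp
next
  case False
  then have "sph_outer c (\<Union>n. from_nat_into \<A> n) = 0"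
    using A by (intro sph_outer_UN_null) (auto simp: from_nat_into)
  moreover have "(\<Union>n. from_nat_into \<A> n) = \<Union>\<A>"
    using False A(1) by (metis range_from_nat_into)
  ultimately show ?thesis by simp
qed

text \<open>The part of the hypersurface over an interval has content at most a constant times its
  length, because the additional \<open>D * r\<close> in the neighbourhood estimate disappears as r
  tends to 0. A null set is then covered by intervals of small total length.\<close>

lemma sph_outer_slice_null:
  fixes f u :: "'n::finite heis \<Rightarrow> real"
  assumes c: "c > 0" and f: "hgrad_on U f F" and u: "hgrad_on U u A" and u2: "Ck_on 2 U u" and p: "p \<in> U"
    and A: "\<And>q e. q \<in> U \<Longrightarrow> e \<in> Basis \<Longrightarrow> A q \<bullet> e = frechet_derivative u (at q) (hor e q)"
    and nz: "F p \<noteq> 0" "\<And>c. A p \<noteq> c *\<^sub>R F p"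
  obtains \<rho> where "\<rho> > 0" "ball p \<rho> \<subseteq> U"
    "\<And>N. N \<in> null_sets lborel \<Longrightarrow> sph_outer c {q \<in> ball p \<rho>. f q = 0 \<and> u q \<in> N} = 0"
proof -
  obtain \<rho> R D where D: "\<rho> > 0" "R > 0" "D > 0" "ball p \<rho> \<subseteq> U"
    "\<And>E r b m. E \<subseteq> {q \<in> ball p \<rho>. f q = 0 \<and> \<bar>u q - m\<bar> \<le> b} \<Longrightarrow> 0 < r \<Longrightarrow> r < R \<Longrightarrow> 0 \<le> b \<Longrightarrow>
       emeasure lborel (\<Union>q\<in>E. U_ball q r) \<le> ennreal (D * r * (b + D * r))"
    by (rule nbhd_volume_slice[OF f u u2 p _ nz], rule A, assumption, assumption, rule that; blast)
  obtain K where K: "K > 0" "\<And>(E :: 'n heis set) D R. R > 0 \<Longrightarrow> D \<ge> 0 \<Longrightarrow>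
    (\<And>r. 0 < r \<Longrightarrow> r < R \<Longrightarrow> emeasure lborel (\<Union>q\<in>E. U_ball q r) \<le> ennreal (D * r)) \<Longrightarrow>
    sph_outer c E \<le> ennreal (K * D)"
    by (rule sph_outer_le_volume[OF c], rule that; blast)
  have slice: "sph_outer c {q \<in> ball p \<rho>. f q = 0 \<and> u q \<in> {a..d}} \<le> ennreal (K * D) * ennreal (d - a)"
    if "a \<le> d" for a d
  proof -
    define b where "b = (d - a) / 2"
    let ?E = "{q \<in> ball p \<rho>. f q = 0 \<and> u q \<in> {a..d}}"
    have b: "b \<ge> 0" using that by (simp add: b_def)
    have E: "?E \<subseteq> {q \<in> ball p \<rho>. f q = 0 \<and> \<bar>u q - (a + d) / 2\<bar> \<le> b}"
      by (auto simp: b_def abs_le_iff field_simps)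
    have eps: "sph_outer c ?E \<le> ennreal (K * D * b) + ennreal e" if e: "e > 0" for e
    proof -
      \<comment> \<open>For r below \<open>\<eta> / D\<close> the additional term is at most \<eta>,
        which contributes exactly e after multiplication by \<open>K * D\<close>.\<close>
      define \<eta> where "\<eta> = e / (K * D)"
      have \<eta>: "\<eta> > 0" using e K(1) D(3) by (simp add: \<eta>_def)
      have "sph_outer c ?E \<le> ennreal (K * (D * (b + \<eta>)))"
      proof (rule K(2)[of "min R (\<eta> / D)"])
        fix r assume r: "0 < r" "r < min R (\<eta> / D)"
        have Dr: "D * r \<le> \<eta>" using r D(3) by (simp add: field_simps)
        have "emeasure lborel (\<Union>q\<in>?E. U_ball q r) \<le> ennreal (D * r * (b + D * r))"
          using D(5)[OF E] r b by simp
        also have "\<dots> \<le> ennreal (D * (b + \<eta>) * r)"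
        proof (rule ennreal_leI)
          have "D * r * (b + D * r) \<le> D * r * (b + \<eta>)" using Dr D(3) r by (intro mult_left_mono) auto
          then show "D * r * (b + D * r) \<le> D * (b + \<eta>) * r" by (simp add: mult_ac)
        qed
        finally show "emeasure lborel (\<Union>q\<in>?E. U_ball q r) \<le> ennreal (D * (b + \<eta>) * r)" .
      qed (use D \<eta> b in auto)
      also have "K * (D * (b + \<eta>)) = K * D * b + e" using K(1) D(3) by (simp add: \<eta>_def field_simps)
      finally show ?thesis using K(1) D(3) b e by (simp add: ennreal_plus)
    qed
    have "sph_outer c ?E \<le> ennreal (K * D * b)" by (rule ennreal_le_epsilon, rule eps)
    also have "\<dots> \<le> ennreal (K * D) * ennreal (d - a)"
      using K(1) D(3) that by (simp add: b_def flip: ennreal_mult)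
    finally show ?thesis .
  qed
  show ?thesis
  proof (rule that[OF D(1) D(4)])
    fix N :: "real set" assume N: "N \<in> null_sets lborel"
    let ?E = "\<lambda>N. {q \<in> ball p \<rho>. f q = 0 \<and> u q \<in> N}"
    have "sph_outer c (?E (N \<inter> {- real k..real k})) = 0" for k :: nat
    proof -
      have eps: "sph_outer c (?E (N \<inter> {- real k..real k})) \<le> 0 + ennreal e" if e: "e > 0" for e
      proof -
        define \<eta> where "\<eta> = e / (K * D)"
        have \<eta>: "\<eta> > 0" using e K(1) D(3) by (simp add: \<eta>_def)
        have nullN: "N \<inter> {- real k..real k} \<in> null_sets lborel" using N by (rule null_set_Int2) auto
        obtain a d where ad: "\<And>i::nat. a i \<le> d i" "N \<inter> {- real k..real k} \<subseteq> (\<Union>i. {a i..d i})"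
            "(\<Sum>i. ennreal (d i - a i)) \<le> ennreal \<eta>"
          by (rule null_real_cover[OF nullN Int_lower2 \<eta>], rule that; assumption)
        have "sph_outer c (?E (N \<inter> {- real k..real k})) \<le> sph_outer c (\<Union>i. ?E {a i..d i})"
          using ad(2) by (intro sph_outer_mono c) blast
        also have "\<dots> \<le> (\<Sum>i. sph_outer c (?E {a i..d i}))" by (rule sph_outer_UN_le)
        also have "\<dots> \<le> (\<Sum>i. ennreal (K * D) * ennreal (d i - a i))"
          using slice ad(1) by (intro suminf_le) auto
        also have "\<dots> = ennreal (K * D) * (\<Sum>i. ennreal (d i - a i))" by simp
        also have "\<dots> \<le> ennreal (K * D) * ennreal \<eta>" using ad(3) by (rule mult_left_mono) simp
        also have "\<dots> = ennreal e" using K(1) D(3) \<eta> by (simp add: \<eta>_def flip: ennreal_mult)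
        finally show ?thesis by simp
      qed
      have "sph_outer c (?E (N \<inter> {- real k..real k})) \<le> 0" by (rule ennreal_le_epsilon, rule eps)
      then show ?thesis by simp
    qed
    then have "sph_outer c (\<Union>k. ?E (N \<inter> {- real k..real k})) = 0" by (rule sph_outer_UN_null)
    moreover have "?E N \<subseteq> (\<Union>k. ?E (N \<inter> {- real k..real k}))"
    proof
      fix q assume q: "q \<in> ?E N"
      obtain k :: nat where "\<bar>u q\<bar> \<le> real k" using real_arch_simple by blast
      then have "q \<in> ?E (N \<inter> {- real k..real k})" using q by (simp add: abs_le_iff)
      then show "q \<in> (\<Union>k. ?E (N \<inter> {- real k..real k}))" by blast
    qed
    ultimately show "sph_outer c (?E N) = 0"
      using sph_outer_mono[OF c] by (metis (no_types, lifting) le_zero_eq)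
  qed
qed

subsection \<open>Borel sets are measurable for the spherical measure\<close>

text \<open>Balls of a cover with radii below \<open>d / 2\<close> meet at most one of two sets at distance \<open>d\<close>.\<close>

lemma sph_outer_separated:
  fixes A B :: "'n::finite heis set"
  assumes c: "c > 0" and d: "d > 0" "\<And>x y. x \<in> A \<Longrightarrow> y \<in> B \<Longrightarrow> box_norm (- x \<star> y) \<ge> d"
  shows "sph_outer c A + sph_outer c B \<le> sph_outer c (A \<union> B)"
proof -
  let ?N = "2 * CARD('n) + 1"
  have mono: "sph_pre c \<delta> E \<le> sph_pre c \<delta>' E" if "\<delta>' \<le> \<delta>" for \<delta> \<delta>' :: real and E :: "'n heis set"
    unfolding sph_pre_def using that by (intro INF_superset_mono) (auto intro: order.strict_trans2)
  have pre: "sph_pre c \<delta> A + sph_pre c \<delta> B \<le> sph_pre c \<delta> (A \<union> B)" if \<delta>: "0 < \<delta>" "\<delta> \<le> d / 2" for \<delta>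
    unfolding sph_pre_def[of c \<delta> "A \<union> B"]
  proof (rule INF_greatest, safe)
    fix p :: "nat \<Rightarrow> 'n heis" and r :: "nat \<Rightarrow> real"
    assume r: "\<forall>i. 0 < r i \<and> r i < \<delta>" and cov: "A \<union> B \<subseteq> (\<Union>i. U_ball (p i) (r i))"
    define I where "I = {i. U_ball (p i) (r i) \<inter> A \<noteq> {}}"
    have part: "sph_pre c \<delta> E \<le> (\<Sum>i. if i \<in> J then ennreal (c * r i ^ ?N) else 0)"
      if E: "E \<subseteq> (\<Union>i\<in>J. U_ball (p i) (r i))" for E J
    proof -
      have "sph_pre c \<delta> E \<le> sph_pre c \<delta> (\<Union>i. if i \<in> J then U_ball (p i) (r i) else {})"
        using E by (intro sph_pre_mono) (auto split: if_splits)
      also have "\<dots> \<le> (\<Sum>i. sph_pre c \<delta> (if i \<in> J then U_ball (p i) (r i) else {}))"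
        by (rule sph_pre_subadditive)
      also have "\<dots> \<le> (\<Sum>i. if i \<in> J then ennreal (c * r i ^ ?N) else 0)"
      proof (intro suminf_le summableI)
        show "sph_pre c \<delta> (if i \<in> J then U_ball (p i) (r i) else {}) \<le> (if i \<in> J then ennreal (c * r i ^ ?N) else 0)" for i
          using r sph_pre_U_ball[OF c, of "r i" \<delta> "p i"] sph_pre_empty[OF c \<delta>(1), where 'n = 'n] by simp
      qed
      finally show ?thesis .
    qed
    have "A \<subseteq> (\<Union>i\<in>I. U_ball (p i) (r i))"
    proof
      fix x assume x: "x \<in> A"
      then obtain i where "x \<in> U_ball (p i) (r i)" using cov by blast
      then show "x \<in> (\<Union>i\<in>I. U_ball (p i) (r i))" using x unfolding I_def by blast
    qed
    moreover have "B \<subseteq> (\<Union>i\<in>-I. U_ball (p i) (r i))"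
    proof
      fix y assume y: "y \<in> B"
      then obtain i where i: "y \<in> U_ball (p i) (r i)" using cov by blast
      have "i \<notin> I"
      proof
        assume "i \<in> I"
        then obtain x where x: "x \<in> A" "x \<in> U_ball (p i) (r i)" by (auto simp: I_def)
        have "box_norm (- x \<star> y) \<le> box_norm (- x \<star> p i) + box_norm (- p i \<star> y)"
          by (rule box_norm_dist_triangle)
        also have "\<dots> < r i + r i"
          using x(2) i box_norm_dist_commute[of x "p i"] unfolding U_ball_iff by simp
        also have "\<dots> < d" using r \<delta> by (metis (no_types) field_sum_of_halves add_strict_mono less_le_trans)
        finally show False using d(2)[OF x(1) y] by simp
      qed
      then show "y \<in> (\<Union>i\<in>-I. U_ball (p i) (r i))" using i by blast
    qed
    ultimately have "sph_pre c \<delta> A + sph_pre c \<delta> B \<le>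
        (\<Sum>i. if i \<in> I then ennreal (c * r i ^ ?N) else 0) + (\<Sum>i. if i \<in> - I then ennreal (c * r i ^ ?N) else 0)"
      by (intro add_mono part)
    also have "\<dots> = (\<Sum>i. (if i \<in> I then ennreal (c * r i ^ ?N) else 0) + (if i \<in> - I then ennreal (c * r i ^ ?N) else 0))"
      by (rule suminf_add) auto
    also have "\<dots> = (\<Sum>i. ennreal (c * r i ^ ?N))" by (intro suminf_cong) auto
    finally show "sph_pre c \<delta> A + sph_pre c \<delta> B \<le> (\<Sum>i. ennreal (c * r i ^ ?N))" .
  qed
  have "sph_pre c \<delta>1 A + sph_pre c \<delta>2 B \<le> sph_outer c (A \<union> B)" if "\<delta>1 > 0" "\<delta>2 > 0" for \<delta>1 \<delta>2
  proof -
    define \<delta> where "\<delta> = min (d / 2) (min \<delta>1 \<delta>2)"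
    have \<delta>: "0 < \<delta>" "\<delta> \<le> d / 2" "\<delta> \<le> \<delta>1" "\<delta> \<le> \<delta>2" using that d(1) by (auto simp: \<delta>_def)
    have "sph_pre c \<delta>1 A + sph_pre c \<delta>2 B \<le> sph_pre c \<delta> A + sph_pre c \<delta> B"
      using \<delta> by (intro add_mono mono)
    also have "\<dots> \<le> sph_outer c (A \<union> B)"
      using pre[OF \<delta>(1,2)] sph_pre_le_sph_outer[OF \<delta>(1)] order_trans by blast
    finally show ?thesis .
  qed
  note le = this
  have "sph_pre c \<delta>1 A + sph_outer c B \<le> sph_outer c (A \<union> B)" if "\<delta>1 > 0" for \<delta>1
    unfolding sph_outer_def[of c B] using le[OF that]
    by (subst ennreal_SUP_add_right) (auto intro!: SUP_least)
  then show ?thesis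
    unfolding sph_outer_def[of c A]
    by (subst ennreal_SUP_add_left[symmetric]) (auto intro!: SUP_least)
qed

lemma sph_outer_Un: "c > 0 \<Longrightarrow> sph_outer c (A \<union> B) \<le> sph_outer c A + sph_outer c (B :: 'n::finite heis set)"
proof -
  assume c: "c > 0"
  let ?B = "\<lambda>n::nat. if n = 0 then A else if n = 1 then B else {}"
  have "sph_outer c (A \<union> B) \<le> sph_outer c (\<Union>n. ?B n)"
    by (intro sph_outer_mono c) (auto split: if_splits intro: exI[of _ 0] exI[of _ 1])
  also have "\<dots> \<le> (\<Sum>n. sph_outer c (?B n))" by (rule sph_outer_UN_le)
  also have "\<dots> = (\<Sum>n\<in>{0, 1}. sph_outer c (?B n))"
    using sph_outer_empty[OF c, where 'n = 'n] by (intro suminf_finite) auto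
  finally show ?thesis by simp
qed

lemma ennreal_suminf_tail:
  fixes a :: "nat \<Rightarrow> ennreal"
  assumes "(\<Sum>j. a j) < \<infinity>" "e > 0"
  obtains k where "(\<Sum>j. a (j + k)) < ennreal e"
proof -
  have fin: "a j < top" for j
    using assms(1) by (auto simp: less_top dest!: ennreal_suminf_lessD)
  define b where "b j = enn2real (a j)" for j
  have ab: "a j = ennreal (b j)" for j using fin[of j] by (simp add: b_def)
  have b0: "b j \<ge> 0" for j by (simp add: b_def)
  have sb: "summable b"
    using assms(1) b0 unfolding ab by (intro summable_suminf_not_top) auto
  obtain N where N: "\<And>n. n \<ge> N \<Longrightarrow> norm (\<Sum>i. b (i + n)) < e"
    using suminf_exist_split[OF assms(2) sb] by blast
  have "(\<Sum>j. a (j + N)) = ennreal (\<Sum>i. b (i + N))"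
    unfolding ab using b0 sb by (intro suminf_ennreal2) (auto simp: summable_iff_shift)
  also have "\<dots> < ennreal e" using N[of N] by (intro ennreal_lessI) (auto simp: assms(2))
  finally show ?thesis using that by blast
qed

text \<open>Caratheodory's argument for metric outer measures. \<open>G k\<close> consists of the
  points of \<open>E\<close> at distance at least 1/(k+1) from \<open>F\<close>, and
  \<open>R k\<close> are the layers between consecutive sets. Layers with indices differing by at
  least 2 are separated, so the contents of all layers have a finite sum; its tail bounds what
  \<open>G k\<close> misses of \<open>E - F\<close>.\<close>

lemma sph_outer_closed_caratheodory:
  fixes F E :: "'n::finite heis set"
  assumes c: "c > 0" and F: "closed F"
  shows "sph_outer c (E \<inter> F) + sph_outer c (E - F) \<le> sph_outer c E"
proof (cases "sph_outer c E = \<infinity>")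
  case False
  then have fin: "sph_outer c E < \<infinity>" by (simp add: less_top)
  define G where "G k = {x \<in> E - F. \<forall>p\<in>F. box_norm (- p \<star> x) \<ge> 1 / (real k + 1)}" for k
  define R where "R k = G (Suc k) - G k" for k
  have Gmono: "G j \<subseteq> G k" if "j \<le> k" for j k
  proof -
    have "1 / (real k + 1) \<le> 1 / (real j + 1)" using that by (simp add: field_simps)
    then show ?thesis unfolding G_def by force
  qed
  have GE: "G k \<subseteq> E" "R k \<subseteq> E" for k by (auto simp: G_def R_def)
  have GU: "E - F \<subseteq> (\<Union>k. G k)"
  proof
    fix x assume x: "x \<in> E - F"
    obtain r where r: "r > 0" "U_ball x r \<subseteq> - F"
      using U_ball_mem_ball[of "- F" x] F x by auto
    obtain k where k: "inverse (real (Suc k)) < r" using reals_Archimedean[OF r(1)] by blast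
    have "box_norm (- p \<star> x) \<ge> 1 / (real k + 1)" if "p \<in> F" for p
    proof -
      have "p \<notin> U_ball x r" using r(2) that by blast
      then have "box_norm (- p \<star> x) \<ge> r" unfolding U_ball_iff box_norm_dist_commute[of x p] by simp
      then show ?thesis using k by (simp add: inverse_eq_divide add.commute)
    qed
    then have "x \<in> G k" using x by (simp add: G_def)
    then show "x \<in> (\<Union>k. G k)" by blast
  qed
  have Rfar: "box_norm (- x \<star> y) \<ge> 1 / (real i + 2) - 1 / (real i + 3)"
    if x: "x \<in> R j" and y: "y \<in> G (Suc i)" and ij: "i + 2 \<le> j" for x y i j
  proof -
    have "x \<notin> G j" "x \<in> E - F" using x by (auto simp: R_def G_def)
    then obtain p where p: "p \<in> F" "box_norm (- p \<star> x) < 1 / (real j + 1)" by (auto simp: G_def not_le)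
    have "1 / (real j + 1) \<le> 1 / (real i + 3)" using ij by (simp add: field_simps)
    moreover have "box_norm (- p \<star> y) \<ge> 1 / (real i + 2)"
      using y p(1) by (auto simp: G_def add.commute)
    ultimately show ?thesis using p(2) box_norm_dist_triangle[of p y x] by linarith
  qed
  have pos: "1 / (real i + 2) - 1 / (real i + 3) > 0" for i :: nat
    using frac_less2[of 1 1 "real i + 2" "real i + 3"] by simp
  \<comment> \<open>With m = 0 and m = 1 these are the even and the odd layers, within each of which
    additivity over separated sets applies.\<close>
  have alt: "(\<Sum>j<n. sph_outer c (R (2 * j + m))) \<le> sph_outer c (\<Union>j<n. R (2 * j + m))" for n m
  proof (induction n)
    case (Suc n)
    have "(\<Sum>j<Suc n. sph_outer c (R (2 * j + m)))
        \<le> sph_outer c (R (2 * n + m)) + sph_outer c (\<Union>j<n. R (2 * j + m))"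
      using Suc by (simp add: add.commute add_left_mono)
    also have "\<dots> \<le> sph_outer c (R (2 * n + m) \<union> (\<Union>j<n. R (2 * j + m)))"
    proof (cases n)
      case 0
      then show ?thesis using sph_outer_empty[OF c, where 'n = 'n] by simp
    next
      case (Suc n')
      show ?thesis
      proof (rule sph_outer_separated[OF c pos[of "2 * n' + m"]])
        fix x y assume x: "x \<in> R (2 * n + m)" and "y \<in> (\<Union>j<n. R (2 * j + m))"
        then obtain j where j: "j < n" "y \<in> R (2 * j + m)" by blast
        have "y \<in> G (Suc (2 * j + m))" using j(2) by (simp add: R_def)
        then have "y \<in> G (Suc (2 * n' + m))" using Gmono[of "Suc (2 * j + m)" "Suc (2 * n' + m)"] j(1) Suc by auto
        then show "1 / (real (2 * n' + m) + 2) - 1 / (real (2 * n' + m) + 3) \<le> box_norm (- x \<star> y)"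
          using Rfar[OF x, of y "2 * n' + m"] Suc by simp
      qed
    qed
    also have "R (2 * n + m) \<union> (\<Union>j<n. R (2 * j + m)) = (\<Union>j<Suc n. R (2 * j + m))"
      by (auto simp: less_Suc_eq)
    finally show ?case .
  qed simp
  have half: "(\<Sum>j<n. sph_outer c (R (2 * j + m))) \<le> sph_outer c E" for n m
  proof -
    have "(\<Union>j<n. R (2 * j + m)) \<subseteq> E" using GE(2) by blast
    then show ?thesis using alt[of m n] sph_outer_mono[OF c] order_trans by blast
  qed
  have total: "(\<Sum>j. sph_outer c (R j)) \<le> sph_outer c E + sph_outer c E"
  proof (rule suminf_le_const)
    fix n
    have "(\<Sum>j<n. sph_outer c (R j)) \<le> (\<Sum>j<2 * n. sph_outer c (R j))"
      by (intro sum_mono2) auto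
    also have "\<dots> = (\<Sum>j<n. sph_outer c (R (2 * j + 0))) + (\<Sum>j<n. sph_outer c (R (2 * j + 1)))"
      by (induction n) (simp_all add: algebra_simps)
    also have "\<dots> \<le> sph_outer c E + sph_outer c E"
      by (intro add_mono half)
    finally show "(\<Sum>j<n. sph_outer c (R j)) \<le> sph_outer c E + sph_outer c E" .
  qed simp
  then have tot: "(\<Sum>j. sph_outer c (R j)) < \<infinity>" using fin by (auto simp: less_top[symmetric] top_unique dest: order_le_less_trans)
  show ?thesis
  proof (rule ennreal_le_epsilon)
    fix e :: real assume e: "0 < e"
    obtain k where k: "(\<Sum>j. sph_outer c (R (j + k))) < ennreal e"
      using ennreal_suminf_tail[OF tot e] by blast
    have "E - F \<subseteq> G k \<union> (\<Union>j. R (j + k))"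
    proof
      fix x assume x: "x \<in> E - F"
      define m where "m = (LEAST m. x \<in> G m)"
      have m: "x \<in> G m" "\<And>j. j < m \<Longrightarrow> x \<notin> G j"
        using GU x unfolding m_def by (auto intro: LeastI dest: not_less_Least)
      show "x \<in> G k \<union> (\<Union>j. R (j + k))"
      proof (cases "m \<le> k")
        case True
        then show ?thesis using Gmono m by blast
      next
        case False
        then have "x \<in> R (m - 1)" using m by (auto simp: R_def)
        then have "x \<in> R ((m - 1 - k) + k)" using False by simp
        then show ?thesis by blast
      qed
    qed
    then have "sph_outer c (E - F) \<le> sph_outer c (G k \<union> (\<Union>j. R (j + k)))" by (rule sph_outer_mono[OF c])
    also have "\<dots> \<le> sph_outer c (G k) + sph_outer c (\<Union>j. R (j + k))" by (rule sph_outer_Un[OF c])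
    also have "\<dots> \<le> sph_outer c (G k) + ennreal e"
      using sph_outer_UN_le[of c "\<lambda>j. R (j + k)"] k by (intro add_left_mono) auto
    finally have "sph_outer c (E \<inter> F) + sph_outer c (E - F) \<le> (sph_outer c (E \<inter> F) + sph_outer c (G k)) + ennreal e"
      by (simp add: add.assoc add_left_mono)
    also have "sph_outer c (E \<inter> F) + sph_outer c (G k) \<le> sph_outer c ((E \<inter> F) \<union> G k)"
      by (rule sph_outer_separated[OF c, of "1 / (real k + 1)"]) (auto simp: G_def)
    also have "\<dots> \<le> sph_outer c E" using GE by (intro sph_outer_mono c) auto
    finally show "sph_outer c (E \<inter> F) + sph_outer c (E - F) \<le> sph_outer c E + ennreal e" by (simp add: add_right_mono)
  qed
qed simp

lemma sets_borel_le_sph_measure: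
  assumes c: "c > 0"
  shows "sets borel \<subseteq> sets (sph_measure c :: 'n::finite heis measure)"
proof -
  have "closed F \<Longrightarrow> F \<in> sets (sph_measure c)" for F :: "'n heis set"
    unfolding sets_sph_measure[OF c] lambda_system_def
  proof (intro CollectI conjI ballI)
    fix E :: "'n heis set" assume F: "closed F"
    have "sph_outer c E \<le> sph_outer c ((F \<inter> E) \<union> ((UNIV - F) \<inter> E))" by (intro sph_outer_mono c) auto
    also have "\<dots> \<le> sph_outer c (F \<inter> E) + sph_outer c ((UNIV - F) \<inter> E)" by (rule sph_outer_Un[OF c])
    finally have "sph_outer c E \<le> sph_outer c (F \<inter> E) + sph_outer c ((UNIV - F) \<inter> E)" .
    moreover have "F \<inter> E = E \<inter> F" "(UNIV - F) \<inter> E = E - F" by auto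
    ultimately show "sph_outer c (F \<inter> E) + sph_outer c ((UNIV - F) \<inter> E) = sph_outer c E"
      using sph_outer_closed_caratheodory[OF c F, of E] by auto
  qed auto
  moreover have "space (sph_measure c :: 'n heis measure) = UNIV"
    by (simp add: sph_measure_def space_measure_of_conv)
  ultimately show ?thesis
    unfolding borel_eq_closed using sets.sigma_sets_subset[of "Collect closed" "sph_measure c :: 'n heis measure"]
    by (auto simp: sets_measure_of)
qed

lemma sph_outer_null_sets:
  fixes A :: "'n::finite heis set"
  assumes c: "c > 0" and A: "sph_outer c A = 0"
  shows "A \<in> null_sets (sph_measure c)"
proof -
  have "A \<in> sets (sph_measure c)"
    unfolding sets_sph_measure[OF c] lambda_system_def
  proof (intro CollectI conjI ballI)
    fix E :: "'n heis set"
    have "sph_outer c (A \<inter> E) \<le> 0" using sph_outer_mono[OF c, of "A \<inter> E" A] A by auto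
    moreover have "sph_outer c ((UNIV - A) \<inter> E) \<le> sph_outer c E" by (intro sph_outer_mono c) auto
    moreover have "sph_outer c E \<le> sph_outer c (A \<union> ((UNIV - A) \<inter> E))" by (intro sph_outer_mono c) auto
    moreover have "\<dots> \<le> sph_outer c A + sph_outer c ((UNIV - A) \<inter> E)" by (rule sph_outer_Un[OF c])
    ultimately show "sph_outer c (A \<inter> E) + sph_outer c ((UNIV - A) \<inter> E) = sph_outer c E" using A by auto
  qed auto
  then show ?thesis using A emeasure_sph_measure[OF c, of A] by (simp add: null_sets_def)
qed

text \<open>Covers consist of open balls, so each scale 1/(k+1) gives an open superset whose content
  at that scale is almost optimal; the intersection of these supersets has the same outer
  measure.\<close>

lemma sph_outer_borel_hull:
  fixes E :: "'n::finite heis set"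
  assumes c: "c > 0" and fin: "sph_outer c E < \<infinity>"
  obtains B where "B \<in> sets borel" "E \<subseteq> B" "sph_outer c B = sph_outer c E"
proof -
  let ?N = "2 * CARD('n) + 1"
  have "\<exists>G. open G \<and> E \<subseteq> G \<and> sph_pre c \<delta> G \<le> sph_outer c E + ennreal \<delta>" if \<delta>: "\<delta> > 0" for \<delta>
  proof -
    have "sph_pre c \<delta> E < sph_outer c E + ennreal \<delta>"
      using sph_pre_le_sph_outer[OF \<delta>, of c E] fin \<delta>
      by (metis add.right_neutral ennreal_add_left_cancel_less ennreal_less_zero_iff infinity_ennreal_def less_top order_le_less_trans)
    then obtain p :: "nat \<Rightarrow> 'n heis" and r where pr: "\<forall>i. 0 < r i \<and> r i < \<delta>" "E \<subseteq> (\<Union>i. U_ball (p i) (r i))"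
        "(\<Sum>i. ennreal (c * r i ^ ?N)) < sph_outer c E + ennreal \<delta>"
      unfolding sph_pre_def INF_less_iff by auto
    have "sph_pre c \<delta> (\<Union>i. U_ball (p i) (r i)) \<le> (\<Sum>i. ennreal (c * r i ^ ?N))"
      unfolding sph_pre_def by (rule INF_lower2[of "(p, r)"]) (use pr(1) in auto)
    moreover have "open (\<Union>i. U_ball (p i) (r i))" by (intro open_UN ballI open_U_ball)
    ultimately show ?thesis using pr(2,3) by (meson less_imp_le order_trans)
  qed
  then have "\<exists>G. \<forall>k::nat. open (G k) \<and> E \<subseteq> G k \<and> sph_pre c (1 / (real k + 1)) (G k) \<le> sph_outer c E + ennreal (1 / (real k + 1))"
    by (intro choice allI) simp
  then obtain G where G: "\<And>k::nat. open (G k)" "\<And>k. E \<subseteq> G k"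
    "\<And>k. sph_pre c (1 / (real k + 1)) (G k) \<le> sph_outer c E + ennreal (1 / (real k + 1))" by blast
  let ?B = "\<Inter>k. G k"
  have "sph_outer c ?B \<le> sph_outer c E"
    unfolding sph_outer_def[of c ?B]
  proof (rule SUP_least)
    fix \<delta> :: real assume "\<delta> \<in> {0<..}"
    then have \<delta>: "\<delta> > 0" by simp
    show "sph_pre c \<delta> ?B \<le> sph_outer c E"
    proof (rule ennreal_le_epsilon)
      fix e :: real assume e: "0 < e"
      obtain k where k: "inverse (real (Suc k)) < min \<delta> e" using reals_Archimedean[of "min \<delta> e"] \<delta> e by auto
      have k: "1 / (real k + 1) \<le> \<delta>" "1 / (real k + 1) \<le> e"
        using k by (auto simp: inverse_eq_divide add.commute)
      have "sph_pre c \<delta> ?B \<le> sph_pre c \<delta> (G k)" by (intro sph_pre_mono) auto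
      also have "\<dots> \<le> sph_pre c (1 / (real k + 1)) (G k)"
        unfolding sph_pre_def using k(1) by (intro INF_superset_mono) (auto intro: order.strict_trans2)
      also have "\<dots> \<le> sph_outer c E + ennreal (1 / (real k + 1))" by (rule G)
      also have "\<dots> \<le> sph_outer c E + ennreal e" using k(2) by (intro add_left_mono ennreal_leI)
      finally show "sph_pre c \<delta> ?B \<le> sph_outer c E + ennreal e" .
    qed
  qed
  moreover have "E \<subseteq> ?B" using G(2) by blast
  then have "sph_outer c E \<le> sph_outer c ?B" by (rule sph_outer_mono[OF c])
  moreover have "?B \<in> sets borel" using G(1) by (intro sets.countable_INT) (auto simp: borel_open)
  ultimately show ?thesis using that[of ?B] \<open>E \<subseteq> ?B\<close> by auto
qed

subsection \<open>Uniqueness of the horizontal normal\<close>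

text \<open>The two flows do not commute, so the expansion follows them one after the other. On each
  leg the mean value theorem compares \<open>F\<close> with its value at \<open>p\<close>.\<close>

lemma hgrad_on_two_step:
  fixes f :: "'n::finite heis \<Rightarrow> real"
  assumes f: "hgrad_on U f F" and p: "p \<in> U" and e: "e1 \<in> Basis" "e2 \<in> Basis" and \<epsilon>: "\<epsilon> > 0"
  shows "\<exists>t>0. \<forall>h s. \<bar>h\<bar> \<le> t \<longrightarrow> \<bar>s\<bar> \<le> t \<longrightarrow> hflow e1 s (hflow e2 h p) \<in> U \<and>
      \<bar>f (hflow e1 s (hflow e2 h p)) - f p - (h * (F p \<bullet> e2) + s * (F p \<bullet> e1))\<bar> \<le> \<epsilon> * (\<bar>h\<bar> + \<bar>s\<bar>)"
proof -
  have U: "open U" and cF: "continuous_on U F"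
    and d: "\<And>q e. q \<in> U \<Longrightarrow> e \<in> Basis \<Longrightarrow> has_hderiv f e (F q \<bullet> e) q"
    using f by (auto simp: hgrad_on_def)
  define V where "V = U \<inter> F -` ball (F p) \<epsilon>"
  have V: "open V" "p \<in> V" unfolding V_def using U cF p \<epsilon> by (auto intro!: continuous_open_preimage)
  obtain r1 t1 where 1: "r1 > 0" "t1 > 0" "\<And>s q. \<bar>s\<bar> \<le> t1 \<Longrightarrow> q \<in> ball p r1 \<Longrightarrow> hflow e1 s q \<in> V"
    using hflow_near[OF V, of e1] by metis
  have "p \<in> ball p r1" using 1(1) by simp
  then obtain r2 t2 where 2: "r2 > 0" "t2 > 0" "\<And>s q. \<bar>s\<bar> \<le> t2 \<Longrightarrow> q \<in> ball p r2 \<Longrightarrow> hflow e2 s q \<in> ball p r1"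
    using hflow_near[of "ball p r1" p e2] by (metis open_ball)
  have along: "\<bar>f (hflow e x q) - f q - x * (F p \<bullet> e)\<bar> \<le> \<epsilon> * \<bar>x\<bar>"
    if e: "e \<in> Basis" and q: "\<And>y. \<bar>y\<bar> \<le> \<bar>x\<bar> \<Longrightarrow> hflow e y q \<in> V" for e x q
  proof -
    have "norm ((f (hflow e x q) - x * (F p \<bullet> e)) - (f (hflow e 0 q) - 0 * (F p \<bullet> e))) \<le> \<epsilon> * norm (x - 0)"
    proof (rule field_differentiable_bound[of "{-\<bar>x\<bar>..\<bar>x\<bar>}" "\<lambda>y. f (hflow e y q) - y * (F p \<bullet> e)"
          "\<lambda>y. F (hflow e y q) \<bullet> e - F p \<bullet> e"])
      fix y assume "y \<in> {-\<bar>x\<bar>..\<bar>x\<bar>}"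
      then have y: "hflow e y q \<in> V" by (intro q) auto
      have "((\<lambda>y. f (hflow e y q)) has_field_derivative F (hflow e y q) \<bullet> e) (at y)"
        using y e by (intro has_hderiv_at d) (auto simp: V_def)
      moreover have "((\<lambda>y. y * (F p \<bullet> e)) has_field_derivative F p \<bullet> e) (at y)"
        by (auto intro!: derivative_eq_intros)
      ultimately show "((\<lambda>y. f (hflow e y q) - y * (F p \<bullet> e)) has_field_derivative
          F (hflow e y q) \<bullet> e - F p \<bullet> e) (at y within {-\<bar>x\<bar>..\<bar>x\<bar>})"
        by (rule has_field_derivative_at_within[OF DERIV_diff])
      have "\<bar>(F (hflow e y q) - F p) \<bullet> e\<bar> \<le> norm (F (hflow e y q) - F p)" by (rule Basis_le_norm[OF e])
      also have "\<dots> \<le> \<epsilon>" using y by (simp add: V_def dist_norm norm_minus_commute)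
      finally show "norm (F (hflow e y q) \<bullet> e - F p \<bullet> e) \<le> \<epsilon>" by (simp add: inner_diff_left)
    qed auto
    then show ?thesis by simp
  qed
  show ?thesis
  proof (intro exI[of _ "min t1 t2"] conjI[of "0 < _"] allI impI)
    fix h s :: real assume hs: "\<bar>h\<bar> \<le> min t1 t2" "\<bar>s\<bar> \<le> min t1 t2"
    have near: "hflow e2 y p \<in> ball p r1" if "\<bar>y\<bar> \<le> \<bar>h\<bar>" for y using 2(1) 2(3)[of y p] that hs by simp
    have near': "hflow e2 y p \<in> V" if "\<bar>y\<bar> \<le> \<bar>h\<bar>" for y using 1(2) 1(3)[of 0, OF _ near[OF that]] by simp
    have near1: "hflow e1 y (hflow e2 h p) \<in> V" if "\<bar>y\<bar> \<le> \<bar>s\<bar>" for y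
      using 1(3)[of y, OF _ near[of h]] that hs by simp
    have "\<bar>f (hflow e2 h p) - f p - h * (F p \<bullet> e2)\<bar> \<le> \<epsilon> * \<bar>h\<bar>" by (rule along[OF e(2) near'])
    moreover have "\<bar>f (hflow e1 s (hflow e2 h p)) - f (hflow e2 h p) - s * (F p \<bullet> e1)\<bar> \<le> \<epsilon> * \<bar>s\<bar>"
      by (rule along[OF e(1) near1])
    moreover have "hflow e1 s (hflow e2 h p) \<in> U" using near1[of s] by (simp add: V_def)
    ultimately show "hflow e1 s (hflow e2 h p) \<in> U \<and>
      \<bar>f (hflow e1 s (hflow e2 h p)) - f p - (h * (F p \<bullet> e2) + s * (F p \<bullet> e1))\<bar> \<le> \<epsilon> * (\<bar>h\<bar> + \<bar>s\<bar>)"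
      unfolding distrib_left by linarith
  qed (use 1 2 in auto)
qed

text \<open>Otherwise some curve through \<open>p\<close> in the zero set of \<open>f\<close> is transversal to that of \<open>g\<close>.\<close>

lemma hgrad_on_same_zeros:
  fixes f g :: "'n::finite heis \<Rightarrow> real"
  assumes f: "hgrad_on U f F" and g: "hgrad_on U g G" and p: "p \<in> U" "f p = 0"
    and zeros: "\<And>q. q \<in> U \<Longrightarrow> f q = 0 \<longleftrightarrow> g q = 0" and nz: "F p \<noteq> 0"
  shows "\<exists>c. G p = c *\<^sub>R F p"
proof -
  obtain e1 where e1: "e1 \<in> Basis" "F p \<bullet> e1 \<noteq> 0" using nz euclidean_all_zero_iff by blast
  define a where "a = F p \<bullet> e1"
  define a' where "a' = G p \<bullet> e1"
  have "G p \<bullet> e2 = ((a' / a) *\<^sub>R F p) \<bullet> e2" if e2: "e2 \<in> Basis" for e2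
  proof (rule ccontr)
    assume ne: "G p \<bullet> e2 \<noteq> ((a' / a) *\<^sub>R F p) \<bullet> e2"
    define b where "b = F p \<bullet> e2"
    define b' where "b' = G p \<bullet> e2"
    \<comment> \<open>To first order \<open>f\<close> does not change in the direction e2 + k e1,
      whereas \<open>g\<close> changes there at rate \<Delta>.\<close>
    define k where "k = - b / a"
    define \<Delta> where "\<Delta> = b' + k * a'"
    have a: "a \<noteq> 0" using e1 by (simp add: a_def)
    have \<Delta>: "\<bar>\<Delta>\<bar> > 0" using ne a by (simp add: \<Delta>_def k_def b_def b'_def mult.commute)
    \<comment> \<open>Slack for perturbing k: as long as |\<tau>| \<le> \<theta>, the term
      \<open>\<tau> * a'\<close> absorbs at most half of \<Delta>.\<close>
    define \<theta> where "\<theta> = min 1 (\<bar>\<Delta>\<bar> / (2 * (\<bar>a'\<bar> + 1)))"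
    have \<theta>: "0 < \<theta>" "\<theta> \<le> 1" using \<Delta> by (auto simp: \<theta>_def)
    have "\<theta> * \<bar>a'\<bar> \<le> \<bar>\<Delta>\<bar> / (2 * (\<bar>a'\<bar> + 1)) * (\<bar>a'\<bar> + 1)"
      using \<Delta> by (intro mult_mono) (auto simp: \<theta>_def)
    also have "\<dots> = \<bar>\<Delta>\<bar> / 2" by (simp add: field_simps)
    finally have \<theta>a: "\<theta> * \<bar>a'\<bar> \<le> \<bar>\<Delta>\<bar> / 2" .
    \<comment> \<open>The two legs have total length at most (2 + |k|) h. The error in
      \<open>f\<close> then stays below the effect of a perturbation by \<theta>, and the error in
      \<open>g\<close> below a quarter of \<Delta>.\<close>
    define \<epsilon> where "\<epsilon> = min (\<bar>a\<bar> * \<theta>) (\<bar>\<Delta>\<bar> / 4) / (2 + \<bar>k\<bar>)"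
    have \<epsilon>: "\<epsilon> > 0" using a \<theta> \<Delta> by (simp add: \<epsilon>_def)
    have "\<epsilon> * (2 + \<bar>k\<bar>) = min (\<bar>a\<bar> * \<theta>) (\<bar>\<Delta>\<bar> / 4)" by (simp add: \<epsilon>_def)
    then have \<epsilon>k: "\<epsilon> * (2 + \<bar>k\<bar>) \<le> \<bar>a\<bar> * \<theta>" "\<epsilon> * (2 + \<bar>k\<bar>) \<le> \<bar>\<Delta>\<bar> / 4" by auto
    obtain t1 where t1: "t1 > 0" "\<And>h s. \<bar>h\<bar> \<le> t1 \<Longrightarrow> \<bar>s\<bar> \<le> t1 \<Longrightarrow> hflow e1 s (hflow e2 h p) \<in> U \<and>
      \<bar>f (hflow e1 s (hflow e2 h p)) - f p - (h * b + s * a)\<bar> \<le> \<epsilon> * (\<bar>h\<bar> + \<bar>s\<bar>)"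
      unfolding a_def b_def using hgrad_on_two_step[OF f p(1) e1(1) e2 \<epsilon>] by blast
    obtain t2 where t2: "t2 > 0" "\<And>h s. \<bar>h\<bar> \<le> t2 \<Longrightarrow> \<bar>s\<bar> \<le> t2 \<Longrightarrow> hflow e1 s (hflow e2 h p) \<in> U \<and>
      \<bar>g (hflow e1 s (hflow e2 h p)) - g p - (h * b' + s * a')\<bar> \<le> \<epsilon> * (\<bar>h\<bar> + \<bar>s\<bar>)"
      unfolding a'_def b'_def using hgrad_on_two_step[OF g p(1) e1(1) e2 \<epsilon>] by blast
    define h where "h = min t1 t2 / (2 + \<bar>k\<bar>)"
    have h: "h > 0" "h * (2 + \<bar>k\<bar>) = min t1 t2" using t1(1) t2(1) by (auto simp: h_def)
    have small: "\<bar>h\<bar> \<le> t1 \<and> \<bar>h\<bar> \<le> t2 \<and> \<bar>(k + \<tau>) * h\<bar> \<le> t1 \<and> \<bar>(k + \<tau>) * h\<bar> \<le> t2 \<and>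
        \<epsilon> * (\<bar>h\<bar> + \<bar>(k + \<tau>) * h\<bar>) \<le> \<epsilon> * (2 + \<bar>k\<bar>) * h" if "\<bar>\<tau>\<bar> \<le> \<theta>" for \<tau>
    proof -
      have "\<bar>k + \<tau>\<bar> \<le> 1 + \<bar>k\<bar>" using that \<theta>(2) by linarith
      then have 1: "\<bar>(k + \<tau>) * h\<bar> \<le> (1 + \<bar>k\<bar>) * h" using h(1) by (simp add: abs_mult mult_right_mono)
      have 2: "\<bar>h\<bar> + (1 + \<bar>k\<bar>) * h = h * (2 + \<bar>k\<bar>)" using h(1) by (simp add: algebra_simps)
      have 3: "0 \<le> (1 + \<bar>k\<bar>) * h" using h(1) by simp
      have "\<epsilon> * (\<bar>h\<bar> + \<bar>(k + \<tau>) * h\<bar>) \<le> \<epsilon> * (h * (2 + \<bar>k\<bar>))"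
        using 1 2 \<epsilon> by (intro mult_left_mono) linarith+
      moreover have "\<epsilon> * (h * (2 + \<bar>k\<bar>)) = \<epsilon> * (2 + \<bar>k\<bar>) * h" by simp
      moreover have "(1 + \<bar>k\<bar>) * h \<le> min t1 t2" using 2 h(1) unfolding h(2) by (simp del: min.bounded_iff)
      then have "\<bar>(k + \<tau>) * h\<bar> \<le> min t1 t2" using 1 by (rule order_trans[rotated])
      moreover have "\<bar>h\<bar> \<le> min t1 t2" using 2 3 unfolding h(2) by (simp del: min.bounded_iff)
      ultimately show ?thesis by (simp only: min.bounded_iff)
    qed
    let ?q = "\<lambda>\<tau>. hflow e1 ((k + \<tau>) * h) (hflow e2 h p)"
    have fq: "\<bar>f (?q \<tau>) - \<tau> * a * h\<bar> \<le> \<bar>a\<bar> * \<theta> * h" and gq: "\<bar>g (?q \<tau>) - (\<Delta> + \<tau> * a') * h\<bar> \<le> \<bar>\<Delta>\<bar> / 4 * h"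
      and qU: "?q \<tau> \<in> U" if "\<bar>\<tau>\<bar> \<le> \<theta>" for \<tau>
    proof -
      note s = small[OF that]
      have eq: "h * b + (k + \<tau>) * h * a = \<tau> * a * h" "h * b' + (k + \<tau>) * h * a' = (\<Delta> + \<tau> * a') * h"
        using a by (simp_all add: k_def \<Delta>_def field_simps)
      have gp: "g p = 0" using zeros[OF p(1)] p(2) by simp
      have 1: "\<bar>f (?q \<tau>) - \<tau> * a * h\<bar> \<le> \<epsilon> * (\<bar>h\<bar> + \<bar>(k + \<tau>) * h\<bar>)"
        using t1(2)[of h "(k + \<tau>) * h"] s p(2) unfolding eq by simp
      have 2: "\<bar>g (?q \<tau>) - (\<Delta> + \<tau> * a') * h\<bar> \<le> \<epsilon> * (\<bar>h\<bar> + \<bar>(k + \<tau>) * h\<bar>)"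
        using t2(2)[of h "(k + \<tau>) * h"] s gp unfolding eq by simp
      have 3: "\<epsilon> * (2 + \<bar>k\<bar>) * h \<le> \<bar>a\<bar> * \<theta> * h" "\<epsilon> * (2 + \<bar>k\<bar>) * h \<le> \<bar>\<Delta>\<bar> / 4 * h"
        using mult_right_mono[OF \<epsilon>k(1) less_imp_le[OF h(1)]] mult_right_mono[OF \<epsilon>k(2) less_imp_le[OF h(1)]] .
      show "\<bar>f (?q \<tau>) - \<tau> * a * h\<bar> \<le> \<bar>a\<bar> * \<theta> * h" using 1 3 s by linarith
      show "\<bar>g (?q \<tau>) - (\<Delta> + \<tau> * a') * h\<bar> \<le> \<bar>\<Delta>\<bar> / 4 * h" using 2 3 s by linarith
      show "?q \<tau> \<in> U" using t1(2)[of h "(k + \<tau>) * h"] s by blast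
    qed
    let ?x = "\<lambda>\<tau>. sgn a * f (?q \<tau>)"
    have sa: "sgn a * a = \<bar>a\<bar>" "\<bar>sgn a\<bar> = 1" using a by (auto simp: sgn_if)
    have sx: "\<bar>?x \<tau> - \<tau> * \<bar>a\<bar> * h\<bar> \<le> \<bar>a\<bar> * \<theta> * h" if "\<bar>\<tau>\<bar> \<le> \<theta>" for \<tau>
    proof -
      have "?x \<tau> - \<tau> * \<bar>a\<bar> * h = sgn a * (f (?q \<tau>) - \<tau> * a * h)"
        unfolding sa(1)[symmetric] by (simp add: algebra_simps)
      then show ?thesis using fq[OF that] sa(2) by (simp add: abs_mult)
    qed
    \<comment> \<open>Up to the sign of a, \<open>f\<close> is nonpositive at -\<theta> and
      nonnegative at \<theta>. At the zero in between \<open>g\<close> would vanish as well,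
      although its rate of change is at least half of |\<Delta>| and its error at most a
      quarter.\<close>
    have "\<exists>\<tau>\<ge>-\<theta>. \<tau> \<le> \<theta> \<and> ?x \<tau> = 0"
    proof (rule IVT')
      show "?x (- \<theta>) \<le> 0" using sx[of "- \<theta>"] \<theta>(1) by (simp add: abs_le_iff mult_ac)
      show "0 \<le> ?x \<theta>" using sx[of \<theta>] \<theta>(1) by (simp add: abs_le_iff mult_ac)
      have cq: "continuous_on {-\<theta>..\<theta>} ?q" by (intro continuous_intros)
      have cf: "continuous_on U f" using f by (simp add: hgrad_on_def)
      have "continuous_on {-\<theta>..\<theta>} (\<lambda>\<tau>. f (?q \<tau>))"
        by (rule continuous_on_compose2[OF cf cq]) (use qU in auto)
      then show "continuous_on {-\<theta>..\<theta>} ?x" by (intro continuous_on_mult continuous_on_const)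
    qed (use \<theta> in auto)
    then obtain \<tau> where "- \<theta> \<le> \<tau>" "\<tau> \<le> \<theta>" "?x \<tau> = 0" by blast
    then have \<tau>: "\<bar>\<tau>\<bar> \<le> \<theta>" "f (?q \<tau>) = 0" using a by (simp_all add: sgn_zero_iff)
    then have "g (?q \<tau>) = 0" using zeros qU by blast
    then have "\<bar>\<Delta> + \<tau> * a'\<bar> * h \<le> \<bar>\<Delta>\<bar> / 4 * h" using gq[OF \<tau>(1)] h(1) by (simp add: abs_mult)
    then have "\<bar>\<Delta> + \<tau> * a'\<bar> \<le> \<bar>\<Delta>\<bar> / 4" using h(1) by simp
    moreover have "\<bar>\<tau> * a'\<bar> \<le> \<bar>\<Delta>\<bar> / 2"
      using \<theta>a mult_right_mono[OF \<tau>(1), of "\<bar>a'\<bar>"] by (simp add: abs_mult)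
    ultimately show False using \<Delta> by linarith
  qed
  then have "G p = (a' / a) *\<^sub>R F p" by (rule euclidean_eqI)
  then show ?thesis by blast
qed

subsection \<open>Disintegration of a finite measure over a real-valued function\<close>

text \<open>Base-4 expansions with digits 0 and 1 determine their digits, so a sequence of bits can be
  decoded from a real number in a Borel measurable way.\<close>

definition bits_real :: "(nat \<Rightarrow> bool) \<Rightarrow> real" where
  "bits_real b = (\<Sum>n. of_bool (b n) * (1/4) ^ Suc n)"

definition real_bit :: "nat \<Rightarrow> real \<Rightarrow> bool" where
  "real_bit n x \<longleftrightarrow> \<lfloor>4 ^ Suc n * x\<rfloor> mod 4 = 1"

lemma bits_real_summable: "summable (\<lambda>n. of_bool (b n) * (1/4) ^ Suc n :: real)"
proof (rule summable_comparison_test'[of "\<lambda>n. (1/4) ^ Suc n" 0])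
  show "summable (\<lambda>n. (1/4) ^ Suc n :: real)"
    unfolding summable_Suc_iff by (rule summable_geometric) simp
qed auto

lemma bits_real_bounds: "0 \<le> bits_real b" "bits_real b \<le> 1/3"
proof -
  have s: "(\<lambda>n. (1/4) ^ Suc n :: real) sums (1/3)"
    using sums_mult[OF geometric_sums[of "1/4::real"], of "1/4"] by simp
  show "0 \<le> bits_real b" unfolding bits_real_def by (intro suminf_nonneg bits_real_summable) auto
  have "bits_real b \<le> (\<Sum>n. (1/4) ^ Suc n)"
    unfolding bits_real_def by (intro suminf_le bits_real_summable) (use s in \<open>auto simp: sums_iff\<close>)
  then show "bits_real b \<le> 1/3" using s by (simp add: sums_iff)
qed

text \<open>Multiplication by \<open>4 ^ Suc n\<close> moves digit n to the units place, after a
  multiple of 4. With digits 0 and 1 the remaining tail is at most 1/3, so no carry can occur; base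
  2 would admit double expansions.\<close>

lemma real_bit_bits_real: "real_bit n (bits_real b) = b n"
proof -
  have shift: "4 ^ Suc n * bits_real b = real_of_int (\<Sum>i<n. of_bool (b i) * 4 ^ (n - i)) + of_bool (b n) + bits_real (\<lambda>i. b (i + Suc n))"
  proof -
    have "bits_real b = (\<Sum>i. of_bool (b (i + Suc n)) * (1/4) ^ Suc (i + Suc n)) + (\<Sum>i<Suc n. of_bool (b i) * (1/4) ^ Suc i)"
      unfolding bits_real_def by (rule suminf_split_initial_segment[OF bits_real_summable])
    also have "(\<Sum>i. of_bool (b (i + Suc n)) * (1/4) ^ Suc (i + Suc n)) = (1/4) ^ Suc n * bits_real (\<lambda>i. b (i + Suc n))"
      unfolding bits_real_def
      by (subst suminf_mult[OF bits_real_summable, symmetric]) (simp add: power_add mult_ac)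
    finally have "4 ^ Suc n * bits_real b = 4 ^ Suc n * ((1/4) ^ Suc n * bits_real (\<lambda>i. b (i + Suc n)))
        + (\<Sum>i<Suc n. 4 ^ Suc n * (of_bool (b i) * (1/4) ^ Suc i))"
      by (simp only: distrib_left sum_distrib_left)
    also have "4 ^ Suc n * ((1/4) ^ Suc n * bits_real (\<lambda>i. b (i + Suc n))) = bits_real (\<lambda>i. b (i + Suc n))"
      by (simp add: power_divide)
    also have "(\<Sum>i<Suc n. 4 ^ Suc n * (of_bool (b i) * (1/4) ^ Suc i)) = (\<Sum>i<Suc n. of_bool (b i) * (4::real) ^ (n - i))"
      by (intro sum.cong refl) (simp add: power_divide power_diff)
    finally show ?thesis by (simp add: of_int_sum)
  qed
  have "even4": "(\<Sum>i<n. of_bool (b i) * 4 ^ (n - i) :: int) mod 4 = 0"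
  proof -
    have "4 dvd (\<Sum>i<n. of_bool (b i) * 4 ^ (n - i) :: int)"
      by (intro dvd_sum dvd_mult dvd_power) auto
    then show ?thesis by simp
  qed
  have "\<lfloor>4 ^ Suc n * bits_real b\<rfloor> = (\<Sum>i<n. of_bool (b i) * 4 ^ (n - i)) + of_bool (b n)"
    unfolding shift using bits_real_bounds[of "\<lambda>i. b (i + Suc n)"] by (intro floor_unique) auto
  then have "\<lfloor>4 ^ Suc n * bits_real b\<rfloor> mod 4 = of_bool (b n)"
    using even4 by (simp add: mod_add_eq[symmetric])
  then show ?thesis by (simp add: real_bit_def)
qed

text \<open>A point is encoded by the answers to the questions whether it lies within 2^-m of the
  k-th point of a dense sequence. It is decoded as the limit over m of dense points chosen by
  positive answers.\<close>

lemma real_embedding: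
  obtains \<iota> :: "'a::euclidean_space \<Rightarrow> real" and g where "\<iota> \<in> borel_measurable borel" "g \<in> borel_measurable borel"
    "\<And>p. g (\<iota> p) = p" "\<And>p. 0 \<le> \<iota> p" "\<And>p. \<iota> p < 1"
proof -
  obtain D :: "'a set" where D: "countable D" "\<And>X. open X \<Longrightarrow> X \<noteq> {} \<Longrightarrow> \<exists>d\<in>D. d \<in> X"
    using countable_dense_setE by blast
  have "D \<noteq> {}" using D(2)[of UNIV] by auto
  define d where "d = from_nat_into D"
  have d: "\<exists>k. dist p (d k) < e" if "e > 0" for p e
  proof -
    have "\<exists>x\<in>D. x \<in> ball p e" using D(2)[of "ball p e"] that by auto
    then show ?thesis using from_nat_into_surj[OF D(1)] unfolding d_def by (metis mem_ball)
  qed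
  define b where "b p n \<longleftrightarrow> dist p (d (fst (prod_decode n))) < (1/2) ^ snd (prod_decode n)" for p n
  define \<iota> where "\<iota> p = bits_real (b p)" for p
  \<comment> \<open>The least index makes the choice of a dense point a Borel function of the
    code.\<close>
  define k where "k m x = (LEAST k. real_bit (prod_encode (k, m)) x)" for m x
  define g where "g x = lim (\<lambda>m. d (k m x))" for x
  have k: "dist p (d (k m (\<iota> p))) < (1/2) ^ m" for p m
  proof -
    have "real_bit (prod_encode (k, m)) (\<iota> p) \<longleftrightarrow> dist p (d k) < (1/2) ^ m" for k
      by (simp add: \<iota>_def real_bit_bits_real b_def)
    then show ?thesis unfolding k_def using LeastI_ex[OF d[of "(1/2) ^ m" p]] by simp
  qed
  have gi: "g (\<iota> p) = p" for p
  proof -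
    have "(\<lambda>m. dist (d (k m (\<iota> p))) p) \<longlonglongrightarrow> 0"
      by (rule tendsto_sandwich[of "\<lambda>_. 0" _ _ "\<lambda>m. (1/2) ^ m"])
        (use k in \<open>auto simp: dist_commute less_imp_le LIMSEQ_realpow_zero\<close>)
    then have "(\<lambda>m. d (k m (\<iota> p))) \<longlonglongrightarrow> p" by (rule tendsto_dist_iff[THEN iffD2])
    then show ?thesis unfolding g_def by (rule limI)
  qed
  have "\<iota> \<in> borel_measurable borel"
    unfolding \<iota>_def bits_real_def b_def by measurable
  moreover have "g \<in> borel_measurable borel"
  proof -
    have [measurable]: "Measurable.pred borel (real_bit n)" for n
      unfolding real_bit_def by measurable
    have [measurable]: "k m \<in> measurable borel (count_space UNIV)" for m
      unfolding k_def by measurable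
    have [measurable]: "d \<in> measurable (count_space UNIV) borel" by simp
    show ?thesis unfolding g_def by measurable
  qed
  moreover have "0 \<le> \<iota> p" "\<iota> p < 1" for p
    using bits_real_bounds[of "b p"] by (simp_all add: \<iota>_def)
  ultimately show ?thesis using gi by (intro that[of \<iota> g])
qed

text \<open>The inequality is tested on the set where it fails; finiteness of the integral of
  \<open>g\<close> makes the integrals over that set strictly ordered if it is not null.\<close>

lemma AE_le_of_nn_integral_le:
  assumes [measurable]: "f \<in> borel_measurable M" "g \<in> borel_measurable M"
    and fin: "(\<integral>\<^sup>+x. g x \<partial>M) < \<infinity>"
    and le: "\<And>T. T \<in> sets M \<Longrightarrow> (\<integral>\<^sup>+x. f x * indicator T x \<partial>M) \<le> (\<integral>\<^sup>+x. g x * indicator T x \<partial>M)"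
  shows "AE x in M. f x \<le> g x"
proof -
  define T where "T = {x \<in> space M. g x < f x}"
  have T[measurable]: "T \<in> sets M" unfolding T_def by measurable
  have "AE x in M. f x * indicator T x \<le> g x * indicator T x"
  proof (rule ccontr)
    assume "\<not> ?thesis"
    moreover have "AE x in M. g x * indicator T x \<le> f x * indicator T x"
      by (rule AE_I2) (auto simp: T_def indicator_def)
    moreover have "(\<integral>\<^sup>+x. g x * indicator T x \<partial>M) \<noteq> \<infinity>"
    proof -
      have "(\<integral>\<^sup>+x. g x * indicator T x \<partial>M) \<le> (\<integral>\<^sup>+x. g x \<partial>M)"
        by (intro nn_integral_mono) (simp add: indicator_def)
      then show ?thesis using fin by auto
    qed
    ultimately have "(\<integral>\<^sup>+x. g x * indicator T x \<partial>M) < (\<integral>\<^sup>+x. f x * indicator T x \<partial>M)"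
      by (intro nn_integral_less) auto
    then show False using le[OF T] by simp
  qed
  then show ?thesis
    by (rule AE_mp) (rule AE_I2, auto simp: T_def indicator_def split: if_splits)
qed

text \<open>With S the supremum, the set lies between (0, S) and (0, S]; whether it contains S
  depends on whether the supremum is attained, which does not affect its length.\<close>

lemma emeasure_lborel_quantile:
  fixes F :: "'q \<Rightarrow> ennreal"
  assumes "\<And>q. q \<in> A \<Longrightarrow> F q \<le> ennreal m" "m \<ge> 0" "B \<in> sets borel"
    and B: "\<And>v. v \<in> B \<longleftrightarrow> 0 < v \<and> v \<le> m \<and> (\<exists>q\<in>A. ennreal v \<le> F q)"
  shows "emeasure lborel B = (SUP q\<in>A. F q)"
proof -
  define S where "S = (SUP q\<in>A. F q)"
  have "S \<le> ennreal m" unfolding S_def using assms(1) by (intro SUP_least)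
  then have "S < top" by (simp add: le_less_trans)
  then obtain t where t: "S = ennreal t" "t \<ge> 0" by (cases S) auto
  have "t \<le> m" using \<open>S \<le> ennreal m\<close> t assms(2) by simp
  have "B \<subseteq> {0<..t}"
  proof
    fix v assume "v \<in> B"
    then obtain q where "0 < v" "q \<in> A" "ennreal v \<le> F q" using B by blast
    then have "ennreal v \<le> S" unfolding S_def by (meson SUP_upper order_trans)
    then show "v \<in> {0<..t}" using t \<open>0 < v\<close> by simp
  qed
  then have "emeasure lborel B \<le> emeasure lborel {0<..t}" by (intro emeasure_mono) auto
  then have 1: "emeasure lborel B \<le> S" using t by simp
  have "{0<..<t} \<subseteq> B"
  proof
    fix v assume v: "v \<in> {0<..<t}"
    then have "ennreal v < S" using t by (simp add: ennreal_less_iff)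
    then obtain q where "q \<in> A" "ennreal v < F q" unfolding S_def less_SUP_iff by blast
    then show "v \<in> B" using B v \<open>t \<le> m\<close> by (auto intro: less_imp_le)
  qed
  then have "emeasure lborel {0<..<t} \<le> emeasure lborel B" using assms(3) by (intro emeasure_mono) auto
  then have "S \<le> emeasure lborel B" using t by simp
  then show ?thesis using 1 by (simp add: S_def)
qed

text \<open>The conditional measures are images of Lebesgue measure under conditional quantile functions,
  after embedding the space into the real line.\<close>

theorem disintegration:
  fixes M :: "'a::euclidean_space measure" and u :: "'a \<Rightarrow> real"
  assumes sM: "sets M = sets borel" and fin: "emeasure M UNIV < \<infinity>"
    and u: "u \<in> borel_measurable borel"
    and null: "\<And>N. N \<in> null_sets lborel \<Longrightarrow> emeasure M (u -` N) = 0"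
  obtains \<kappa> :: "real \<Rightarrow> 'a measure" where
    "\<And>s. sets (\<kappa> s) = sets borel" "\<And>s. emeasure (\<kappa> s) UNIV < \<infinity>"
    "\<And>h. h \<in> borel_measurable (borel \<Otimes>\<^sub>M borel) \<Longrightarrow> (\<lambda>s. \<integral>\<^sup>+p. h (s, p) \<partial>\<kappa> s) \<in> borel_measurable borel"
    "\<And>h. h \<in> borel_measurable (borel \<Otimes>\<^sub>M borel) \<Longrightarrow>
       (\<integral>\<^sup>+s. \<integral>\<^sup>+p. h (s, p) \<partial>\<kappa> s \<partial>lborel) = (\<integral>\<^sup>+p. h (u p, p) \<partial>M)"
proof -

  \<comment> \<open>Conditional distribution functions as Radon-Nikodym densities\<close>
  have spM: "space M = UNIV" using sets_eq_imp_space_eq[OF sM] by simp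
  have measM: "measurable M N = measurable borel N" for N :: "'b measure"
    by (rule measurable_cong_sets[OF sM refl])
  note [measurable] = u
  obtain \<iota> :: "'a \<Rightarrow> real" and g where \<iota>[measurable]: "\<iota> \<in> borel_measurable borel"
    and g[measurable]: "g \<in> borel_measurable borel"
    and gi: "\<And>p. g (\<iota> p) = p" and \<iota>01: "\<And>p. 0 \<le> \<iota> p" "\<And>p. \<iota> p < 1"
    using real_embedding by metis
  \<comment> \<open>By the hypothesis on null sets the measure of u^-1(T) within \<open>B\<close> is
    absolutely continuous as a function of T.\<close>
  have dens: "\<exists>F. F \<in> borel_measurable borel \<and>
      (\<forall>T\<in>sets borel. (\<integral>\<^sup>+s. F s * indicator T s \<partial>lborel) = emeasure M (u -` T \<inter> B))"
    if B: "B \<in> sets borel" for B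
  proof -
    define N where "N = distr (density M (indicator B)) borel u"
    have N: "emeasure N T = emeasure M (u -` T \<inter> B)" if [measurable]: "T \<in> sets borel" for T
    proof -
      have uT: "u -` T \<in> sets borel" using measurable_sets[OF u that] by simp
      have "emeasure N T = emeasure (density M (indicator B)) (u -` T)"
        unfolding N_def using that by (subst emeasure_distr) (auto simp: measM spM)
      also have "\<dots> = (\<integral>\<^sup>+p. indicator B p * indicator (u -` T) p \<partial>M)"
        using B uT by (subst emeasure_density) (auto simp: sM measM)
      also have "\<dots> = (\<integral>\<^sup>+p. indicator (u -` T \<inter> B) p \<partial>M)"
        by (intro nn_integral_cong) (auto simp: indicator_def)
      also have "\<dots> = emeasure M (u -` T \<inter> B)" using B uT sM by (intro nn_integral_indicator) auto
      finally show ?thesis .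
    qed
    have "absolutely_continuous lborel N"
      unfolding absolutely_continuous_def
    proof
      fix T assume T: "T \<in> null_sets (lborel :: real measure)"
      then have Tb: "T \<in> sets borel" by auto
      then have "u -` T \<in> sets M" using measurable_sets[OF u Tb] sM by simp
      then have "emeasure M (u -` T \<inter> B) \<le> emeasure M (u -` T)" by (intro emeasure_mono) auto
      then have "emeasure N T = 0" using null[OF T] N[OF Tb] by simp
      then show "T \<in> null_sets N" using Tb by (auto simp: null_sets_def N_def)
    qed
    moreover have "sets N = sets lborel" by (simp add: N_def)
    ultimately obtain F where F: "F \<in> borel_measurable lborel" "density lborel F = N"
      using sigma_finite_measure.Radon_Nikodym[OF lborel.sigma_finite_measure_axioms] by blast
    have "(\<integral>\<^sup>+s. F s * indicator T s \<partial>lborel) = emeasure M (u -` T \<inter> B)" if "T \<in> sets borel" for T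
      using N[OF that] F that unfolding F(2)[symmetric] by (simp add: emeasure_density)
    then show ?thesis using F(1) by auto
  qed
  have "\<forall>q. \<exists>F. F \<in> borel_measurable borel \<and>
      (\<forall>T\<in>sets borel. (\<integral>\<^sup>+s. F s * indicator T s \<partial>lborel) = emeasure M (u -` T \<inter> {p. \<iota> p \<le> q}))"
    by (intro allI dens) measurable
  \<comment> \<open>\<open>F q s\<close> plays the role of the mass on the slice over s of the
    points with code at most q, and \<open>Ft s\<close> below that of its total mass. Both are
    determined only up to null sets of s.\<close>
  then obtain F where F[measurable]: "\<And>q. F q \<in> borel_measurable borel"
    and Fint: "\<And>q T. T \<in> sets borel \<Longrightarrow>
      (\<integral>\<^sup>+s. F q s * indicator T s \<partial>lborel) = emeasure M (u -` T \<inter> {p. \<iota> p \<le> q})"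
    by metis
  obtain Ft where Ft[measurable]: "Ft \<in> borel_measurable borel"
    and Ftint: "\<And>T. T \<in> sets borel \<Longrightarrow> (\<integral>\<^sup>+s. Ft s * indicator T s \<partial>lborel) = emeasure M (u -` T)"
    using dens[of UNIV] by auto
  have emM: "emeasure M A \<le> emeasure M B" if "A \<subseteq> B" "B \<in> sets borel" for A B
    using that sM by (intro emeasure_mono) auto
  have finM: "emeasure M A < \<infinity>" for A
    using emM[of A UNIV] fin by (simp add: less_top le_less_trans)
  have set\<iota>: "{p. \<iota> p \<le> q} \<in> sets borel" for q by measurable
  have uT: "u -` T \<in> sets borel" if "T \<in> sets borel" for T using measurable_sets[OF u that] by simp
  have Fle: "AE s in lborel. F q s \<le> F q' s" if "q \<le> q'" for q q'
  proof (rule AE_le_of_nn_integral_le)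
    show "(\<integral>\<^sup>+s. F q' s \<partial>lborel) < \<infinity>" using Fint[of UNIV q'] finM by simp
    fix T :: "real set" assume "T \<in> sets lborel"
    then show "(\<integral>\<^sup>+s. F q s * indicator T s \<partial>lborel) \<le> (\<integral>\<^sup>+s. F q' s * indicator T s \<partial>lborel)"
      using that by (simp add: Fint) (intro emM sets.Int uT set\<iota>; auto)
  qed auto
  have Fle': "AE s in lborel. F q s \<le> Ft s" for q
  proof (rule AE_le_of_nn_integral_le)
    show "(\<integral>\<^sup>+s. Ft s \<partial>lborel) < \<infinity>" using Ftint[of UNIV] finM by simp
    fix T :: "real set" assume "T \<in> sets lborel"
    then show "(\<integral>\<^sup>+s. F q s * indicator T s \<partial>lborel) \<le> (\<integral>\<^sup>+s. Ft s * indicator T s \<partial>lborel)"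
      by (simp add: Fint Ftint) (intro emM uT; auto)
  qed auto

  \<comment> \<open>Conditional quantile functions and the measures they transport\<close>
  define m where "m s = enn2real (Ft s)" for s
  have m[measurable]: "m \<in> borel_measurable borel" unfolding m_def by measurable
  have m0: "m s \<ge> 0" for s by (simp add: m_def)
  have AEm: "AE s in lborel. Ft s = ennreal (m s)"
  proof -
    have "AE s in lborel. Ft s \<noteq> \<infinity>"
      using Ftint[of UNIV] finM[of UNIV] by (intro nn_integral_noteq_infinite) auto
    then show ?thesis by eventually_elim (simp add: m_def less_top)
  qed
  \<comment> \<open>Monotonicity in q holds almost everywhere for each pair, so only countably many
    thresholds are kept; codes lie in [0, 1).\<close>
  define Q where "Q = \<rat> \<inter> {0..1::real}"
  have Q: "countable Q" "0 \<in> Q" "Q \<subseteq> {0..1}" by (auto simp: Q_def countable_rat countable_Int1)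
  have AEmono: "AE s in lborel. \<forall>q\<in>Q. \<forall>q'\<in>Q. q \<le> q' \<longrightarrow> F q s \<le> F q' s"
    using Fle Q(1) by (auto simp: AE_ball_countable)
  have AEtop: "AE s in lborel. \<forall>q\<in>Q. F q s \<le> Ft s"
    using Fle' Q(1) by (auto simp: AE_ball_countable)
  \<comment> \<open>The generalised inverse of the distribution function at level v. The default
    value 1 stands for thresholds that are not admissible; it keeps the infimum within [0, 1] and
    lies above every code.\<close>
  define Qf where "Qf x = (INF q\<in>Q. if ennreal (snd x) \<le> F q (fst x) then q else 1)" for x :: "real \<times> real"
  have Qf[measurable]: "Qf \<in> borel_measurable (borel \<Otimes>\<^sub>M borel)"
    unfolding Qf_def using Q(1) by (intro borel_measurable_cINF_real) measurable
  have bdd: "bdd_below ((\<lambda>q. if ennreal v \<le> F q s then q else 1) ` Q)" for s v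
    using Q(3) by (intro bdd_belowI[of _ 0]) (auto split: if_splits)
  have Qf_less: "Qf (s, v) < x \<longleftrightarrow> (\<exists>q\<in>Q. (if ennreal v \<le> F q s then q else 1) < x)" for s v x
    unfolding Qf_def using Q(2) bdd by (subst cINF_less_iff) auto
  have Qf_le: "Qf (s, v) \<le> 1" for s v
  proof -
    have "Qf (s, v) \<le> (if ennreal v \<le> F 0 s then 0 else 1)"
      unfolding Qf_def using cINF_lower[OF bdd Q(2), of v s] by simp
    then show ?thesis by (simp split: if_splits)
  qed
  have P[measurable]: "Measurable.pred (borel \<Otimes>\<^sub>M borel) (\<lambda>x :: real \<times> real. 0 < snd x \<and> snd x \<le> m (fst x))"
    by measurable
  \<comment> \<open>Restricts the levels v to (0, m s], so that the slice measure has mass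
    \<open>m s\<close>.\<close>
  define W where "W x = (indicator {x. 0 < snd x \<and> snd x \<le> m (fst x)} x :: ennreal)" for x :: "real \<times> real"
  have W[measurable]: "W \<in> borel_measurable (borel \<Otimes>\<^sub>M borel)"
    unfolding W_def using P by (intro borel_measurable_indicator) (auto simp: pred_def space_pair_measure)
  have ll: "measurable (lborel \<Otimes>\<^sub>M lborel) N = measurable (borel \<Otimes>\<^sub>M borel) N" for N :: "'b measure" and x :: "real \<times> real"
    by (intro measurable_cong_sets sets_pair_measure_cong) auto
  define \<kappa> where "\<kappa> s = distr (density lborel (\<lambda>v. W (s, v))) borel (\<lambda>v. g (Qf (s, v)))" for s
  have s\<kappa>: "sets (\<kappa> s) = sets borel" for s by (simp add: \<kappa>_def)
  have int\<kappa>: "(\<integral>\<^sup>+p. h p \<partial>\<kappa> s) = (\<integral>\<^sup>+v. W (s, v) * h (g (Qf (s, v))) \<partial>lborel)"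
    if [measurable]: "h \<in> borel_measurable borel" for h s
    unfolding \<kappa>_def by (subst nn_integral_distr) (auto simp: nn_integral_density)
  have fin\<kappa>: "emeasure (\<kappa> s) UNIV < \<infinity>" for s
  proof -
    have "emeasure (\<kappa> s) UNIV = (\<integral>\<^sup>+p. 1 \<partial>\<kappa> s)"
      using s\<kappa>[of s] sets_eq_imp_space_eq[OF s\<kappa>[of s]] by simp
    also have "\<dots> = (\<integral>\<^sup>+v. W (s, v) * 1 \<partial>lborel)" by (rule int\<kappa>) simp
    also have "\<dots> = (\<integral>\<^sup>+v. indicator {0<..m s} v \<partial>lborel)"
      by (intro nn_integral_cong) (auto simp: W_def indicator_def)
    also have "\<dots> < \<infinity>" using m0 by simp
    finally show ?thesis .
  qed

  \<comment> \<open>Equality of the two joint measures on levels and points\<close>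
  define J1 where "J1 = distr (density (lborel \<Otimes>\<^sub>M lborel) W) (borel \<Otimes>\<^sub>M borel) (\<lambda>x. (fst x, g (Qf x)))"
  define J2 where "J2 = distr M (borel \<Otimes>\<^sub>M borel) (\<lambda>p. (u p, p))"
  have intJ1: "(\<integral>\<^sup>+x. h x \<partial>J1) = (\<integral>\<^sup>+s. \<integral>\<^sup>+v. W (s, v) * h (s, g (Qf (s, v))) \<partial>lborel \<partial>lborel)"
    if [measurable]: "h \<in> borel_measurable (borel \<Otimes>\<^sub>M borel)" for h
  proof -
    have "(\<integral>\<^sup>+x. h x \<partial>J1) = (\<integral>\<^sup>+x. W x * h (fst x, g (Qf x)) \<partial>(lborel \<Otimes>\<^sub>M lborel))"
      unfolding J1_def by (subst nn_integral_distr) (auto simp: nn_integral_density ll)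
    also have "\<dots> = (\<integral>\<^sup>+s. \<integral>\<^sup>+v. W (s, v) * h (s, g (Qf (s, v))) \<partial>lborel \<partial>lborel)"
      by (subst lborel.nn_integral_fst[symmetric]) (auto simp: ll)
    finally show ?thesis .
  qed
  \<comment> \<open>The joint distribution of level and code, evaluated on half-lines. Open
    half-lines suit the infimum defining \<open>Qf\<close>, since being strictly below x is decided
    by a single threshold.\<close>
  have slice: "(\<integral>\<^sup>+s. \<integral>\<^sup>+v. W (s, v) * (indicator T s * indicator {..<x} (Qf (s, v))) \<partial>lborel \<partial>lborel)
      = emeasure M (u -` T \<inter> {p. \<iota> p < x})" if T[measurable]: "T \<in> sets borel" for T and x :: real
  proof -
    define B where "B s = {v. 0 < v \<and> v \<le> m s \<and> Qf (s, v) < x}" for s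
    have Bm: "B s \<in> sets borel" for s unfolding B_def by measurable
    have inner: "(\<integral>\<^sup>+v. W (s, v) * (indicator T s * indicator {..<x} (Qf (s, v))) \<partial>lborel)
        = indicator T s * emeasure lborel (B s)" for s
    proof -
      have "(\<integral>\<^sup>+v. W (s, v) * (indicator T s * indicator {..<x} (Qf (s, v))) \<partial>lborel)
          = (\<integral>\<^sup>+v. indicator T s * indicator (B s) v \<partial>lborel)"
        by (intro nn_integral_cong) (auto simp: W_def B_def indicator_def)
      then show ?thesis using Bm by (simp add: nn_integral_cmult)
    qed
    show ?thesis
    proof (cases "x > 1")
      case True
      have "B s = {0<..m s}" for s
        using Qf_le True by (auto simp: B_def intro: le_less_trans)
      then have "(\<integral>\<^sup>+s. indicator T s * emeasure lborel (B s) \<partial>lborel) = (\<integral>\<^sup>+s. Ft s * indicator T s \<partial>lborel)"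
        using AEm m0 by (intro nn_integral_cong_AE) (auto elim!: eventually_mono simp: mult.commute)
      moreover have "{p. \<iota> p < x} = UNIV" using \<iota>01(2) True by (auto intro: less_trans)
      ultimately show ?thesis unfolding inner by (simp add: Ftint)
    next
      \<comment> \<open>As x \<le> 1, the default value 1 is never below x, so only admissible
        thresholds contribute.\<close>
      case False
      define A where "A = {q\<in>Q. q < x}"
      have Beq: "v \<in> B s \<longleftrightarrow> 0 < v \<and> v \<le> m s \<and> (\<exists>q\<in>A. ennreal v \<le> F q s)" for s v
        using False by (auto simp: B_def Qf_less A_def split: if_splits)
      have AEB: "AE s in lborel. emeasure lborel (B s) = (SUP q\<in>A. F q s)"
        using AEm AEtop
      proof eventually_elim
        case (elim s)
        show ?case
          by (rule emeasure_lborel_quantile[OF _ m0 Bm Beq]) (use elim in \<open>auto simp: A_def\<close>)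
      qed
      show ?thesis
      proof (cases "x > 0")
        case False
        then have "A = {}" using Q(3) by (auto simp: A_def)
        then have "(\<integral>\<^sup>+s. indicator T s * emeasure lborel (B s) \<partial>lborel) = (\<integral>\<^sup>+s. 0 \<partial>(lborel :: real measure))"
          using AEB by (intro nn_integral_cong_AE) (auto elim!: eventually_mono simp: bot_ennreal)
        moreover have "{p. \<iota> p < x} = {}" using \<iota>01(1) False by (auto simp: not_less intro: order_trans)
        ultimately show ?thesis unfolding inner by simp
      next
        case True
        have A: "A \<noteq> {}" "countable A" "A \<subseteq> Q"
          using True Q(1,2) by (auto simp: A_def intro: countable_subset)
        define r where "r = from_nat_into A"
        \<comment> \<open>Running maxima turn the supremum over the countable set \<open>A\<close>
          into an increasing sequence, as monotone convergence requires.\<close>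
        define q where "q n = Max (r ` {..n})" for n
        have r: "r n \<in> A" for n unfolding r_def using A(1) by (rule from_nat_into)
        have qA: "q n \<in> A" for n
        proof -
          have "q n \<in> r ` {..n}" unfolding q_def by (intro Max_in) auto
          then show ?thesis using r by auto
        qed
        have qmono: "q n \<le> q (Suc n)" for n unfolding q_def by (intro Max_mono) auto
        have cof: "\<exists>n. y \<le> q n" if yA: "y \<in> A" for y
        proof -
          obtain n where "y = r n" using from_nat_into_surj[OF A(2) yA] by (auto simp: r_def)
          then have "y \<le> q n" unfolding q_def by (intro Max_ge) auto
          then show ?thesis ..
        qed
        have "AE s in lborel. indicator T s * emeasure lborel (B s) = (SUP n. F (q n) s * indicator T s)"
          using AEB AEmono
        proof eventually_elim
          case (elim s)
          have "(SUP q\<in>A. F q s) = (SUP n. F (q n) s)"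
          proof (rule antisym)
            show "(SUP q\<in>A. F q s) \<le> (SUP n. F (q n) s)"
            proof (rule SUP_least)
              fix y assume y: "y \<in> A"
              then obtain n where "y \<le> q n" using cof by blast
              then have "F y s \<le> F (q n) s" using elim(2) y qA[of n] A(3) by blast
              then show "F y s \<le> (SUP n. F (q n) s)" by (rule SUP_upper2[OF UNIV_I])
            qed
            show "(SUP n. F (q n) s) \<le> (SUP q\<in>A. F q s)" using qA by (intro SUP_least SUP_upper) auto
          qed
          then show ?case using elim(1) by (simp add: SUP_mult_left_ennreal mult.commute)
        qed
        then have "(\<integral>\<^sup>+s. indicator T s * emeasure lborel (B s) \<partial>lborel)
            = (\<integral>\<^sup>+s. (SUP n. F (q n) s * indicator T s) \<partial>lborel)" by (rule nn_integral_cong_AE)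
        also have "\<dots> = (SUP n. \<integral>\<^sup>+s. F (q n) s * indicator T s \<partial>lborel)"
        proof (rule nn_integral_monotone_convergence_SUP_AE)
          show "AE s in lborel. F (q i) s * indicator T s \<le> F (q (Suc i)) s * indicator T s" for i
            using Fle[OF qmono] by eventually_elim (intro mult_right_mono, auto)
        qed measurable
        also have "\<dots> = (SUP n. emeasure M (u -` T \<inter> {p. \<iota> p \<le> q n}))" by (simp add: Fint)
        also have "\<dots> = emeasure M (\<Union>n. u -` T \<inter> {p. \<iota> p \<le> q n})"
        proof (rule SUP_emeasure_incseq)
          show "range (\<lambda>n. u -` T \<inter> {p. \<iota> p \<le> q n}) \<subseteq> sets M"
            unfolding sM by (intro image_subsetI sets.Int uT[OF T] set\<iota>)
          show "incseq (\<lambda>n. u -` T \<inter> {p. \<iota> p \<le> q n})"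
          proof (rule incseq_SucI)
            fix n show "u -` T \<inter> {p. \<iota> p \<le> q n} \<subseteq> u -` T \<inter> {p. \<iota> p \<le> q (Suc n)}"
              using order_trans[OF _ qmono[of n]] by blast
          qed
        qed
        also have "(\<Union>n. u -` T \<inter> {p. \<iota> p \<le> q n}) = u -` T \<inter> {p. \<iota> p < x}"
        proof -
          have "(\<exists>n. \<iota> p \<le> q n) \<longleftrightarrow> \<iota> p < x" for p
          proof
            assume "\<exists>n. \<iota> p \<le> q n"
            then obtain n where "\<iota> p \<le> q n" ..
            moreover have "q n < x" using qA[of n] by (simp add: A_def)
            ultimately show "\<iota> p < x" by simp
          next
            assume "\<iota> p < x"
            then obtain y where y: "y \<in> \<rat>" "\<iota> p < y" "y < x" using Rats_dense_in_real by blast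
            then have "y \<in> A" using \<iota>01(1)[of p] \<open>\<not> x > 1\<close> by (auto simp: A_def Q_def)
            then obtain n where "y \<le> q n" using cof by blast
            then show "\<exists>n. \<iota> p \<le> q n" using y(2) by (intro exI[of _ n]) simp
          qed
          then show ?thesis by auto
        qed
        finally show ?thesis unfolding inner .
      qed
    qed
  qed
  have rect: "emeasure J1 (T \<times> A) = emeasure J2 (T \<times> A)"
    if T[measurable]: "T \<in> sets borel" and A[measurable]: "A \<in> sets borel" for T A
  proof -
    \<comment> \<open>Sets of points are compared through their codes: the two laws on the real line
      agree on half-lines, hence on the preimage of \<open>A\<close> under the decoder
      \<open>g\<close>.\<close>
    define \<nu>1 where "\<nu>1 = distr (density (lborel \<Otimes>\<^sub>M lborel) (\<lambda>x. W x * indicator T (fst x))) borel Qf"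
    define \<nu>2 where "\<nu>2 = distr (density M (indicator (u -` T))) borel \<iota>"
    have uT'[measurable]: "u -` T \<in> sets M" using uT[OF T] sM by simp
    have \<nu>1: "emeasure \<nu>1 C = (\<integral>\<^sup>+s. \<integral>\<^sup>+v. W (s, v) * (indicator T s * indicator C (Qf (s, v))) \<partial>lborel \<partial>lborel)"
      if [measurable]: "C \<in> sets borel" for C
    proof -
      have "emeasure \<nu>1 C = (\<integral>\<^sup>+y. indicator C y \<partial>\<nu>1)" by (simp add: \<nu>1_def)
      also have "\<dots> = (\<integral>\<^sup>+x. W x * indicator T (fst x) * indicator C (Qf x) \<partial>(lborel \<Otimes>\<^sub>M lborel))"
        unfolding \<nu>1_def by (subst nn_integral_distr) (auto simp: nn_integral_density ll)
      also have "\<dots> = (\<integral>\<^sup>+s. \<integral>\<^sup>+v. W (s, v) * indicator T s * indicator C (Qf (s, v)) \<partial>lborel \<partial>lborel)"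
        by (subst lborel.nn_integral_fst[symmetric]) (auto simp: ll)
      finally show ?thesis by (simp add: mult.assoc)
    qed
    have \<nu>2: "emeasure \<nu>2 C = emeasure M (u -` T \<inter> {p. \<iota> p \<in> C})" if [measurable]: "C \<in> sets borel" for C
    proof -
      have C: "\<iota> -` C \<in> sets M" using measurable_sets[OF \<iota> that] sM by simp
      have "emeasure \<nu>2 C = emeasure (density M (indicator (u -` T))) (\<iota> -` C)"
        unfolding \<nu>2_def using that by (subst emeasure_distr) (auto simp: measM spM)
      also have "\<dots> = (\<integral>\<^sup>+p. indicator (u -` T) p * indicator (\<iota> -` C) p \<partial>M)"
        using C by (subst emeasure_density) auto
      also have "\<dots> = (\<integral>\<^sup>+p. indicator (u -` T \<inter> {p. \<iota> p \<in> C}) p \<partial>M)"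
        by (intro nn_integral_cong) (auto simp: indicator_def)
      also have "\<dots> = emeasure M (u -` T \<inter> {p. \<iota> p \<in> C})"
        using C by (intro nn_integral_indicator sets.Int uT') (simp add: vimage_def)
      finally show ?thesis .
    qed
    have "\<nu>1 = \<nu>2"
    proof (rule measure_eqI_generator_eq[where E = "range lessThan" and \<Omega> = UNIV and A = "\<lambda>i. {..<real i}"])
      have "{..<a} \<inter> {..<b} = {..<min a b}" for a b :: real by auto
      then show "Int_stable (range (lessThan :: real \<Rightarrow> _))" by (auto simp: Int_stable_def)
      show "emeasure \<nu>1 X = emeasure \<nu>2 X" if "X \<in> range lessThan" for X
        using that slice[OF T] by (auto simp: \<nu>1 \<nu>2)
      have sb: "sets borel = sigma_sets UNIV (range (lessThan :: real \<Rightarrow> _))"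
        using borel_Iio[where 'a = real] by (metis sets_measure_of subset_UNIV Pow_UNIV)
      then show "sets \<nu>1 = sigma_sets UNIV (range lessThan)" "sets \<nu>2 = sigma_sets UNIV (range lessThan)"
        by (simp_all add: \<nu>1_def \<nu>2_def)
      show "(\<Union>i. {..<real i}) = UNIV" using reals_Archimedean2 by auto
      show "emeasure \<nu>1 {..<real i} \<noteq> \<infinity>" for i
        using slice[OF T, of "real i"] finM[of "u -` T \<inter> {p. \<iota> p < real i}"] by (simp add: \<nu>1)
    qed auto
    moreover have gA: "g -` A \<in> sets borel" using measurable_sets[OF g A] by simp
    ultimately have eq: "emeasure \<nu>1 (g -` A) = emeasure \<nu>2 (g -` A)" by simp
    have "emeasure J1 (T \<times> A) = (\<integral>\<^sup>+x. indicator (T \<times> A) x \<partial>J1)"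
      by (simp add: J1_def)
    also have "\<dots> = (\<integral>\<^sup>+s. \<integral>\<^sup>+v. W (s, v) * indicator (T \<times> A) (s, g (Qf (s, v))) \<partial>lborel \<partial>lborel)"
      by (rule intJ1) simp
    also have "\<dots> = emeasure \<nu>1 (g -` A)"
      unfolding \<nu>1[OF gA] by (intro nn_integral_cong) (auto simp: indicator_def)
    also have "\<dots> = emeasure M (u -` T \<inter> A)" unfolding eq \<nu>2[OF gA] by (simp add: gi)
    also have "\<dots> = emeasure J2 (T \<times> A)"
    proof -
      have "(\<lambda>p. (u p, p)) -` (T \<times> A) \<inter> space M = u -` T \<inter> A" by (auto simp: spM)
      then show ?thesis unfolding J2_def by (subst emeasure_distr) (auto simp: measM)
    qed
    finally show ?thesis .
  qed
  have J: "J1 = J2"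
  proof (rule measure_eqI_generator_eq[where E = "{a \<times> b |a b. a \<in> sets (borel :: real measure) \<and> b \<in> sets (borel :: 'a measure)}"
        and \<Omega> = UNIV and A = "\<lambda>_. UNIV"])
    show "Int_stable {a \<times> b |a b. a \<in> sets (borel :: real measure) \<and> b \<in> sets (borel :: 'a measure)}"
      by (rule Int_stable_pair_measure_generator)
    have "sets (borel \<Otimes>\<^sub>M borel) = sigma_sets UNIV {a \<times> b |a b. a \<in> sets (borel :: real measure) \<and> b \<in> sets (borel :: 'a measure)}"
      by (simp add: sets_pair_measure)
    then show "sets J1 = sigma_sets UNIV {a \<times> b |a b. a \<in> sets (borel :: real measure) \<and> b \<in> sets (borel :: 'a measure)}"
      "sets J2 = sigma_sets UNIV {a \<times> b |a b. a \<in> sets (borel :: real measure) \<and> b \<in> sets (borel :: 'a measure)}"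
      by (simp_all add: J1_def J2_def)
    show "emeasure J1 X = emeasure J2 X"
      if "X \<in> {a \<times> b |a b. a \<in> sets (borel :: real measure) \<and> b \<in> sets (borel :: 'a measure)}" for X
      using that rect by auto
    show "range (\<lambda>_::nat. UNIV) \<subseteq> {a \<times> b |a b. a \<in> sets (borel :: real measure) \<and> b \<in> sets (borel :: 'a measure)}"
      by (auto intro!: exI[of _ UNIV])
    have "UNIV \<in> sets (borel \<Otimes>\<^sub>M borel :: (real \<times> 'a) measure)"
      using sets.top[of "borel \<Otimes>\<^sub>M borel :: (real \<times> 'a) measure"] by (simp add: space_pair_measure)
    then have "emeasure J2 UNIV = emeasure M UNIV"
      unfolding J2_def by (subst emeasure_distr) (auto simp: measM spM)
    then have "emeasure J1 UNIV = emeasure M UNIV" using rect[of UNIV UNIV] by simp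
    then show "emeasure J1 UNIV \<noteq> \<infinity>" using fin by simp
  qed auto
  have h\<kappa>: "(\<integral>\<^sup>+p. h (s, p) \<partial>\<kappa> s) = (\<integral>\<^sup>+v. W (s, v) * h (s, g (Qf (s, v))) \<partial>lborel)"
    if [measurable]: "h \<in> borel_measurable (borel \<Otimes>\<^sub>M borel)" for h s
    by (rule int\<kappa>) measurable
  show ?thesis
  proof (rule that[OF s\<kappa> fin\<kappa>])
    fix h :: "real \<times> 'a \<Rightarrow> ennreal" assume h[measurable]: "h \<in> borel_measurable (borel \<Otimes>\<^sub>M borel)"
    have "(\<lambda>x. W x * h (fst x, g (Qf x))) \<in> borel_measurable (borel \<Otimes>\<^sub>M lborel)"
      by (subst measurable_cong_sets[of _ "borel \<Otimes>\<^sub>M borel" _ borel]) (auto intro: sets_pair_measure_cong)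
    from lborel.borel_measurable_nn_integral_fst[OF this]
    show "(\<lambda>s. \<integral>\<^sup>+p. h (s, p) \<partial>\<kappa> s) \<in> borel_measurable borel" unfolding h\<kappa>[OF h] by simp
    have "(\<integral>\<^sup>+s. \<integral>\<^sup>+p. h (s, p) \<partial>\<kappa> s \<partial>lborel) = (\<integral>\<^sup>+x. h x \<partial>J2)"
      unfolding h\<kappa>[OF h] J[symmetric] intJ1[OF h] ..
    also have "\<dots> = (\<integral>\<^sup>+p. h (u p, p) \<partial>M)"
      unfolding J2_def by (subst nn_integral_distr) (auto simp: measM)
    finally show "(\<integral>\<^sup>+s. \<integral>\<^sup>+p. h (s, p) \<partial>\<kappa> s \<partial>lborel) = (\<integral>\<^sup>+p. h (u p, p) \<partial>M)" .
  qed
qed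

subsection \<open>The metric in terms of horizontal components\<close>

lemma T_coeff_linear: "linear (T_coeff p)"
  by (auto simp: linear_iff T_coeff_def imh_simps algebra_simps)

lemma T_coeff_horizontal_sum:
  "T_coeff p (\<Sum>j\<in>UNIV. a j *\<^sub>R hX j p + b j *\<^sub>R hY j p) = 0"
  by (simp add: linear_sum[OF T_coeff_linear] linear_add[OF T_coeff_linear] linear_cmul[OF T_coeff_linear])

lemma T_coeff_grad_H [simp]: "T_coeff p (grad_H f p) = 0" "T_coeff p (distr_grad_H U f p) = 0"
  unfolding grad_H_def distr_grad_H_def by (rule T_coeff_horizontal_sum)+

lemma g_norm_grad_H: "g_norm p (grad_H f p) = norm (fst (grad_H f p))"
  and g_norm_distr_grad_H: "g_norm p (distr_grad_H U f p) = norm (fst (distr_grad_H U f p))"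
  by (simp_all add: g_norm_def g_inner_def norm_eq_sqrt_inner)

lemma g_inner_grad_H: "g_inner p v (grad_H f p) = fst v \<bullet> fst (grad_H f p)"
  by (simp add: g_inner_def)

lemma g_norm_grad:
  "g_norm p (grad f p) = sqrt ((norm (fst (grad_H f p)))\<^sup>2 + (frechet_derivative f (at p) (0, 1))\<^sup>2)"
proof -
  have "fst (grad f p) = fst (grad_H f p)" by (simp add: grad_def hT_def)
  moreover have "T_coeff p (grad f p) = frechet_derivative f (at p) (0, 1)"
    by (simp add: grad_def linear_add[OF T_coeff_linear] linear_cmul[OF T_coeff_linear] deriv_along_def)
      (simp add: hT_def)
  ultimately show ?thesis unfolding g_norm_def g_inner_def power2_norm_eq_inner
    by (simp add: power2_eq_square)
qed

subsection \<open>Local structure of H-regular hypersurfaces\<close>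

lemma fst_distr_grad_H_nonzero:
  assumes "distr_grad_H U f p \<noteq> 0"
  shows "fst (distr_grad_H U f p) \<noteq> 0"
proof
  assume 0: "fst (distr_grad_H U f p) = 0"
  then have "snd (distr_grad_H U f p) = 0"
    using T_coeff_grad_H(2)[of p U f] by (simp add: T_coeff_def imh_simps)
  then show False using 0 assms by (simp add: prod_eq_iff)
qed

lemma defines_near_hgrad_on:
  assumes "defines_near S p r f"
  shows "hgrad_on (B_ball p r) f (\<lambda>q. fst (distr_grad_H (B_ball p r) f q))" "p \<in> B_ball p r"
    "S \<inter> B_ball p r = {q \<in> B_ball p r. f q = 0}" "fst (distr_grad_H (B_ball p r) f p) \<noteq> 0"
  using assms C1_H_hgrad_on[OF open_B_ball] mem_B_ball fst_distr_grad_H_nonzero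
  unfolding defines_near_def by blast+

lemma hgrad_on_subset: "hgrad_on U f F \<Longrightarrow> open V \<Longrightarrow> V \<subseteq> U \<Longrightarrow> hgrad_on V f F"
  unfolding hgrad_on_def by (meson continuous_on_subset subsetD)

text \<open>A normal may come from another defining function on another ball. Its gradient is a
  nonzero multiple of \<open>F q\<close> because the zero sets agree near q, and after normalisation
  and squaring neither the factor nor the sign is visible.\<close>

lemma is_normal_at_inner:
  assumes f: "hgrad_on U f F" and S: "S \<inter> U = {q \<in> U. f q = 0}" and q: "q \<in> U" "q \<in> S" "F q \<noteq> 0"
    and v: "is_normal_at S q v"
  shows "(fst v \<bullet> a)\<^sup>2 = (F q \<bullet> a)\<^sup>2 / (norm (F q))\<^sup>2"
proof -
  obtain r g where g: "defines_near S q r g"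
    "v = (1 / g_norm q (distr_grad_H (B_ball q r) g q)) *\<^sub>R distr_grad_H (B_ball q r) g q"
    using v unfolding is_normal_at_def by blast
  define G where "G x = fst (distr_grad_H (B_ball q r) g x)" for x
  have G: "hgrad_on (B_ball q r) g G" "q \<in> B_ball q r" "S \<inter> B_ball q r = {x \<in> B_ball q r. g x = 0}" "G q \<noteq> 0"
    using defines_near_hgrad_on[OF g(1)] unfolding G_def by blast+
  have U: "open U" using f by (simp add: hgrad_on_def)
  let ?V = "U \<inter> B_ball q r"
  have V: "open ?V" by (intro open_Int U open_B_ball)
  have "\<exists>k. G q = k *\<^sub>R F q"
  proof (rule hgrad_on_same_zeros[of ?V f F g G q])
    show "hgrad_on ?V f F" by (rule hgrad_on_subset[OF f V]) blast
    show "hgrad_on ?V g G" by (rule hgrad_on_subset[OF G(1) V]) blast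
    show "q \<in> ?V" using q(1) G(2) by blast
    show "f q = 0" using S q by blast
    show "f x = 0 \<longleftrightarrow> g x = 0" if "x \<in> ?V" for x using S G(3) that by blast
  qed (rule q(3))
  then obtain k where k: "G q = k *\<^sub>R F q" by blast
  then have k0: "k \<noteq> 0" using G(4) by auto
  have "fst v = (1 / norm (G q)) *\<^sub>R G q" using g(2) by (simp add: g_norm_distr_grad_H G_def)
  then have "(fst v \<bullet> a)\<^sup>2 = (k * (F q \<bullet> a))\<^sup>2 / (\<bar>k\<bar> * norm (F q))\<^sup>2"
    by (simp add: k power_divide)
  also have "\<dots> = (F q \<bullet> a)\<^sup>2 / (norm (F q))\<^sup>2" using k0 by (simp add: power_mult_distrib)
  finally show ?thesis .
qed

text \<open>Local data in a form suited to a countable subcover. A normal is chosen point by point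
  and only up to sign, so it need not be measurable; the squared inner products are governed by one
  continuous field.\<close>

lemma H_regular_local:
  fixes S :: "'n::finite heis set"
  assumes c: "c > 0" and S: "H_regular S" and p: "p \<in> S" "p \<in> \<Omega>" and \<Omega>: "open \<Omega>"
  shows "\<exists>V. open V \<and> p \<in> V \<and> V \<subseteq> \<Omega> \<and> S \<inter> V \<in> sets borel \<and> sph_outer c (S \<inter> V) < \<infinity> \<and>
    (\<exists>F. continuous_on V F \<and> (\<forall>q\<in>V. F q \<noteq> 0) \<and>
      (\<forall>q\<in>S \<inter> V. \<forall>v a. is_normal_at S q v \<longrightarrow> (fst v \<bullet> a)\<^sup>2 = (F q \<bullet> a)\<^sup>2 / (norm (F q))\<^sup>2))"
proof -
  obtain r f where "defines_near S p r f" using S p(1) unfolding H_regular_def by blast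
  note d = defines_near_hgrad_on[OF this]
  define U where "U = B_ball p r"
  define F where "F q = fst (distr_grad_H U f q)" for q
  have f: "hgrad_on U f F" "p \<in> U" "S \<inter> U = {q \<in> U. f q = 0}" "F p \<noteq> 0"
    using d unfolding U_def F_def by blast+
  have U: "open U" "continuous_on U f" "continuous_on U F" using f(1) by (auto simp: hgrad_on_def)
  obtain \<rho> where \<rho>: "\<rho> > 0" "ball p \<rho> \<subseteq> U" "sph_outer c {q \<in> ball p \<rho>. f q = 0} < \<infinity>"
    using sph_outer_hypersurface_finite[OF c f(1) f(2) f(4)] by blast
  define V where "V = \<Omega> \<inter> ball p \<rho> \<inter> (U \<inter> F -` (- {0}))"
  have V: "open V" unfolding V_def using U \<Omega> by (intro open_Int continuous_open_preimage) auto
  have pV: "p \<in> V" using p(2) \<rho>(1) f(2,4) by (simp add: V_def)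
  have VU: "V \<subseteq> U" "V \<subseteq> ball p \<rho>" "V \<subseteq> \<Omega>" "\<forall>q\<in>V. F q \<noteq> 0" by (auto simp: V_def)
  have SV: "S \<inter> V = {q \<in> V. f q = 0}" using f(3) VU(1) by blast
  have "open (V \<inter> f -` (- {0}))"
    using V continuous_on_subset[OF U(2) VU(1)] by (intro continuous_open_preimage) auto
  then have "V - V \<inter> f -` (- {0}) \<in> sets borel" using V by (intro sets.Diff borel_open)
  moreover have "V - V \<inter> f -` (- {0}) = S \<inter> V" unfolding SV by auto
  ultimately have "S \<inter> V \<in> sets borel" by simp
  moreover have "sph_outer c (S \<inter> V) < \<infinity>"
  proof (rule le_less_trans[OF sph_outer_mono[OF c] \<rho>(3)])
    show "S \<inter> V \<subseteq> {q \<in> ball p \<rho>. f q = 0}" unfolding SV using VU(2) by blast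
  qed
  moreover have "\<forall>q\<in>S \<inter> V. \<forall>v a. is_normal_at S q v \<longrightarrow> (fst v \<bullet> a)\<^sup>2 = (F q \<bullet> a)\<^sup>2 / (norm (F q))\<^sup>2"
  proof (intro ballI allI impI)
    fix q v a assume "q \<in> S \<inter> V" "is_normal_at S q v"
    then show "(fst v \<bullet> a)\<^sup>2 = (F q \<bullet> a)\<^sup>2 / (norm (F q))\<^sup>2"
      using VU by (intro is_normal_at_inner[OF f(1,3)]) auto
  qed
  moreover have "continuous_on V F" by (rule continuous_on_subset[OF U(3) VU(1)])
  ultimately show ?thesis using V pV VU(3,4) by (intro exI[of _ V] exI[of _ F] conjI)
qed

text \<open>The hypothesis \<open>np\<close> excludes that the horizontal gradient of
  \<open>u\<close> is a multiple of that of the defining function: for parallel vectors the squared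
  inner product with the unit normal equals the squared norm.\<close>

lemma normal_slice_null:
  fixes S :: "'n::finite heis set"
  assumes c: "c > 0" and v: "is_normal_at S p v" and p: "p \<in> \<Omega>" and \<Omega>: "open \<Omega>" and u: "Ck_on 2 \<Omega> u"
    and np: "(norm (fst (grad_H u p)))\<^sup>2 \<noteq> (fst v \<bullet> fst (grad_H u p))\<^sup>2"
  shows "\<exists>V. open V \<and> p \<in> V \<and> (\<forall>N\<in>null_sets lborel. sph_outer c {q \<in> S \<inter> V. u q \<in> N} = 0)"
proof -
  obtain r f where g: "defines_near S p r f"
    "v = (1 / g_norm p (distr_grad_H (B_ball p r) f p)) *\<^sub>R distr_grad_H (B_ball p r) f p"
    using v unfolding is_normal_at_def by blast
  define F where "F q = fst (distr_grad_H (B_ball p r) f q)" for q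
  define A where "A q = fst (grad_H u q)" for q
  define U where "U = B_ball p r \<inter> \<Omega>"
  have d: "hgrad_on (B_ball p r) f F" "p \<in> B_ball p r" "S \<inter> B_ball p r = {q \<in> B_ball p r. f q = 0}" "F p \<noteq> 0"
    using defines_near_hgrad_on[OF g(1)] unfolding F_def by blast+
  have U: "open U" "p \<in> U" unfolding U_def using d(2) p by (auto intro!: open_Int open_B_ball \<Omega>)
  have sub: "Ck_on k T h" if "Ck_on k S' h" "T \<subseteq> S'" for k T S' and h :: "'n heis \<Rightarrow> real"
    using that by (induction k arbitrary: h) (auto intro: continuous_on_subset)
  have u2: "Ck_on 2 U u" using sub[OF u] by (simp add: U_def)
  then have u1: "Ck_on 1 U u" using Ck_on_Suc_imp[of 1 U u] by (simp add: numeral_2_eq_2)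
  have f: "hgrad_on U f F" by (rule hgrad_on_subset[OF d(1) U(1)]) (simp add: U_def)
  have hu: "hgrad_on U u A" unfolding A_def by (rule Ck_on_hgrad_on[OF U(1) u1])
  have Ai: "A q \<bullet> e = frechet_derivative u (at q) (hor e q)" if "e \<in> Basis" for q e
    unfolding A_def by (rule fst_grad_H_inner[OF that])
  have np': "A p \<noteq> k *\<^sub>R F p" for k
  proof
    assume k: "A p = k *\<^sub>R F p"
    have "fst v = (1 / norm (F p)) *\<^sub>R F p" using g(2) by (simp add: g_norm_distr_grad_H F_def)
    then have eq: "fst v \<bullet> A p = k * norm (F p)"
      using d(4) by (simp add: k power2_norm_eq_inner[symmetric] power2_eq_square)
    have "(fst v \<bullet> A p)\<^sup>2 = (norm (A p))\<^sup>2" unfolding eq by (simp add: k power_mult_distrib)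
    then show False using np by (simp add: A_def)
  qed
  obtain \<rho> where \<rho>: "\<rho> > 0" "ball p \<rho> \<subseteq> U"
    "\<And>N. N \<in> null_sets lborel \<Longrightarrow> sph_outer c {q \<in> ball p \<rho>. f q = 0 \<and> u q \<in> N} = 0"
    by (rule sph_outer_slice_null[OF c f hu u2 U(2) _ d(4)], rule Ai, assumption, rule np', rule that; assumption)
  have "{q \<in> S \<inter> ball p \<rho>. u q \<in> N} = {q \<in> ball p \<rho>. f q = 0 \<and> u q \<in> N}" for N
    using d(3) \<rho>(2) unfolding U_def by blast
  then show ?thesis using \<rho> by (intro exI[of _ "ball p \<rho>"]) simp
qed

lemma Lindelof_neighbourhoods:
  fixes E :: "'a::second_countable_topology set"
  assumes "\<And>p. p \<in> E \<Longrightarrow> \<exists>V. open V \<and> p \<in> V \<and> P V"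
  obtains \<V> where "countable \<V>" "E \<subseteq> \<Union>\<V>" "\<And>V. V \<in> \<V> \<Longrightarrow> open V \<and> P V"
proof -
  obtain \<V> where V: "\<V> \<subseteq> {V. open V \<and> P V}" "countable \<V>" "\<Union>\<V> = \<Union>{V. open V \<and> P V}"
    using Lindelof_openin[of "{V. open V \<and> P V}" UNIV] by auto
  show ?thesis
  proof (rule that[OF V(2)])
    show "E \<subseteq> \<Union>\<V>" unfolding V(3) using assms by blast
    show "open W \<and> P W" if "W \<in> \<V>" for W using V(1) that by blast
  qed
qed

lemma H_regular_borel:
  fixes S :: "'n::finite heis set"
  assumes S: "H_regular S"
  shows "S \<in> sets borel"
proof -
  obtain \<V> where V: "countable \<V>" "S \<subseteq> \<Union>\<V>" "\<And>V. V \<in> \<V> \<Longrightarrow> open V \<and> S \<inter> V \<in> sets borel"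
  proof (rule Lindelof_neighbourhoods[of S "\<lambda>V. S \<inter> V \<in> sets borel"])
    show "\<exists>V. open V \<and> p \<in> V \<and> S \<inter> V \<in> sets borel" if "p \<in> S" for p
      using H_regular_local[OF zero_less_one S that UNIV_I open_UNIV] by blast
  qed blast
  have "S = (\<Union>V\<in>\<V>. S \<inter> V)" using V(2) by blast
  also have "\<dots> \<in> sets borel" using V by (intro sets.countable_UN') auto
  finally show ?thesis .
qed

subsection \<open>Inner regularity and the coarea formula\<close>

text \<open>The density is finite but perhaps not integrable. On the sets where it is at most n it
  may be truncated, which gives a finite Borel measure, and these sets increase to
  \<open>A\<close>.\<close>

lemma inner_regular_density:
  fixes \<kappa> :: "'a::euclidean_space measure"
  assumes s: "sets \<kappa> = sets borel" and fin: "emeasure \<kappa> UNIV < \<infinity>"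
    and f: "f \<in> borel_measurable borel" "\<And>x. f x < \<infinity>" and A: "A \<in> sets borel"
  shows "emeasure (density \<kappa> f) A = (SUP K\<in>{K. compact K \<and> K \<subseteq> A}. emeasure (density \<kappa> f) K)"
proof (rule antisym)
  have sp: "space \<kappa> = UNIV" using sets_eq_imp_space_eq[OF s] by simp
  have mk: "measurable \<kappa> N = measurable borel N" for N :: "'b measure" by (rule measurable_cong_sets[OF s refl])
  note [measurable] = f(1) A
  have em: "emeasure (density \<kappa> g) B = (\<integral>\<^sup>+x. g x * indicator B x \<partial>\<kappa>)"
    if "g \<in> borel_measurable borel" "B \<in> sets borel" for g B
    using that by (intro emeasure_density) (auto simp: mk s)
  define B where "B n = A \<inter> {x. f x \<le> of_nat n}" for n :: nat
  have B: "B n \<in> sets borel" for n unfolding B_def by measurable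
  have "A = (\<Union>n. B n)"
  proof -
    have "\<exists>n. f x \<le> of_nat n" for x using ennreal_Ex_less_of_nat[of "f x"] f(2)[of x] by (auto intro: less_imp_le)
    then show ?thesis by (auto simp: B_def)
  qed
  moreover have "(SUP n. emeasure (density \<kappa> f) (B n)) = emeasure (density \<kappa> f) (\<Union>n. B n)"
  proof (rule SUP_emeasure_incseq)
    show "incseq B" unfolding B_def by (intro incseq_SucI) (auto intro: order_trans)
  qed (use B s in auto)
  ultimately have "emeasure (density \<kappa> f) A = (SUP n. emeasure (density \<kappa> f) (B n))" by simp
  also have "\<dots> \<le> (SUP K\<in>{K. compact K \<and> K \<subseteq> A}. emeasure (density \<kappa> f) K)"
  proof (rule SUP_least)
    fix n
    define g where "g x = min (f x) (of_nat n)" for x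
    have g: "g \<in> borel_measurable borel" unfolding g_def by measurable
    have eq: "emeasure (density \<kappa> f) C = emeasure (density \<kappa> g) C" if "C \<subseteq> B n" "C \<in> sets borel" for C
      unfolding em[OF f(1) that(2)] em[OF g that(2)]
      by (intro nn_integral_cong) (use that(1) in \<open>auto simp: g_def B_def indicator_def min_def\<close>)
    have "emeasure (density \<kappa> g) UNIV \<le> (\<integral>\<^sup>+x. of_nat n \<partial>\<kappa>)"
      unfolding em[OF g, of UNIV, simplified] by (intro nn_integral_mono) (simp add: g_def)
    also have "\<dots> < \<infinity>" using fin sp by (simp add: ennreal_mult_less_top less_top ennreal_of_nat_neq_top[unfolded less_top])
    finally have "emeasure (density \<kappa> g) UNIV < \<infinity>" .
    then have "emeasure (density \<kappa> g) (B n) = (SUP K\<in>{K. K \<subseteq> B n \<and> compact K}. emeasure (density \<kappa> g) K)"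
      using B by (intro inner_regular) (auto simp: s sp)
    also have "\<dots> \<le> (SUP K\<in>{K. compact K \<and> K \<subseteq> A}. emeasure (density \<kappa> f) K)"
    proof (rule SUP_mono)
      fix K assume "K \<in> {K. K \<subseteq> B n \<and> compact K}"
      then have "K \<in> {K. compact K \<and> K \<subseteq> A}" "emeasure (density \<kappa> g) K = emeasure (density \<kappa> f) K"
        using eq[of K] by (auto simp: B_def borel_compact)
      then show "\<exists>K'\<in>{K. compact K \<and> K \<subseteq> A}. emeasure (density \<kappa> g) K \<le> emeasure (density \<kappa> f) K'" by auto
    qed
    finally show "emeasure (density \<kappa> f) (B n) \<le> (SUP K\<in>{K. compact K \<and> K \<subseteq> A}. emeasure (density \<kappa> f) K)"
      using eq[OF order_refl B] by simp
  qed
  finally show "emeasure (density \<kappa> f) A \<le> (SUP K\<in>{K. compact K \<and> K \<subseteq> A}. emeasure (density \<kappa> f) K)" .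
  show "(SUP K\<in>{K. compact K \<and> K \<subseteq> A}. emeasure (density \<kappa> f) K) \<le> emeasure (density \<kappa> f) A"
    using A s by (intro SUP_least emeasure_mono) auto
qed

text \<open>Passing to complements in \<open>Y\<close>: a Borel hull of \<open>Y - R\<close> is
  removed from \<open>Y\<close>. Because the measures are finite and \<open>R\<close> is measurable,
  the hull exceeds \<open>Y - R\<close> by a null set.\<close>

lemma sph_outer_borel_kernel:
  fixes R Y :: "'n::finite heis set"
  assumes c: "c > 0" and R: "R \<in> sets (sph_measure c)" and Y: "Y \<in> sets borel" "sph_outer c Y < \<infinity>"
  obtains Y' where "Y' \<in> sets borel" "Y' \<subseteq> R \<inter> Y" "sph_outer c (R \<inter> Y - Y') = 0"
proof -
  let ?M = "sph_measure c :: 'n heis measure"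
  have bM: "B \<in> sets ?M" if "B \<in> sets borel" for B using sets_borel_le_sph_measure[OF c] that by blast
  have em: "emeasure ?M B = sph_outer c B" if "B \<in> sets ?M" for B
    by (rule emeasure_sph_measure[OF c that])
  have "sph_outer c (Y - R) < \<infinity>"
    using sph_outer_mono[OF c, of "Y - R" Y] Y(2) by (auto intro: le_less_trans)
  then obtain B where B: "B \<in> sets borel" "Y - R \<subseteq> B" "sph_outer c B = sph_outer c (Y - R)"
    using sph_outer_borel_hull[OF c] by blast
  have s: "Y \<in> sets ?M" "B \<inter> Y \<in> sets ?M" "Y - R \<in> sets ?M" "R \<inter> Y - (Y - B) \<in> sets ?M"
    using bM[OF Y(1)] bM[OF B(1)] R by auto
  have fin: "emeasure ?M (Y - R) < \<infinity>" using \<open>sph_outer c (Y - R) < \<infinity>\<close> em[OF s(3)] by simp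
  have "emeasure ?M (B \<inter> Y) \<le> emeasure ?M (Y - R)"
    unfolding em[OF s(2)] em[OF s(3)] B(3)[symmetric] by (rule sph_outer_mono[OF c]) auto
  moreover have "emeasure ?M (Y - R) \<le> emeasure ?M (B \<inter> Y)" using B(2) s by (intro emeasure_mono) auto
  ultimately have eq: "emeasure ?M (B \<inter> Y) = emeasure ?M (Y - R)" by simp
  have "R \<inter> Y - (Y - B) = B \<inter> Y - (Y - R)" by auto
  then have "emeasure ?M (R \<inter> Y - (Y - B)) = emeasure ?M (B \<inter> Y) - emeasure ?M (Y - R)"
    using B(2) s fin by (simp, intro emeasure_Diff) auto
  then have "emeasure ?M (R \<inter> Y - (Y - B)) = 0" unfolding eq using fin by simp
  then have "sph_outer c (R \<inter> Y - (Y - B)) = 0" using em[OF s(4)] by simp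
  moreover have "Y - B \<in> sets borel" "Y - B \<subseteq> R \<inter> Y" using Y(1) B by auto
  ultimately show ?thesis using that[of "Y - B"] by blast
qed

lemma sph_outer_null_subset: "c > 0 \<Longrightarrow> A \<subseteq> B \<Longrightarrow> sph_outer c B = 0 \<Longrightarrow> sph_outer c A = 0"
  using sph_outer_mono[of c A B] by simp

text \<open>Replaces \<open>R\<close> by a Borel subset of full measure on which the integrand is
  Borel, even though \<open>\<nu>\<close> is an arbitrary selection, and collects there the finite
  pieces and the vanishing over null sets of levels.\<close>

lemma rectifiable_integrand:
  fixes R \<Omega> :: "'n::finite heis set" and u :: "'n heis \<Rightarrow> real" and \<nu> :: "'n heis \<Rightarrow> 'n heis"
  defines "A \<equiv> \<lambda>p. fst (grad_H u p)"
  defines "w \<equiv> \<lambda>p. sqrt ((norm (A p))\<^sup>2 - (fst (\<nu> p) \<bullet> A p)\<^sup>2)"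
  assumes c: "c > 0" and \<Omega>: "open \<Omega>" and u: "Ck_on 2 \<Omega> u" and R\<Omega>: "R \<subseteq> \<Omega>"
    and R: "R \<in> sets (sph_measure c)" and \<nu>: "is_unit_normal c R \<nu>"
  obtains R1 \<Y> where "R1 \<in> sets borel" "R1 \<subseteq> R" "sph_outer c (R - R1) = 0"
    "countable \<Y>" "R1 \<subseteq> \<Union>\<Y>" "\<And>Y. Y \<in> \<Y> \<Longrightarrow> Y \<in> sets borel \<and> sph_outer c Y < \<infinity>"
    "(\<lambda>p. indicator R1 p * w p) \<in> borel_measurable borel"
    "\<And>p. p \<in> R1 \<Longrightarrow> (fst (\<nu> p) \<bullet> A p)\<^sup>2 \<le> (norm (A p))\<^sup>2"
    "\<And>N. N \<in> null_sets lborel \<Longrightarrow> sph_outer c {p \<in> R1. w p \<noteq> 0 \<and> u p \<in> N} = 0"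
proof -
  obtain S where rS: "rectifying_sequence c R S"
    and nS: "\<forall>p\<in>R \<inter> (\<Union>j. S j). is_normal_at (S (LEAST j. p \<in> S j)) p (\<nu> p)"
    using \<nu> unfolding is_unit_normal_def by (elim exE conjE)
  have S: "\<And>j. H_regular (S j)" "sph_outer c (R - (\<Union>j. S j)) = 0"
    using rS unfolding rectifying_sequence_def by simp_all
  \<comment> \<open>On \<open>D j\<close> the least index of a hypersurface containing the point is
    j, so \<open>\<nu>\<close> is a normal of \<open>S j\<close> there.\<close>
  define D where "D j = S j - (\<Union>i<j. S i)" for j
  have D: "D j \<in> sets borel" for j
    unfolding D_def by (intro sets.Diff sets.finite_UN H_regular_borel S(1)) auto
  have DS: "(\<Union>j. S j) \<subseteq> (\<Union>j. D j)"
  proof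
    fix p assume p: "p \<in> (\<Union>j. S j)"
    then obtain j where "p \<in> S j" by blast
    then have "p \<in> S (LEAST j. p \<in> S j)" by (rule LeastI)
    then have "p \<in> D (LEAST j. p \<in> S j)" unfolding D_def by (auto dest: not_less_Least)
    then show "p \<in> (\<Union>j. D j)" by blast
  qed
  have normal: "is_normal_at (S j) p (\<nu> p)" if "p \<in> R" "p \<in> D j" for p j
  proof -
    have "(LEAST j. p \<in> S j) = j"
      using that(2) unfolding D_def by (intro Least_equality) (auto intro!: leI)
    moreover have "p \<in> R \<inter> (\<Union>j. S j)" using that unfolding D_def by blast
    ultimately show ?thesis using nS by metis
  qed
  have cA: "continuous_on \<Omega> A"
    using Ck_on_hgrad_on[OF \<Omega>, of u] Ck_on_Suc_imp[of 1 \<Omega> u] u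
    unfolding A_def hgrad_on_def by (simp add: numeral_2_eq_2)
  define good where "good j V \<longleftrightarrow> V \<subseteq> \<Omega> \<and> S j \<inter> V \<in> sets borel \<and> sph_outer c (S j \<inter> V) < \<infinity> \<and>
    (\<exists>F. continuous_on V F \<and> (\<forall>q\<in>V. F q \<noteq> 0) \<and>
      (\<forall>q\<in>S j \<inter> V. \<forall>v a. is_normal_at (S j) q v \<longrightarrow> (fst v \<bullet> a)\<^sup>2 = (F q \<bullet> a)\<^sup>2 / (norm (F q))\<^sup>2))" for j V
  have "\<forall>j. \<exists>\<V>. countable \<V> \<and> S j \<inter> \<Omega> \<subseteq> \<Union>\<V> \<and> (\<forall>V\<in>\<V>. open V \<and> good j V)"
  proof
    fix j
    have "\<exists>V. open V \<and> p \<in> V \<and> good j V" if "p \<in> S j \<inter> \<Omega>" for p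
      using H_regular_local[OF c S(1) _ _ \<Omega>, of p j] that unfolding good_def by blast
    then obtain \<V> where "countable \<V>" "S j \<inter> \<Omega> \<subseteq> \<Union>\<V>" "\<And>V. V \<in> \<V> \<Longrightarrow> open V \<and> good j V"
      using Lindelof_neighbourhoods[of "S j \<inter> \<Omega>" "good j"] by metis
    then show "\<exists>\<V>. countable \<V> \<and> S j \<inter> \<Omega> \<subseteq> \<Union>\<V> \<and> (\<forall>V\<in>\<V>. open V \<and> good j V)" by blast
  qed
  then obtain \<V> where \<V>: "\<And>j. countable (\<V> j)" "\<And>j. S j \<inter> \<Omega> \<subseteq> \<Union>(\<V> j)"
    "\<And>j V. V \<in> \<V> j \<Longrightarrow> open V \<and> good j V" by metis
  \<comment> \<open>Countably many Borel pieces of finite measure, each with its own continuous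
    field representing the normal.\<close>
  define \<Y> where "\<Y> = (\<Union>j. (\<lambda>V. D j \<inter> V) ` \<V> j)"
  have cY: "countable \<Y>" unfolding \<Y>_def using \<V>(1) by auto
  have Y: "Y \<in> sets borel" "sph_outer c Y < \<infinity>"
    "\<exists>F. Y \<subseteq> \<Omega> \<and> continuous_on Y F \<and> (\<forall>q\<in>Y. F q \<noteq> 0) \<and>
      (\<forall>q\<in>R \<inter> Y. \<forall>a. (fst (\<nu> q) \<bullet> a)\<^sup>2 = (F q \<bullet> a)\<^sup>2 / (norm (F q))\<^sup>2)" if YY: "Y \<in> \<Y>" for Y
  proof -
    obtain j V where jV: "V \<in> \<V> j" "Y = D j \<inter> V" using YY unfolding \<Y>_def by blast
    note g = \<V>(3)[OF jV(1)]
    have "V \<in> sets borel" using g by (intro borel_open) blast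
    then show "Y \<in> sets borel" using D jV(2) by blast
    have sub: "Y \<subseteq> S j \<inter> V" using jV(2) by (auto simp: D_def)
    show "sph_outer c Y < \<infinity>"
      using le_less_trans[OF sph_outer_mono[OF c sub]] g unfolding good_def by blast
    obtain F where F: "continuous_on V F" "\<forall>q\<in>V. F q \<noteq> 0"
        "\<And>q v a. q \<in> S j \<inter> V \<Longrightarrow> is_normal_at (S j) q v \<Longrightarrow> (fst v \<bullet> a)\<^sup>2 = (F q \<bullet> a)\<^sup>2 / (norm (F q))\<^sup>2"
      using g unfolding good_def by blast
    show "\<exists>F. Y \<subseteq> \<Omega> \<and> continuous_on Y F \<and> (\<forall>q\<in>Y. F q \<noteq> 0) \<and>
      (\<forall>q\<in>R \<inter> Y. \<forall>a. (fst (\<nu> q) \<bullet> a)\<^sup>2 = (F q \<bullet> a)\<^sup>2 / (norm (F q))\<^sup>2)"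
    proof (intro exI[of _ F] conjI ballI allI)
      show "Y \<subseteq> \<Omega>" using g sub unfolding good_def by blast
      show "continuous_on Y F" using continuous_on_subset[OF F(1)] sub by blast
      show "F q \<noteq> 0" if "q \<in> Y" for q using F(2) sub that by blast
      show "(fst (\<nu> q) \<bullet> a)\<^sup>2 = (F q \<bullet> a)\<^sup>2 / (norm (F q))\<^sup>2" if "q \<in> R \<inter> Y" for q a
        using F(3)[OF _ normal[of q j]] that sub jV(2) by blast
    qed
  qed
  have "\<forall>Y\<in>\<Y>. \<exists>Y'. Y' \<in> sets borel \<and> Y' \<subseteq> R \<inter> Y \<and> sph_outer c (R \<inter> Y - Y') = 0"
    using sph_outer_borel_kernel[OF c R Y(1,2)] by metis
  then obtain K where K: "\<And>Y. Y \<in> \<Y> \<Longrightarrow> K Y \<in> sets borel \<and> K Y \<subseteq> R \<inter> Y \<and> sph_outer c (R \<inter> Y - K Y) = 0"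
    by metis
  define R1 where "R1 = (\<Union>Y\<in>\<Y>. K Y)"
  have R1b: "R1 \<in> sets borel" unfolding R1_def using cY K by (intro sets.countable_UN') auto
  have R1R: "R1 \<subseteq> R" "R1 \<subseteq> \<Union>\<Y>" unfolding R1_def using K by blast+
  have "sph_outer c (R - R1) = 0"
  proof -
    have "R - R1 \<subseteq> \<Union>(insert (R - (\<Union>j. S j)) ((\<lambda>Y. R \<inter> Y - K Y) ` \<Y>))"
    proof
      fix p assume p: "p \<in> R - R1"
      show "p \<in> \<Union>(insert (R - (\<Union>j. S j)) ((\<lambda>Y. R \<inter> Y - K Y) ` \<Y>))"
      proof (cases "p \<in> (\<Union>j. S j)")
        case True
        then obtain j where j: "p \<in> D j" using DS by blast
        moreover have "p \<in> S j \<inter> \<Omega>" using j p R\<Omega> by (auto simp: D_def)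
        then obtain V where V: "V \<in> \<V> j" "p \<in> V" using \<V>(2) by blast
        ultimately have "D j \<inter> V \<in> \<Y>" "p \<in> D j \<inter> V" unfolding \<Y>_def by blast+
        then show ?thesis using p unfolding R1_def by blast
      qed (use p in blast)
    qed
    moreover have "sph_outer c (\<Union>(insert (R - (\<Union>j. S j)) ((\<lambda>Y. R \<inter> Y - K Y) ` \<Y>))) = 0"
      using cY K S(2) by (intro sph_outer_countable_null[OF c]) auto
    ultimately show ?thesis by (rule sph_outer_null_subset[OF c])
  qed
  have inner_le: "(fst (\<nu> p) \<bullet> A p)\<^sup>2 \<le> (norm (A p))\<^sup>2" if p: "p \<in> R1" for p
  proof -
    obtain Y where "Y \<in> \<Y>" "p \<in> R \<inter> Y" using p R1R by blast
    then obtain F where F: "F p \<noteq> 0" "(fst (\<nu> p) \<bullet> A p)\<^sup>2 = (F p \<bullet> A p)\<^sup>2 / (norm (F p))\<^sup>2"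
      using Y(3) by blast
    have "(F p \<bullet> A p)\<^sup>2 \<le> (norm (F p))\<^sup>2 * (norm (A p))\<^sup>2"
      using Cauchy_Schwarz_ineq[of "F p" "A p"] by (simp add: power2_norm_eq_inner)
    moreover have "(norm (F p))\<^sup>2 > 0" using F(1) by simp
    ultimately show ?thesis unfolding F(2) by (simp only: pos_divide_le_eq mult.commute)
  qed
  have "(\<lambda>p. indicator R1 p * w p) \<in> borel_measurable borel"
  proof (rule measurable_piecewise_restrict[where C = "insert (- R1) ((\<lambda>Y. R1 \<inter> Y) ` \<Y>)"])
    show "countable (insert (- R1) ((\<lambda>Y. R1 \<inter> Y) ` \<Y>))" using cY by simp
    show "X \<inter> space borel \<in> sets borel" if "X \<in> insert (- R1) ((\<lambda>Y. R1 \<inter> Y) ` \<Y>)" for X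
      using that R1b Y(1) by auto
    show "space borel \<subseteq> \<Union>(insert (- R1) ((\<lambda>Y. R1 \<inter> Y) ` \<Y>))" using R1R(2) by auto
    fix X assume "X \<in> insert (- R1) ((\<lambda>Y. R1 \<inter> Y) ` \<Y>)"
    then consider "X = - R1" | Y where "Y \<in> \<Y>" "X = R1 \<inter> Y" by blast
    then show "(\<lambda>p. indicator R1 p * w p) \<in> borel_measurable (restrict_space borel X)"
    proof cases
      case 1
      then show ?thesis by (subst measurable_cong[of _ _ "\<lambda>_. 0"]) (auto simp: space_restrict_space)
    next
      case 2
      then obtain F where F: "Y \<subseteq> \<Omega>" "continuous_on Y F" "\<forall>q\<in>Y. F q \<noteq> 0"
        "\<forall>q\<in>R \<inter> Y. \<forall>a. (fst (\<nu> q) \<bullet> a)\<^sup>2 = (F q \<bullet> a)\<^sup>2 / (norm (F q))\<^sup>2"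
        using Y(3) by blast
      \<comment> \<open>The integrand rewritten through the continuous field of the piece; the sign
        of the normal has dropped out by squaring.\<close>
      define \<omega> where "\<omega> q = sqrt ((norm (A q))\<^sup>2 - (F q \<bullet> A q)\<^sup>2 / (norm (F q))\<^sup>2)" for q
      have XY: "X \<subseteq> Y" "X \<subseteq> \<Omega>" using F(1) 2(2) by blast+
      have cF: "continuous_on X F" by (rule continuous_on_subset[OF F(2) XY(1)])
      have cAX: "continuous_on X A" by (rule continuous_on_subset[OF cA XY(2)])
      have "continuous_on X \<omega>" unfolding \<omega>_def
        using F(3) XY by (intro continuous_on_real_sqrt continuous_on_diff continuous_on_power continuous_on_norm
            continuous_on_divide continuous_on_inner cF cAX) auto
      then have "\<omega> \<in> borel_measurable (restrict_space borel X)"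
        by (rule borel_measurable_continuous_on_restrict)
      moreover have "indicator R1 p * w p = \<omega> p" if "p \<in> X" for p
      proof -
        have "p \<in> R1" "p \<in> R \<inter> Y" using that 2(2) R1R(1) by blast+
        then show ?thesis using F(4) by (simp add: w_def \<omega>_def del: split_paired_All)
      qed
      ultimately show ?thesis
        by (subst measurable_cong[of _ _ \<omega>]) (simp_all add: space_restrict_space)
    qed
  qed
  moreover have "sph_outer c {p \<in> R1. w p \<noteq> 0 \<and> u p \<in> N} = 0" if N: "N \<in> null_sets lborel" for N
  proof -
    define thin where "thin j V \<longleftrightarrow> (\<forall>N\<in>null_sets lborel. sph_outer c {q \<in> S j \<inter> V. u q \<in> N} = 0)" for j V
    have part: "sph_outer c {p \<in> R1 \<inter> D j. w p \<noteq> 0 \<and> u p \<in> N} = 0" for j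
    proof -
      let ?E = "{p \<in> R1 \<inter> D j. w p \<noteq> 0}"
      \<comment> \<open>That \<open>w\<close> is nonzero at p means that squared norm and squared
        inner product differ, which is the transversality asked for in
        \<open>normal_slice_null\<close>.\<close>
      have ex: "\<exists>V. open V \<and> p \<in> V \<and> thin j V" if p: "p \<in> ?E" for p
      proof -
        have "is_normal_at (S j) p (\<nu> p)" "p \<in> \<Omega>" using p normal R1R(1) R\<Omega> by blast+
        moreover have "(norm (A p))\<^sup>2 \<noteq> (fst (\<nu> p) \<bullet> A p)\<^sup>2" using p by (auto simp: w_def)
        ultimately show ?thesis
          unfolding thin_def A_def by (intro normal_slice_null[OF c _ _ \<Omega> u])
      qed
      obtain \<W> where W: "countable \<W>" "?E \<subseteq> \<Union>\<W>" "\<And>V. V \<in> \<W> \<Longrightarrow> open V \<and> thin j V"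
        by (rule Lindelof_neighbourhoods[of ?E "thin j"], rule ex, assumption, rule that; assumption)
      have "{p \<in> R1 \<inter> D j. w p \<noteq> 0 \<and> u p \<in> N} \<subseteq> \<Union>((\<lambda>V. {q \<in> S j \<inter> V. u q \<in> N}) ` \<W>)"
      proof
        fix p assume p: "p \<in> {p \<in> R1 \<inter> D j. w p \<noteq> 0 \<and> u p \<in> N}"
        then obtain V where "V \<in> \<W>" "p \<in> V" using W(2) by blast
        moreover have "p \<in> S j" using p by (simp add: D_def)
        ultimately show "p \<in> \<Union>((\<lambda>V. {q \<in> S j \<inter> V. u q \<in> N}) ` \<W>)" using p by blast
      qed
      moreover have "sph_outer c (\<Union>((\<lambda>V. {q \<in> S j \<inter> V. u q \<in> N}) ` \<W>)) = 0"
        using W N unfolding thin_def by (intro sph_outer_countable_null[OF c]) auto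
      ultimately show ?thesis by (rule sph_outer_null_subset[OF c])
    qed
    have "{p \<in> R1. w p \<noteq> 0 \<and> u p \<in> N} \<subseteq> (\<Union>j. {p \<in> R1 \<inter> D j. w p \<noteq> 0 \<and> u p \<in> N})"
    proof
      fix p assume p: "p \<in> {p \<in> R1. w p \<noteq> 0 \<and> u p \<in> N}"
      then have "p \<in> \<Union>\<Y>" using R1R(2) by blast
      then obtain j where "p \<in> D j" unfolding \<Y>_def by blast
      then show "p \<in> (\<Union>j. {p \<in> R1 \<inter> D j. w p \<noteq> 0 \<and> u p \<in> N})" using p by blast
    qed
    then show ?thesis by (rule sph_outer_null_subset[OF c _ sph_outer_UN_null[OF part]])
  qed
  ultimately show ?thesis
    using \<open>sph_outer c (R - R1) = 0\<close> Y(1,2) by (intro that[OF R1b R1R(1) _ cY R1R(2) _ _ inner_le]) simp_all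
qed

theorem theorem1p5:
  fixes \<Omega> R :: "'n::finite heis set"
    and u :: "'n heis \<Rightarrow> real"
    and \<nu> :: "'n heis \<Rightarrow> 'n heis"
    and c :: real
  assumes "perimeter_normalized TYPE('n) c"
    and "open \<Omega>"
    and "smooth_on \<Omega> u"
    and "R \<subseteq> \<Omega>"
    and "H_rectifiable c R"
    and "is_unit_normal c R \<nu>"
  shows "\<exists>\<mu> :: real \<Rightarrow> 'n heis measure.
    (AE s in lborel. radon_slice c \<Omega> R (level_set \<Omega> u s) (\<mu> s)) \<and>
    (\<forall>h \<in> borel_measurable (restrict_space borel \<Omega>). (\<forall>p\<in>\<Omega>. 0 \<le> h p) \<longrightarrow>
      (\<lambda>s. \<integral>\<^sup>+ p. ennreal (h p * (g_norm p (grad_H u p) / g_norm p (grad u p))) \<partial>\<mu> s)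
        \<in> borel_measurable lebesgue \<and>
      (\<integral>\<^sup>+ s. (\<integral>\<^sup>+ p. ennreal (h p * (g_norm p (grad_H u p) / g_norm p (grad u p))) \<partial>\<mu> s) \<partial>lebesgue) =
      (\<integral>\<^sup>+ p\<in>R. ennreal (h p * sqrt ((g_norm p (grad_H u p))\<^sup>2
                                - (g_inner p (\<nu> p) (grad_H u p))\<^sup>2)) \<partial>sph_measure c))"
proof -
  have c: "c > 0" using assms(1) unfolding perimeter_normalized_def by (rule conjunct1)
  note \<Omega> = assms(2)
  have \<Omega>b: "\<Omega> \<in> sets borel" using \<Omega> by (rule borel_open)
  have u: "Ck_on k \<Omega> u" for k using assms(3) by (simp add: smooth_on_def)
  have R: "R \<in> sets (sph_measure c)" using assms(5) by (simp add: H_rectifiable_def)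
  define A where "A p = fst (grad_H u p)" for p
  define w where "w p = sqrt ((norm (A p))\<^sup>2 - (fst (\<nu> p) \<bullet> A p)\<^sup>2)" for p
  show ?thesis
  proof (rule rectifiable_integrand[OF c \<Omega> u assms(4) R assms(6)], goal_cases)
    case (1 R1 \<Y>)
    note R1b = 1(1) and R1R = 1(2) and R1null = 1(3) and Y = 1(4,5,6)
    have Wm: "(\<lambda>p. indicator R1 p * w p) \<in> borel_measurable borel" using 1(7) unfolding w_def A_def .
    have inner_le: "(fst (\<nu> p) \<bullet> A p)\<^sup>2 \<le> (norm (A p))\<^sup>2" if "p \<in> R1" for p using 1(8)[OF that] unfolding A_def .
    have thin: "sph_outer c {p \<in> R1. w p \<noteq> 0 \<and> u p \<in> N} = 0" if "N \<in> null_sets lborel" for N using 1(9)[OF that] unfolding w_def A_def .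
    have R1\<Omega>: "R1 \<subseteq> \<Omega>" using R1R assms(4) by blast

    \<comment> \<open>Borel extensions of the integrands by zero\<close>
    define W where "W p = indicator R1 p * w p" for p
    define uu where "uu p = indicator \<Omega> p * u p" for p
    define aa where "aa p = indicator \<Omega> p * norm (A p)" for p
    define nn where "nn p = indicator \<Omega> p * g_norm p (grad u p)" for p
    have cA: "continuous_on \<Omega> A" using Ck_on_hgrad_on[OF \<Omega> u] unfolding A_def hgrad_on_def by blast
    have cu: "continuous_on \<Omega> u" using u[of 0] by simp
    have cD: "continuous_on \<Omega> (\<lambda>p. frechet_derivative u (at p) (0, 1))"
      using u[of "Suc 0"] unfolding Ck_on.simps by blast
    have cn: "continuous_on \<Omega> (\<lambda>p. g_norm p (grad u p))"
      unfolding g_norm_grad A_def[symmetric]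
      by (intro continuous_on_real_sqrt continuous_on_add continuous_on_power continuous_on_norm cA cD)
    have ind: "(\<lambda>p. indicator \<Omega> p * g p) \<in> borel_measurable borel" if "continuous_on \<Omega> g" for g :: "'n heis \<Rightarrow> real"
      using borel_measurable_continuous_on_indicator[OF \<Omega>b that] by simp
    have W[measurable]: "W \<in> borel_measurable borel" unfolding W_def by (rule Wm)
    have uum[measurable]: "uu \<in> borel_measurable borel" unfolding uu_def by (rule ind[OF cu])
    have [measurable]: "aa \<in> borel_measurable borel" unfolding aa_def by (rule ind[OF continuous_on_norm[OF cA]])
    have [measurable]: "nn \<in> borel_measurable borel" unfolding nn_def by (rule ind[OF cn])
    note [measurable] = R1b \<Omega>b
    have an: "aa p \<le> nn p" "0 \<le> aa p" "0 \<le> nn p" for p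
      by (auto simp: aa_def nn_def g_norm_grad A_def indicator_def intro!: real_le_rsqrt)
    have w: "0 \<le> w p" "w p \<le> aa p" if "p \<in> R1" for p
    proof -
      show "0 \<le> w p" using inner_le[OF that] by (simp add: w_def)
      have "w p \<le> sqrt ((norm (A p))\<^sup>2)" unfolding w_def by (intro real_sqrt_le_mono) simp
      then show "w p \<le> aa p" using that R1\<Omega> by (auto simp: aa_def)
    qed
    have W0: "0 \<le> W p" "W p \<le> aa p" "W p \<noteq> 0 \<Longrightarrow> p \<in> R1" for p
      using w[of p] an(2)[of p] by (auto simp: W_def indicator_def)
    \<comment> \<open>The slice measures must absorb the inverse of the factor |\<nabla>_H u| /
      |\<nabla>u| occurring in the formula. Where the horizontal gradient vanishes, \<open>W\<close>
      vanishes too, and the quotient is 0 by convention. The bound by \<open>nn\<close> will give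
      local finiteness.\<close>
    define kk where "kk p = W p * (nn p / aa p)" for p
    have [measurable]: "kk \<in> borel_measurable borel" unfolding kk_def by measurable
    have kk0: "0 \<le> kk p" for p using W0(1) an by (simp add: kk_def)
    have kk_le: "kk p \<le> nn p" for p
    proof (cases "aa p = 0")
      case False
      then have "aa p > 0" using an(2)[of p] by simp
      then have "kk p \<le> aa p * (nn p / aa p)" unfolding kk_def using W0(2) an(3)[of p] by (intro mult_right_mono) auto
      then show ?thesis using False by simp
    qed (use an in \<open>simp add: kk_def\<close>)
    have kkW: "aa p / nn p * kk p = W p" for p
    proof (cases "aa p = 0")
      case True
      then show ?thesis using W0(1,2)[of p] by (simp add: kk_def)
    next
      case False
      then have "aa p > 0" "nn p > 0" using an[of p] by linarith+
      then show ?thesis by (simp add: kk_def)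
    qed

    \<comment> \<open>The Borel measure on the rectifiable set and its finite weighting\<close>
    let ?S = "sph_measure c :: 'n heis measure"
    have spS: "space ?S = UNIV" by (simp add: sph_measure_def space_measure_of_conv)
    have idm: "(\<lambda>p. p) \<in> measurable ?S borel"
      using sets_borel_le_sph_measure[OF c, where 'n = 'n] by (auto simp: measurable_def spS)
    have mS: "f \<in> borel_measurable ?S" if "f \<in> borel_measurable borel" for f :: "'n heis \<Rightarrow> ennreal"
      using measurable_compose[OF idm that] .
    have bS: "B \<in> sets ?S" if "B \<in> sets borel" for B
      using sets_borel_le_sph_measure[OF c, where 'n = 'n] that by blast
    \<comment> \<open>The measure restricted to \<open>R1\<close> and transferred from the
      Caratheodory sets to the Borel sets, on which the disintegration is stated.\<close>
    define P where "P = distr (density ?S (indicator R1)) borel (\<lambda>p. p)"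
    have sP: "sets P = sets borel" "space P = UNIV" by (simp_all add: P_def)
    have mP: "measurable P N = measurable borel N" for N :: "'b measure" by (rule measurable_cong_sets[OF sP(1) refl])
    have nnP: "(\<integral>\<^sup>+p. f p \<partial>P) = (\<integral>\<^sup>+p. indicator R1 p * f p \<partial>?S)"
      if f: "f \<in> borel_measurable borel" for f :: "'n heis \<Rightarrow> ennreal"
    proof -
      have "(\<integral>\<^sup>+p. f p \<partial>P) = (\<integral>\<^sup>+p. f p \<partial>density ?S (indicator R1))"
        unfolding P_def using idm f by (intro nn_integral_distr) simp_all
      also have "\<dots> = (\<integral>\<^sup>+p. indicator R1 p * f p \<partial>?S)"
        by (intro nn_integral_density mS f borel_measurable_indicator R1b)
      finally show ?thesis .
    qed
    have emP: "emeasure P B = sph_outer c (B \<inter> R1)" if B: "B \<in> sets borel" for B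
    proof -
      have "emeasure P B = (\<integral>\<^sup>+p. indicator B p \<partial>P)" using B sP by simp
      also have "\<dots> = (\<integral>\<^sup>+p. indicator R1 p * indicator B p \<partial>?S)" using B by (intro nnP) simp
      also have "\<dots> = (\<integral>\<^sup>+p. indicator (B \<inter> R1) p \<partial>?S)"
        by (intro nn_integral_cong) (auto simp: indicator_def)
      also have "\<dots> = emeasure ?S (B \<inter> R1)"
        by (intro nn_integral_indicator bS sets.Int B R1b)
      also have "\<dots> = sph_outer c (B \<inter> R1)" by (intro emeasure_sph_measure c bS sets.Int B R1b)
      finally show ?thesis .
    qed
    have sfP: "sigma_finite_measure P"
    proof (unfold_locales, intro exI[of _ "insert (- R1) \<Y>"] conjI ballI)
      show "countable (insert (- R1) \<Y>)" using Y(1) by simp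
      show "insert (- R1) \<Y> \<subseteq> sets P" using Y(3) R1b by (auto simp: sP)
      show "\<Union>(insert (- R1) \<Y>) = space P" using Y(2) by (auto simp: sP)
      fix B assume "B \<in> insert (- R1) \<Y>"
      then consider "B = - R1" | "B \<in> \<Y>" by blast
      then show "emeasure P B \<noteq> \<infinity>"
      proof cases
        case 1
        have "- R1 \<in> sets borel" using R1b by auto
        then show ?thesis using 1 emP[of "- R1"] sph_outer_empty[OF c, where 'n = 'n] by simp
      next
        case 2
        then have "emeasure P B \<le> sph_outer c B" using Y(3) sph_outer_mono[OF c, of "B \<inter> R1" B] by (simp add: emP)
        then show ?thesis using Y(3)[OF 2] by (auto dest: le_less_trans)
      qed
    qed
    obtain \<rho> where \<rho>m: "\<rho> \<in> borel_measurable P" and \<rho>int: "integral\<^sup>N P \<rho> \<noteq> \<infinity>"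
      and \<rho>: "\<And>p. 0 < \<rho> p \<and> \<rho> p < \<infinity>"
      using sigma_finite_measure.Ex_finite_integrable_function[OF sfP] by (auto simp: sP)
    have [measurable]: "\<rho> \<in> borel_measurable borel" using \<rho>m by (simp add: mP)

    \<comment> \<open>The weight is kept only where \<open>W\<close> is nonzero, because only there
      is the image under \<open>u\<close> known to be absolutely continuous. Nothing is lost, as
      \<open>kk\<close> vanishes elsewhere.\<close>
    define \<rho>' where "\<rho>' p = (if W p \<noteq> 0 then \<rho> p else 0)" for p
    have \<rho>'m[measurable]: "\<rho>' \<in> borel_measurable borel" unfolding \<rho>'_def by measurable
    define M where "M = density P \<rho>'"
    have sM: "sets M = sets borel" by (simp add: M_def sP)
    have emM: "emeasure M B = (\<integral>\<^sup>+p. \<rho>' p * indicator B p \<partial>P)" if "B \<in> sets borel" for B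
      unfolding M_def using that by (intro emeasure_density) (simp_all add: mP sP)
    have finM: "emeasure M UNIV < \<infinity>"
    proof -
      have "emeasure M UNIV \<le> integral\<^sup>N P \<rho>"
        unfolding emM[of UNIV, simplified] by (intro nn_integral_mono) (simp add: \<rho>'_def)
      then show ?thesis using \<rho>int by (auto simp: less_top[symmetric] top_unique)
    qed
    have nullM: "emeasure M (uu -` N) = 0" if N: "N \<in> null_sets lborel" for N
    proof -
      have Nb: "N \<in> sets borel" using N by auto
      have uN: "uu -` N \<in> sets borel" using measurable_sets[of uu borel borel N] Nb by simp
      have Wb: "{p. W p \<noteq> 0} \<in> sets borel" by measurable
      let ?Z = "{p. W p \<noteq> 0} \<inter> uu -` N"
      have Z: "?Z \<in> sets borel" using Wb uN by (rule sets.Int)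
      have "?Z \<inter> R1 \<subseteq> {p \<in> R1. w p \<noteq> 0 \<and> u p \<in> N}"
        using R1\<Omega> by (auto simp: W_def uu_def indicator_def)
      then have "sph_outer c (?Z \<inter> R1) = 0" by (rule sph_outer_null_subset[OF c _ thin[OF N]])
      then have "?Z \<in> null_sets P" using Z by (simp add: null_sets_def emP sP)
      then have "AE p in P. p \<notin> ?Z" by (rule AE_not_in)
      then have "AE p in P. \<rho>' p * indicator (uu -` N) p = 0"
        by eventually_elim (auto simp: \<rho>'_def indicator_def)
      then show ?thesis unfolding emM[OF uN]
        using uN by (subst nn_integral_0_iff_AE) (simp_all add: mP)
    qed

    \<comment> \<open>Construction of the slice measures\<close>
    obtain \<kappa> :: "real \<Rightarrow> 'n heis measure" where s\<kappa>: "\<And>s. sets (\<kappa> s) = sets borel"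
      and fin\<kappa>: "\<And>s. emeasure (\<kappa> s) UNIV < \<infinity>"
      and m\<kappa>: "\<And>h. h \<in> borel_measurable (borel \<Otimes>\<^sub>M borel) \<Longrightarrow> (\<lambda>s. \<integral>\<^sup>+p. h (s, p) \<partial>\<kappa> s) \<in> borel_measurable borel"
      and int\<kappa>: "\<And>h. h \<in> borel_measurable (borel \<Otimes>\<^sub>M borel) \<Longrightarrow>
         (\<integral>\<^sup>+s. \<integral>\<^sup>+p. h (s, p) \<partial>\<kappa> s \<partial>lborel) = (\<integral>\<^sup>+p. h (uu p, p) \<partial>M)"
      using disintegration[where u = uu, OF sM finM uum nullM] by blast
    have mk: "measurable (\<kappa> s) N = measurable borel N" for s and N :: "'b measure"
      by (rule measurable_cong_sets[OF s\<kappa> refl])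
    have sp\<kappa>: "space (\<kappa> s) = UNIV" for s using sets_eq_imp_space_eq[OF s\<kappa>] by simp

    \<comment> \<open>Dividing by \<rho> undoes the weighting. The indicator concentrates the
      measure on the level set, and it costs nothing in the integral over s, where \<open>f\<close>
      is evaluated at level \<open>uu p\<close> at the point p.\<close>
    define f where "f s p = (ennreal (kk p) / \<rho> p) * indicator (R1 \<inter> {p. uu p = s}) p" for s p
    have fpair: "(\<lambda>x. f (fst x) (snd x)) \<in> borel_measurable (borel \<Otimes>\<^sub>M borel)"
    proof -
      have "f (fst x) (snd x) = (if snd x \<in> R1 \<and> uu (snd x) = fst x then ennreal (kk (snd x)) / \<rho> (snd x) else 0)" for x
        by (simp add: f_def indicator_def)
      then show ?thesis by simp
    qed
    have fm: "f s \<in> borel_measurable borel" for s unfolding f_def by measurable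
    have ffin: "f s p < \<infinity>" for s p
      using \<rho>[of p] by (auto simp: f_def indicator_def ennreal_divide_eq_top_iff less_top[symmetric])
    define \<tau> where "\<tau> s = density (\<kappa> s) (f s)" for s
    have s\<tau>: "sets (\<tau> s) = sets borel" "space (\<tau> s) = UNIV" for s by (simp_all add: \<tau>_def s\<kappa> sp\<kappa>)
    have int\<tau>: "(\<integral>\<^sup>+p. H p \<partial>\<tau> s) = (\<integral>\<^sup>+p. f s p * H p \<partial>\<kappa> s)" if "H \<in> borel_measurable borel" for H s
      unfolding \<tau>_def using that fm by (intro nn_integral_density) (simp_all add: mk)
    have slices: "(\<lambda>s. \<integral>\<^sup>+p. H p \<partial>\<tau> s) \<in> borel_measurable borel"
        "(\<integral>\<^sup>+s. \<integral>\<^sup>+p. H p \<partial>\<tau> s \<partial>lborel) = (\<integral>\<^sup>+p. H p * ennreal (kk p) \<partial>P)"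
      if H[measurable]: "H \<in> borel_measurable borel" for H
    proof -
      have h: "(\<lambda>x. f (fst x) (snd x) * H (snd x)) \<in> borel_measurable (borel \<Otimes>\<^sub>M borel)"
        by (intro borel_measurable_times_ennreal fpair measurable_compose[OF measurable_snd H])
      show "(\<lambda>s. \<integral>\<^sup>+p. H p \<partial>\<tau> s) \<in> borel_measurable borel"
        unfolding int\<tau>[OF H] using m\<kappa>[OF h] by simp
      have "(\<integral>\<^sup>+s. \<integral>\<^sup>+p. H p \<partial>\<tau> s \<partial>lborel) = (\<integral>\<^sup>+p. f (uu p) p * H p \<partial>M)"
        unfolding int\<tau>[OF H] using int\<kappa>[OF h] by simp
      also have "\<dots> = (\<integral>\<^sup>+p. \<rho>' p * (f (uu p) p * H p) \<partial>P)"
      proof -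
        have "(\<lambda>p. f (uu p) p * H p) \<in> borel_measurable borel"
          using measurable_compose[of "\<lambda>p. (uu p, p)", OF _ h] by simp
        then show ?thesis unfolding M_def by (intro nn_integral_density) (simp_all add: mP)
      qed
      also have "\<dots> = (\<integral>\<^sup>+p. H p * ennreal (kk p) \<partial>P)"
      proof (intro nn_integral_cong)
        fix p
        show "\<rho>' p * (f (uu p) p * H p) = H p * ennreal (kk p)"
        proof (cases "W p = 0")
          case True
          then show ?thesis by (simp add: \<rho>'_def kk_def)
        next
          case False
          have *: "\<rho> p * (ennreal (kk p) / \<rho> p) = ennreal (kk p)"
            unfolding ennreal_times_divide mult.commute[of "\<rho> p"]
            using \<rho>[of p] by (intro mult_divide_eq_ennreal) auto
          have "\<rho>' p * (f (uu p) p * H p) = \<rho> p * (ennreal (kk p) / \<rho> p) * H p"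
            using False W0(3)[OF False] by (simp add: \<rho>'_def f_def mult.assoc)
          then show ?thesis unfolding * by (simp only: mult.commute)
        qed
      qed
      finally show "(\<integral>\<^sup>+s. \<integral>\<^sup>+p. H p \<partial>\<tau> s \<partial>lborel) = (\<integral>\<^sup>+p. H p * ennreal (kk p) \<partial>P)" .
    qed
    define \<mu> where "\<mu> s = restrict_space (\<tau> s) \<Omega>" for s
    have \<Omega>\<tau>: "\<Omega> \<inter> space (\<tau> s) \<in> sets (\<tau> s)" for s using \<Omega>b by (simp add: s\<tau>)
    have em\<mu>: "emeasure (\<mu> s) B = emeasure (\<tau> s) B" if "B \<subseteq> \<Omega>" for s B
      unfolding \<mu>_def by (rule emeasure_restrict_space[OF \<Omega>\<tau> that])
    have nn\<mu>: "(\<integral>\<^sup>+p. g p \<partial>\<mu> s) = (\<integral>\<^sup>+p. g p * indicator \<Omega> p \<partial>\<tau> s)" for g s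
      unfolding \<mu>_def by (rule nn_integral_restrict_space[OF \<Omega>\<tau>])

    \<comment> \<open>Finiteness on small sets for almost every level\<close>
    obtain \<B> :: "'n heis set set" where \<B>: "countable \<B>" "topological_basis \<B>" using ex_countable_basis by blast
    \<comment> \<open>The masses of \<open>B\<close> integrate over s to at most \<open>C\<close>
      times the measure of \<open>R\<close> in \<open>B\<close>, so they are finite almost
      everywhere. A countable basis then allows one exceptional null set for all
      \<open>B\<close>.\<close>
    have fin_slice: "AE s in lborel. sph_outer c (R \<inter> B) < \<infinity> \<and> (\<exists>C. \<forall>p\<in>B. nn p \<le> C) \<longrightarrow> emeasure (\<tau> s) B < \<infinity>"
      if B: "B \<in> \<B>" for B
    proof (cases "sph_outer c (R \<inter> B) < \<infinity> \<and> (\<exists>C. \<forall>p\<in>B. nn p \<le> C)")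
      case True
      then obtain C where C: "\<forall>p\<in>B. nn p \<le> C" by blast
      have Bb: "B \<in> sets borel" using topological_basis_open[OF \<B>(2) B] by (rule borel_open)
      have em: "emeasure (\<tau> s) B = (\<integral>\<^sup>+p. indicator B p \<partial>\<tau> s)" for s using Bb by (simp add: s\<tau>)
      have "(\<integral>\<^sup>+s. emeasure (\<tau> s) B \<partial>lborel) = (\<integral>\<^sup>+p. indicator B p * ennreal (kk p) \<partial>P)"
        unfolding em using Bb by (intro slices(2)) simp
      also have "\<dots> \<le> (\<integral>\<^sup>+p. ennreal C * indicator B p \<partial>P)"
      proof (intro nn_integral_mono)
        fix p
        show "indicator B p * ennreal (kk p) \<le> ennreal C * indicator B p"
          using C kk_le[of p] by (auto simp: indicator_def intro!: ennreal_leI intro: order_trans)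
      qed
      also have "\<dots> = ennreal C * sph_outer c (B \<inter> R1)" using Bb by (simp add: nn_integral_cmult_indicator sP emP)
      also have "\<dots> < \<infinity>"
      proof -
        have "sph_outer c (B \<inter> R1) \<le> sph_outer c (R \<inter> B)" using R1R by (intro sph_outer_mono[OF c]) blast
        then have "sph_outer c (B \<inter> R1) < top" using True by (auto intro: le_less_trans)
        then show ?thesis by (simp add: ennreal_mult_less_top)
      qed
      finally have "(\<integral>\<^sup>+s. emeasure (\<tau> s) B \<partial>lborel) \<noteq> \<infinity>" by simp
      moreover have "(\<lambda>s. emeasure (\<tau> s) B) \<in> borel_measurable lborel"
        unfolding em using slices(1)[of "indicator B"] Bb by simp
      ultimately have "AE s in lborel. emeasure (\<tau> s) B \<noteq> \<infinity>" by (intro nn_integral_noteq_infinite)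
      then show ?thesis by eventually_elim (simp add: less_top[symmetric])
    next
      case False
      then show ?thesis by (intro always_eventually allI impI) (elim notE)
    qed
    have AE_fin: "AE s in lborel. \<forall>B\<in>\<B>. sph_outer c (R \<inter> B) < \<infinity> \<and> (\<exists>C. \<forall>p\<in>B. nn p \<le> C) \<longrightarrow> emeasure (\<tau> s) B < \<infinity>"
      using fin_slice \<B>(1) by (simp add: AE_ball_countable)

    \<comment> \<open>The Radon property of a slice\<close>
    have radon: "radon_slice c \<Omega> R (level_set \<Omega> u s) (\<mu> s)"
      if fin: "\<forall>B\<in>\<B>. sph_outer c (R \<inter> B) < \<infinity> \<and> (\<exists>C. \<forall>p\<in>B. nn p \<le> C) \<longrightarrow> emeasure (\<tau> s) B < \<infinity>" for s
      unfolding radon_slice_def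
    proof (intro conjI ballI impI)
      let ?G = "R1 \<inter> {p. uu p = s}"
      have G: "?G \<in> sets borel" by measurable
      have GL: "?G \<subseteq> R \<inter> level_set \<Omega> u s"
        using R1R R1\<Omega> by (auto simp: level_set_def uu_def indicator_def)
      show s\<mu>: "sets (\<mu> s) = sets (restrict_space borel \<Omega>)"
        unfolding \<mu>_def by (intro sets_restrict_space_cong s\<tau>)
      have offG: "AE p in \<tau> s. p \<in> ?G"
        unfolding \<tau>_def by (subst AE_density) (auto simp: mk fm f_def indicator_def)
      then have "AE p in \<tau> s. p \<in> \<Omega> \<longrightarrow> p \<in> R \<inter> level_set \<Omega> u s" by eventually_elim (use GL in blast)
      then show "AE p in \<mu> s. p \<in> R \<inter> level_set \<Omega> u s"
        unfolding \<mu>_def AE_restrict_space_iff[OF \<Omega>\<tau>] .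
      interpret K: finite_measure "\<kappa> s" using fin\<kappa>[of s] by (intro finite_measureI) (simp add: sp\<kappa>)
      have "sigma_finite_measure (\<tau> s)"
        unfolding \<tau>_def using ffin[of s]
        by (subst K.sigma_finite_iff_density_finite') (auto simp: mk fm less_top)
      then show "sigma_finite_measure (\<mu> s)"
        unfolding \<mu>_def using \<Omega>b by (intro sigma_finite_measure_restrict_space) (simp_all add: s\<tau>)
      show "emeasure (\<mu> s) B = (SUP K\<in>{K. compact K \<and> K \<subseteq> B \<inter> R \<inter> level_set \<Omega> u s}. emeasure (\<mu> s) K)"
        if "B \<in> sets (\<mu> s)" for B
      proof (rule antisym)
        have B: "B \<in> sets borel" "B \<subseteq> \<Omega>"
          using that \<Omega>b unfolding s\<mu> by (auto simp: sets_restrict_space_iff)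
        have BG: "B \<inter> ?G \<in> sets borel" by (intro sets.Int B(1) G)
        have "emeasure (\<mu> s) B = emeasure (\<tau> s) B" by (rule em\<mu>[OF B(2)])
        also have "\<dots> = emeasure (\<tau> s) (B \<inter> ?G)"
          using offG by (intro emeasure_eq_AE) (use B BG in \<open>auto simp: s\<tau>\<close>)
        also have "\<dots> = (SUP K\<in>{K. compact K \<and> K \<subseteq> B \<inter> ?G}. emeasure (\<tau> s) K)"
          unfolding \<tau>_def by (rule inner_regular_density[OF s\<kappa> fin\<kappa> fm ffin BG])
        also have "\<dots> \<le> (SUP K\<in>{K. compact K \<and> K \<subseteq> B \<inter> R \<inter> level_set \<Omega> u s}. emeasure (\<mu> s) K)"
        proof (rule SUP_mono)
          fix K assume K: "K \<in> {K. compact K \<and> K \<subseteq> B \<inter> ?G}"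
          then have "K \<in> {K. compact K \<and> K \<subseteq> B \<inter> R \<inter> level_set \<Omega> u s}" "K \<subseteq> \<Omega>" using GL B(2) by blast+
          then show "\<exists>K'\<in>{K. compact K \<and> K \<subseteq> B \<inter> R \<inter> level_set \<Omega> u s}. emeasure (\<tau> s) K \<le> emeasure (\<mu> s) K'"
            using em\<mu>[of K s] by (intro bexI[of _ K]) simp_all
        qed
        finally show "emeasure (\<mu> s) B \<le> (SUP K\<in>{K. compact K \<and> K \<subseteq> B \<inter> R \<inter> level_set \<Omega> u s}. emeasure (\<mu> s) K)" .
        show "(SUP K\<in>{K. compact K \<and> K \<subseteq> B \<inter> R \<inter> level_set \<Omega> u s}. emeasure (\<mu> s) K) \<le> emeasure (\<mu> s) B"
          using that by (intro SUP_least emeasure_mono) auto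
      qed
      fix p assume p: "p \<in> \<Omega>" and "locally_finite_at (\<lambda>V. sph_outer c (R \<inter> V)) p"
      then obtain V where V: "open V" "p \<in> V" "sph_outer c (R \<inter> V) < \<infinity>" unfolding locally_finite_at_def by blast
      obtain \<delta> where \<delta>: "\<delta> > 0" "cball p \<delta> \<subseteq> \<Omega>" using \<Omega> p open_contains_cball by blast
      obtain C where C: "C > 0" "\<And>q. q \<in> cball p \<delta> \<Longrightarrow> \<bar>g_norm q (grad u q)\<bar> \<le> C"
        using bounded_on_compact_real[OF compact_cball continuous_on_subset[OF cn \<delta>(2)]] by blast
      \<comment> \<open>A basis set inside this intersection has both properties used for
        finiteness: finite measure of \<open>R\<close> and a bound on the full gradient.\<close>
      have "open (V \<inter> ball p \<delta>)" "p \<in> V \<inter> ball p \<delta>" using V \<delta>(1) by auto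
      then obtain B where B: "B \<in> \<B>" "p \<in> B" "B \<subseteq> V \<inter> ball p \<delta>"
        using topological_basisE[OF \<B>(2)] by metis
      have "nn q \<le> C" if "q \<in> B" for q
      proof -
        have "q \<in> cball p \<delta>" using B(3) that by (auto simp: less_imp_le)
        then show ?thesis using abs_le_D1[OF C(2)[of q]] C(1) by (simp add: nn_def indicator_def)
      qed
      moreover have "sph_outer c (R \<inter> B) < \<infinity>"
        by (rule le_less_trans[OF sph_outer_mono[OF c] V(3)]) (use B(3) in blast)
      ultimately have "emeasure (\<tau> s) B < \<infinity>" using fin B(1) by blast
      moreover have B\<Omega>: "B \<subseteq> \<Omega>" using B(3) \<delta>(2) ball_subset_cball[of p \<delta>] by blast
      moreover have "\<Omega> \<inter> B = B" using B\<Omega> by blast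
      ultimately have "emeasure (\<mu> s) (\<Omega> \<inter> B) < \<infinity>" using em\<mu>[of B s] by simp
      then show "locally_finite_at (\<lambda>V. emeasure (\<mu> s) (\<Omega> \<inter> V)) p"
        unfolding locally_finite_at_def using topological_basis_open[OF \<B>(2) B(1)] B(2) by blast
    qed

    \<comment> \<open>The coarea formula\<close>
    show ?thesis
    proof (intro exI[of _ \<mu>] conjI ballI impI)
      show "AE s in lborel. radon_slice c \<Omega> R (level_set \<Omega> u s) (\<mu> s)"
        using AE_fin by eventually_elim (rule radon)
      fix h :: "'n heis \<Rightarrow> real" assume h: "h \<in> borel_measurable (restrict_space borel \<Omega>)" and h0: "\<forall>p\<in>\<Omega>. 0 \<le> h p"
      define hh where "hh p = indicator \<Omega> p * h p" for p
      have [measurable]: "hh \<in> borel_measurable borel"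
        using h \<Omega>b unfolding hh_def by (simp add: borel_measurable_restrict_space_iff)
      have hh0: "0 \<le> hh p" for p using h0 by (simp add: hh_def indicator_def)
      define H where "H p = ennreal (hh p * (aa p / nn p))" for p
      have Hm: "H \<in> borel_measurable borel" unfolding H_def by measurable
      have eq: "(\<integral>\<^sup>+ p. ennreal (h p * (g_norm p (grad_H u p) / g_norm p (grad u p))) \<partial>\<mu> s) = (\<integral>\<^sup>+p. H p \<partial>\<tau> s)" for s
        unfolding nn\<mu> by (intro nn_integral_cong)
          (simp add: H_def hh_def aa_def nn_def g_norm_grad_H A_def indicator_def)
      show "(\<lambda>s. \<integral>\<^sup>+ p. ennreal (h p * (g_norm p (grad_H u p) / g_norm p (grad u p))) \<partial>\<mu> s) \<in> borel_measurable lebesgue"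
        unfolding eq using slices(1)[OF Hm] by (intro measurable_completion) simp
      have "(\<integral>\<^sup>+ s. (\<integral>\<^sup>+ p. ennreal (h p * (g_norm p (grad_H u p) / g_norm p (grad u p))) \<partial>\<mu> s) \<partial>lebesgue)
          = (\<integral>\<^sup>+s. \<integral>\<^sup>+p. H p \<partial>\<tau> s \<partial>lborel)"
        unfolding eq by (rule nn_integral_completion)
      also have "\<dots> = (\<integral>\<^sup>+p. H p * ennreal (kk p) \<partial>P)" by (rule slices(2)[OF Hm])
      also have "\<dots> = (\<integral>\<^sup>+p. indicator R1 p * (H p * ennreal (kk p)) \<partial>?S)"
        by (rule nnP) (use Hm in measurable)
      also have "\<dots> = (\<integral>\<^sup>+ p\<in>R. ennreal (h p * sqrt ((g_norm p (grad_H u p))\<^sup>2 - (g_inner p (\<nu> p) (grad_H u p))\<^sup>2)) \<partial>?S)"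
      proof (rule nn_integral_cong_AE)
        have "AE p in ?S. p \<notin> R - R1" by (rule AE_not_in[OF sph_outer_null_sets[OF c R1null]])
        then show "AE p in ?S. indicator R1 p * (H p * ennreal (kk p)) =
            ennreal (h p * sqrt ((g_norm p (grad_H u p))\<^sup>2 - (g_inner p (\<nu> p) (grad_H u p))\<^sup>2)) * indicator R p"
        proof eventually_elim
          fix p assume p: "p \<notin> R - R1"
          \<comment> \<open>The gradient quotient in \<open>H\<close> cancels the inverse quotient
            in \<open>kk\<close> and leaves the tangential density \<open>W\<close>.\<close>
          have Hk: "H p * ennreal (kk p) = ennreal (hh p * W p)"
            unfolding H_def kkW[symmetric] mult.assoc[symmetric] using hh0[of p] an[of p] kk0[of p]
            by (intro ennreal_mult[symmetric] mult_nonneg_nonneg divide_nonneg_nonneg)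
          show "indicator R1 p * (H p * ennreal (kk p)) =
            ennreal (h p * sqrt ((g_norm p (grad_H u p))\<^sup>2 - (g_inner p (\<nu> p) (grad_H u p))\<^sup>2)) * indicator R p"
          proof (cases "p \<in> R1")
            case True
            then have "p \<in> R" "p \<in> \<Omega>" using R1R R1\<Omega> by blast+
            then show ?thesis unfolding Hk using True
              by (simp add: hh_def W_def w_def g_norm_grad_H g_inner_grad_H A_def)
          next
            case False
            then have "p \<notin> R" using p by blast
            then show ?thesis using False by simp
          qed
        qed
      qed
      finally show "(\<integral>\<^sup>+ s. (\<integral>\<^sup>+ p. ennreal (h p * (g_norm p (grad_H u p) / g_norm p (grad u p))) \<partial>\<mu> s) \<partial>lebesgue) =
        (\<integral>\<^sup>+ p\<in>R. ennreal (h p * sqrt ((g_norm p (grad_H u p))\<^sup>2 - (g_inner p (\<nu> p) (grad_H u p))\<^sup>2)) \<partial>?S)" .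
    qed
  qed
qed

end
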